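(* Let $\Pi$ be the preprojective algebra of a simply laced Dynkin diagram over an arbitrary field, and let $W$ be the corresponding Weyl group with the (right) weak order. The map $j\mapsto I(j_* )/I(j)$ takes the join-irreducible labelling of $W$ to the layer labelling of $W$. That is, if a Hasse arrow $ws_i\to w$ of $W$ is labelled (in the join-irreducible labelling) by the join-irreducible element $j$, which covers the unique element $j_*$, then the layer label on $ws_i\to w$ is $I(j_* )/I(j)$; i.e. $I(w)/I(ws_i)\simeq I(j_* )/I(j)$ as $\Pi$-modules.
   Context: Let $\Delta$ be a simply laced Dynkin diagram ($A_n$ with $n\ge1$, $D_n$ with $n\ge4$, or $E_6,E_7,E_8$) and $k$ a field. Fix an orientation $Q$ of $\Delta$ and let $\overline Q$ be obtained by adding an opposite arrow $a^*$ for each arrow $a$ of $Q$. The preprojective algebra is $\Pi=k\overline Q/\langle\sum_a(aa^*-a^*a)\rangle$. Modules are finite-dimensional left modules; $e_i$ is the idempotent at vertex $i$. $W$ is the Weyl group with simple reflections $s_i$ and length $\ell$. The (right) weak order is: $u\ge v$ iff $\ell(u)=\ell(v)+\ell(v^{-1}u)$; it is a lattice. Hasse arrows $x\to y$ ($x$ covers $y$) are exactly the $ws_i\to w$ with $\ell(ws_i)=\ell(w)+1$. Let $I_i=\Pi(1-e_i)\Pi$ and, for a reduced word $w=s_{i_1}\cdots s_{i_m}$, let $I(w)=I_{i_1}\cdots I_{i_m}$ (independent of the reduced word; $I(e)=\Pi$). Layer labelling: the Hasse arrow $ws_i\to w$ is labelled by (the isomorphism class of) the $\Pi$-module $I(w)/I(ws_i)$.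 Join-irreducible labelling: an element $j$ is join-irreducible if it covers exactly one element, denoted $j_*$. For a Hasse arrow $x\to y$, $\mathsf{con}(x,y)$ is the smallest (finest) lattice congruence on $W$ with $x\equiv y$. The weak order on $W$ is congruence uniform, so for each Hasse arrow $x\to y$ there is a unique join-irreducible $j\in W$ with $\mathsf{con}(j,j_* )=\mathsf{con}(x,y)$; this $j$ is the join-irreducible label of $x\to y$. *)

theory Defs
  imports "HOL-Algebra.Lattice" "HOL-Algebra.QuotRing" "HOL-Algebra.Ideal_Product" "HOL-Algebra.Module"
begin

section \<open>Simply laced Dynkin diagrams and orientations\<close>

text \<open>A diagram is a finite simple graph, given by its vertex set \<open>V\<close> and its set \<open>E\<close> of
  edges, each edge being an unordered pair of vertices.\<close>

datatype dynkin_type = TypeA nat | TypeD nat | TypeE nat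

fun valid_type :: "dynkin_type \<Rightarrow> bool" where
  "valid_type (TypeA n) \<longleftrightarrow> n \<ge> 1"
| "valid_type (TypeD n) \<longleftrightarrow> n \<ge> 4"
| "valid_type (TypeE n) \<longleftrightarrow> n \<in> {6, 7, 8}"

fun type_verts :: "dynkin_type \<Rightarrow> nat set" where
  "type_verts (TypeA n) = {1..n}"
| "type_verts (TypeD n) = {1..n}"
| "type_verts (TypeE n) = {1..n}"

text \<open>The numbering of the vertices is that of Bourbaki.\<close>

fun type_edges :: "dynkin_type \<Rightarrow> nat set set" where
  "type_edges (TypeA n) = {{i, i + 1} |i. 1 \<le> i \<and> i < n}"
| "type_edges (TypeD n) = {{i, i + 1} |i. 1 \<le> i \<and> i < n - 1} \<union> {{n - 2, n}}"
| "type_edges (TypeE n) = {{1, 3}, {2, 4}} \<union> {{i, i + 1} |i. 3 \<le> i \<and> i < n}"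

definition simply_laced_dynkin :: "'v set \<Rightarrow> 'v set set \<Rightarrow> bool" where
  "simply_laced_dynkin V E \<longleftrightarrow>
     (\<exists>t f. valid_type t \<and> bij_betw f (type_verts t) V \<and> E = (\<lambda>e. f ` e) ` type_edges t)"

text \<open>There are no multiple edges, so an arrow from \<open>i\<close> to \<open>j\<close> is the pair \<open>(i, j)\<close>, and the
  opposite arrow is \<open>(j, i)\<close>.\<close>

definition orientation :: "'v set set \<Rightarrow> ('v \<times> 'v) set \<Rightarrow> bool" where
  "orientation E Q \<longleftrightarrow> bij_betw (\<lambda>(i, j). {i, j}) Q E"

definition double_quiver :: "('v \<times> 'v) set \<Rightarrow> ('v \<times> 'v) set" where
  "double_quiver Q = Q \<union> Q\<inverse>"


section \<open>Path algebras and preprojective algebras\<close>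

text \<open>A path in the quiver with vertex set \<open>V\<close> and arrow set \<open>A\<close> is the nonempty list of the
  vertices it visits; \<open>[i]\<close> is the trivial path at \<open>i\<close>.\<close>

definition paths :: "'v set \<Rightarrow> ('v \<times> 'v) set \<Rightarrow> 'v list set" where
  "paths V A = {p. p \<noteq> [] \<and> set p \<subseteq> V \<and> successively (\<lambda>i j. (i, j) \<in> A) p}"

definition path_basis :: "'v list \<Rightarrow> 'v list \<Rightarrow> 'k::field" where
  "path_basis p = (\<lambda>q. if q = p then 1 else 0)"

text \<open>Elements of the path algebra are finitely supported functions on paths. The coefficient
  of a path \<open>p\<close> in a product collects the ways to cut \<open>p\<close> at one of the vertices it visits, so that
  \<open>p \<cdot> q\<close> means first \<open>p\<close>, then \<open>q\<close>. For the preprojective algebra the opposite convention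
  gives an isomorphic algebra: reversing paths swaps every arrow \<open>a\<close> with its opposite
  and the preprojective relation with its negative, and fixes the idempotents at the vertices.\<close>

definition path_algebra :: "'v set \<Rightarrow> ('v \<times> 'v) set \<Rightarrow> ('v list \<Rightarrow> 'k::field) ring" where
  "path_algebra V A =
     \<lparr>carrier = {f. finite {p. f p \<noteq> 0} \<and> {p. f p \<noteq> 0} \<subseteq> paths V A},
      mult = (\<lambda>f g p. \<Sum>t<length p. f (take (Suc t) p) * g (drop t p)),
      one = (\<lambda>p. if \<exists>i\<in>V. p = [i] then 1 else 0),
      zero = (\<lambda>p. 0),
      add = (\<lambda>f g p. f p + g p)\<rparr>"

definition preprojective_relation ::
    "'v set \<Rightarrow> ('v \<times> 'v) set \<Rightarrow> 'v list \<Rightarrow> 'k::field" where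
  "preprojective_relation V Q =
     (let R = path_algebra V (double_quiver Q) in
      finsum R (\<lambda>(i, j). path_basis [i, j] \<otimes>\<^bsub>R\<^esub> path_basis [j, i]
                    \<ominus>\<^bsub>R\<^esub> path_basis [j, i] \<otimes>\<^bsub>R\<^esub> path_basis [i, j]) Q)"

definition preprojective_ideal ::
    "'v set \<Rightarrow> ('v \<times> 'v) set \<Rightarrow> ('v list \<Rightarrow> 'k::field) set" where
  "preprojective_ideal V Q =
     Idl\<^bsub>path_algebra V (double_quiver Q)\<^esub> {preprojective_relation V Q}"

definition preprojective_algebra ::
    "'v set \<Rightarrow> ('v \<times> 'v) set \<Rightarrow> ('v list \<Rightarrow> 'k::field) set ring" where
  "preprojective_algebra V Q =
     path_algebra V (double_quiver Q) Quot preprojective_ideal V Q"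

definition vertex_idempotent ::
    "'v set \<Rightarrow> ('v \<times> 'v) set \<Rightarrow> 'v \<Rightarrow> ('v list \<Rightarrow> 'k::field) set" where
  "vertex_idempotent V Q i =
     preprojective_ideal V Q +>\<^bsub>path_algebra V (double_quiver Q)\<^esub> path_basis [i]"

definition vertex_ideal ::
    "'v set \<Rightarrow> ('v \<times> 'v) set \<Rightarrow> 'v \<Rightarrow> ('v list \<Rightarrow> 'k::field) set set" where
  "vertex_ideal V Q i =
     (let P = preprojective_algebra V Q in Idl\<^bsub>P\<^esub> {\<one>\<^bsub>P\<^esub> \<ominus>\<^bsub>P\<^esub> vertex_idempotent V Q i})"


section \<open>The Weyl group and its weak order\<close>

text \<open>The reflection \<open>s\<^sub>i\<close> acts on the root lattice, where \<open>x\<close> holds the coordinates in the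
  basis of simple roots: \<open>s\<^sub>i x = x - (\<Sum>\<^sub>j a\<^sub>i\<^sub>j x\<^sub>j) \<alpha>\<^sub>i\<close> with \<open>a\<^sub>i\<^sub>i = 2\<close>, and
  \<open>a\<^sub>i\<^sub>j = -1\<close> on edges. Coordinates outside the vertex set are never moved and play no role.\<close>

definition simple_reflection :: "'v set set \<Rightarrow> 'v \<Rightarrow> ('v \<Rightarrow> int) \<Rightarrow> ('v \<Rightarrow> int)" where
  "simple_reflection E i x = x(i := (\<Sum>j | {i, j} \<in> E. x j) - x i)"

definition weyl_word :: "'v set set \<Rightarrow> 'v list \<Rightarrow> ('v \<Rightarrow> int) \<Rightarrow> ('v \<Rightarrow> int)" where
  "weyl_word E is = foldr (\<lambda>i w. simple_reflection E i \<circ> w) is id"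

definition weyl_group :: "'v set \<Rightarrow> 'v set set \<Rightarrow> (('v \<Rightarrow> int) \<Rightarrow> ('v \<Rightarrow> int)) set" where
  "weyl_group V E = weyl_word E ` lists V"

definition weyl_length :: "'v set \<Rightarrow> 'v set set \<Rightarrow> (('v \<Rightarrow> int) \<Rightarrow> ('v \<Rightarrow> int)) \<Rightarrow> nat" where
  "weyl_length V E w = (LEAST n. \<exists>is\<in>lists V. length is = n \<and> weyl_word E is = w)"

definition reduced_word ::
    "'v set \<Rightarrow> 'v set set \<Rightarrow> (('v \<Rightarrow> int) \<Rightarrow> ('v \<Rightarrow> int)) \<Rightarrow> 'v list \<Rightarrow> bool" where
  "reduced_word V E w is \<longleftrightarrow>
     is \<in> lists V \<and> weyl_word E is = w \<and> length is = weyl_length V E w"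

text \<open>\<^term>\<open>inv_into UNIV v\<close> is the inverse of the bijection \<open>v\<close>.\<close>

definition weak_order :: "'v set \<Rightarrow> 'v set set \<Rightarrow> (('v \<Rightarrow> int) \<Rightarrow> ('v \<Rightarrow> int)) gorder" where
  "weak_order V E =
     \<lparr>carrier = weyl_group V E,
      eq = (=),
      le = (\<lambda>v u. weyl_length V E u
                  = weyl_length V E v + weyl_length V E (inv_into UNIV v \<circ> u))\<rparr>"


section \<open>Hasse arrows, lattice congruences and the join-irreducible labelling\<close>

definition covers :: "('a, 'b) gorder_scheme \<Rightarrow> 'a \<Rightarrow> 'a \<Rightarrow> bool" where
  "covers L x y \<longleftrightarrow> x \<in> carrier L \<and> y \<in> carrier L \<and> y \<sqsubset>\<^bsub>L\<^esub> x \<and>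
     \<not> (\<exists>z\<in>carrier L. y \<sqsubset>\<^bsub>L\<^esub> z \<and> z \<sqsubset>\<^bsub>L\<^esub> x)"

definition join_irreducible :: "('a, 'b) gorder_scheme \<Rightarrow> 'a \<Rightarrow> bool" where
  "join_irreducible L j \<longleftrightarrow> j \<in> carrier L \<and> (\<exists>!y. covers L j y)"

definition lower_cover :: "('a, 'b) gorder_scheme \<Rightarrow> 'a \<Rightarrow> 'a" where
  "lower_cover L j = (THE y. covers L j y)"

definition lattice_congruence :: "('a, 'b) gorder_scheme \<Rightarrow> ('a \<times> 'a) set \<Rightarrow> bool" where
  "lattice_congruence L \<theta> \<longleftrightarrow> equiv (carrier L) \<theta> \<and>
     (\<forall>x x' y y'. (x, x') \<in> \<theta> \<longrightarrow> (y, y') \<in> \<theta> \<longrightarrow>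
        (x \<squnion>\<^bsub>L\<^esub> y, x' \<squnion>\<^bsub>L\<^esub> y') \<in> \<theta> \<and> (x \<sqinter>\<^bsub>L\<^esub> y, x' \<sqinter>\<^bsub>L\<^esub> y') \<in> \<theta>)"

definition con :: "('a, 'b) gorder_scheme \<Rightarrow> 'a \<Rightarrow> 'a \<Rightarrow> ('a \<times> 'a) set" where
  "con L x y = \<Inter>{\<theta>. lattice_congruence L \<theta> \<and> (x, y) \<in> \<theta>}"

text \<open>That \<open>j\<close> is the label of the Hasse arrow \<open>x \<rightarrow> y\<close>. In a congruence uniform lattice there is
  exactly one such \<open>j\<close> for each arrow.\<close>

definition join_irreducible_label :: "('a, 'b) gorder_scheme \<Rightarrow> 'a \<Rightarrow> 'a \<Rightarrow> 'a \<Rightarrow> bool" where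
  "join_irreducible_label L x y j \<longleftrightarrow>
     covers L x y \<and> join_irreducible L j \<and> con L j (lower_cover L j) = con L x y"


section \<open>The ideals of Weyl group elements and the layer labelling\<close>

definition word_ideal ::
    "'v set \<Rightarrow> ('v \<times> 'v) set \<Rightarrow> 'v list \<Rightarrow> ('v list \<Rightarrow> 'k::field) set set" where
  "word_ideal V Q is =
     (let P = preprojective_algebra V Q in
      foldr (\<lambda>i J. ideal_prod P (vertex_ideal V Q i) J) is (carrier P))"

text \<open>The ideal does not depend on the choice of the reduced word.\<close>

definition weyl_ideal ::
    "'v set \<Rightarrow> 'v set set \<Rightarrow> ('v \<times> 'v) set \<Rightarrow> (('v \<Rightarrow> int) \<Rightarrow> ('v \<Rightarrow> int))
       \<Rightarrow> ('v list \<Rightarrow> 'k::field) set set" where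
  "weyl_ideal V E Q w = word_ideal V Q (SOME is. reduced_word V E w is)"

text \<open>The left \<open>R\<close>-module \<open>M / N\<close>, for left ideals \<open>N \<subseteq> M\<close> of \<open>R\<close>. The record type of modules
  extends that of rings; its multiplicative fields mean nothing for a module. The library's
  locale of modules is restricted to commutative rings and hence not used.\<close>

definition quotient_module :: "('a, 'b) ring_scheme \<Rightarrow> 'a set \<Rightarrow> 'a set \<Rightarrow> ('a, 'a set) module" where
  "quotient_module R M N =
     \<lparr>carrier = (\<lambda>x. N +>\<^bsub>R\<^esub> x) ` M,
      mult = undefined,
      one = undefined,
      zero = N,
      add = set_add R,
      smult = (\<lambda>r C. \<Union>x\<in>C. N +>\<^bsub>R\<^esub> (r \<otimes>\<^bsub>R\<^esub> x))\<rparr>"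

definition left_module_isomorphic ::
    "('a, 'b) ring_scheme \<Rightarrow> ('a, 'm, 'c) module_scheme \<Rightarrow> ('a, 'n, 'd) module_scheme \<Rightarrow> bool" where
  "left_module_isomorphic R M N \<longleftrightarrow>
     (\<exists>f. bij_betw f (carrier M) (carrier N) \<and>
          (\<forall>x\<in>carrier M. \<forall>y\<in>carrier M. f (x \<oplus>\<^bsub>M\<^esub> y) = f x \<oplus>\<^bsub>N\<^esub> f y) \<and>
          (\<forall>r\<in>carrier R. \<forall>x\<in>carrier M. f (r \<odot>\<^bsub>M\<^esub> x) = r \<odot>\<^bsub>N\<^esub> f x))"

text \<open>The layer label, up to isomorphism, of the Hasse arrow \<open>x \<rightarrow> y\<close>.\<close>

definition layer_label ::
    "'v set \<Rightarrow> 'v set set \<Rightarrow> ('v \<times> 'v) set \<Rightarrow> (('v \<Rightarrow> int) \<Rightarrow> ('v \<Rightarrow> int))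
       \<Rightarrow> (('v \<Rightarrow> int) \<Rightarrow> ('v \<Rightarrow> int))
       \<Rightarrow> (('v list \<Rightarrow> 'k::field) set, ('v list \<Rightarrow> 'k) set set) module" where
  "layer_label V E Q x y =
     quotient_module (preprojective_algebra V Q) (weyl_ideal V E Q y) (weyl_ideal V E Q x)"

end

theory Submission
  imports Defs Complex_Main "HOL-Library.Function_Algebras"
begin

text \<open>The root of a Hasse arrow \<open>ws\<^sub>i \<rightarrow> w\<close> is the positive root \<open>w\<alpha>\<^sub>i\<close>. The arrows \<open>ws\<^sub>i \<rightarrow> w\<close> and
\<open>ws\<^sub>j \<rightarrow> w\<close> span the interval from \<open>w\<close> to their join, which is a square if \<open>i\<close> and \<open>j\<close> are not
adjacent and a hexagon if they are. Opposite arrows of a square have the same root. In a hexagon the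
opposite outer arrows have the same root, and the two middle arrows have the sum of the two outer
roots as root, which is higher than both.

A set of arrows that is closed under the forcing inside these polygons is the set of arrows
contracted by some lattice congruence (\<open>forcing_closed_edges_congruence\<close>). For an arrow \<open>a\<close> take
the arrows with a root higher than that of \<open>a\<close>, and those with a root of the same height and a
layer isomorphic to that of \<open>a\<close>. This set is closed, provided that opposite arrows of a
polygon have isomorphic layers. If \<open>a\<close> and \<open>b\<close> generate the same congruence, each lies in the set of
the other, so the roots have equal heights and the layers are isomorphic
(\<open>congruence_determines_class\<close>). The theorem is the case where \<open>b\<close> is the arrow from \<open>j\<close> to \<open>j\<^sub>*\<close>.

Opposite arrows have isomorphic layers for the following reason. Let \<open>M = I(w)\<close>. Passing from
\<open>M\<close> to \<open>MI\<^sub>i\<close> only changes \<open>Me\<^sub>i\<close>, which becomes the sum of the \<open>Ma\<close> over the arrows \<open>a\<close> that end in \<open>i\<close>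
(\<open>lift_ideal_prod\<close>). So in a square the inclusion of \<open>MI\<^sub>j\<close> into \<open>M\<close> induces an isomorphism of
\<open>MI\<^sub>j/MI\<^sub>jI\<^sub>i\<close> with \<open>M/MI\<^sub>i\<close>. In a hexagon, right multiplication by the arrow from \<open>i\<close> to \<open>j\<close> maps
\<open>M/MI\<^sub>i\<close> onto \<open>MI\<^sub>jI\<^sub>i/MI\<^sub>jI\<^sub>iI\<^sub>j\<close>, because the preprojective relation rewrites a path that goes from one
vertex to a neighbour and back in terms of the other neighbours. This map is injective because
\<open>Tor\<^sub>1(M, S\<^sub>j) = 0\<close> whenever \<open>w\<alpha>\<^sub>j > 0\<close>, where \<open>S\<^sub>j\<close> is the simple module at \<open>j\<close>. In elementary terms this
is exactness in the middle of \<open>Me\<^sub>j \<rightarrow> \<Oplus> Me\<^sub>k \<rightarrow> Me\<^sub>j\<close>, the sum being over the neighbours \<open>k\<close> of \<open>j\<close>. For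
\<open>M = \<Pi>\<close> it says that \<Pi> is presented by its relation (\<open>exact_F\<close>), and it is inherited along
ascending arrows (\<open>exact_lifted_ideal\<close>).

On the side of the Weyl group, roots are the integer vectors on which the Tits form takes the value
1. The form is positive definite, which gives the dichotomy between positive and negative roots and
the finiteness of the group. Length counts inversions, and the weak order is inclusion of inversion
sets.\<close>

section \<open>Lattice congruences and forcing between covers\<close>

lemma (in partial_order) coversD:
  "covers L y x \<Longrightarrow> x \<in> carrier L \<and> y \<in> carrier L \<and> x \<sqsubseteq> y \<and> x \<noteq> y"
  by (auto simp: covers_def lless_eq)

lemma (in partial_order) covers_dual: "covers (inv_gorder L) x y \<longleftrightarrow> covers L y x"
  by (auto simp: covers_def lless_def eq_is_equal)

text \<open>Let \<open>z\<close> be a lower bound of \<open>x\<close> and \<open>y\<close>, and choose covers \<open>x1\<close> and \<open>y1\<close> of \<open>z\<close> below \<open>x\<close> and \<open>y\<close>. Then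
\<open>x \<squnion> y = (x \<squnion> (x1 \<squnion> y1)) \<squnion> y\<close>, where the inner join exists by hypothesis and the other two by
induction, since their arguments have the lower bounds \<open>x1\<close> and \<open>y1\<close>, which are above \<open>z\<close>.\<close>

lemma (in partial_order) joins_of_covers_suffice:
  fixes rk :: "'a \<Rightarrow> nat"
  assumes cover_below: "\<And>x y. \<lbrakk>x \<in> carrier L; y \<in> carrier L; x \<sqsubseteq> y; x \<noteq> y\<rbrakk> \<Longrightarrow> \<exists>z. covers L z x \<and> z \<sqsubseteq> y"
    and rk: "\<And>x y. covers L y x \<Longrightarrow> rk y < rk x"
    and cover_joins: "\<And>x y z. \<lbrakk>covers L y x; covers L z x; y \<noteq> z\<rbrakk> \<Longrightarrow> \<exists>s. least L s (Upper L {y, z})"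
    and lower_bounds: "\<And>x y. \<lbrakk>x \<in> carrier L; y \<in> carrier L\<rbrakk> \<Longrightarrow> \<exists>z\<in>carrier L. z \<sqsubseteq> x \<and> z \<sqsubseteq> y"
  shows "upper_semilattice L"
proof -
  have singleton: "\<exists>s. least L s (Upper L {x, x})" if "x \<in> carrier L" for x
    using sup_of_singletonI[OF that] by auto
  have comparable: "\<exists>s. least L s (Upper L {x, y})" if "x \<in> carrier L" "y \<in> carrier L" "x \<sqsubseteq> y" for x y
    using that by (intro exI[of _ y] least_UpperI) auto
  have "\<exists>s. least L s (Upper L {x, y})"
    if "z \<in> carrier L" "x \<in> carrier L" "y \<in> carrier L" "z \<sqsubseteq> x" "z \<sqsubseteq> y" for x y z
    using that
  proof (induction "rk z" arbitrary: z x y rule: less_induct)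
    case less
    show ?case
    proof (cases "z = x \<or> z = y")
      case True
      then show ?thesis
        using comparable[of x y] comparable[of y x] less.prems by (auto simp: insert_commute)
    next
      case False
      obtain x1 where x1: "covers L x1 z" "x1 \<sqsubseteq> x" using cover_below[of z x] less.prems False by auto
      obtain y1 where y1: "covers L y1 z" "y1 \<sqsubseteq> y" using cover_below[of z y] less.prems False by auto
      have car: "x1 \<in> carrier L" "y1 \<in> carrier L" using coversD x1 y1 by auto
      obtain u where u: "least L u (Upper L {x1, y1})"
        using cover_joins[OF x1(1) y1(1)] singleton[OF car(1)] by (cases "x1 = y1") auto
      have ucar: "u \<in> carrier L" and u1: "x1 \<sqsubseteq> u" "y1 \<sqsubseteq> u"
        using u car least_Upper_above[OF u] by auto
      obtain p where p: "least L p (Upper L {x, u})"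
        using less.hyps[OF rk[OF x1(1)], of x u] car ucar u1 x1 less.prems by auto
      have pcar: "p \<in> carrier L" and p1: "x \<sqsubseteq> p" "u \<sqsubseteq> p"
        using p less.prems ucar least_Upper_above[OF p] by auto
      have "y1 \<sqsubseteq> p" using u1 p1 le_trans[of y1 u p] car ucar pcar by auto
      then obtain s where s: "least L s (Upper L {p, y})"
        using less.hyps[OF rk[OF y1(1)], of p y] car pcar y1 less.prems by auto
      have scar: "s \<in> carrier L" and s1: "p \<sqsubseteq> s" "y \<sqsubseteq> s"
        using s less.prems pcar least_Upper_above[OF s] by auto
      have "least L s (Upper L {x, y})"
      proof (rule least_UpperI)
        fix t assume "t \<in> {x, y}"
        then show "t \<sqsubseteq> s" using s1 le_trans[OF p1(1) s1(1)] less.prems pcar scar by auto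
      next
        fix t assume "t \<in> Upper L {x, y}"
        then have t: "t \<in> carrier L" "x \<sqsubseteq> t" "y \<sqsubseteq> t" using less.prems by (auto simp: Upper_def)
        have "x1 \<sqsubseteq> t" "y1 \<sqsubseteq> t" using le_trans[OF x1(2) t(2)] le_trans[OF y1(2) t(3)] t less.prems car by auto
        then have "u \<sqsubseteq> t" using least_le[OF u, of t] t by (auto intro: Upper_memI)
        then have "p \<sqsubseteq> t" using least_le[OF p, of t] t by (auto intro: Upper_memI)
        then show "s \<sqsubseteq> t" using least_le[OF s, of t] t by (auto intro: Upper_memI)
      qed (use less.prems scar in auto)
      then show ?thesis by auto
    qed
  qed
  then show ?thesis
    by unfold_locales (meson lower_bounds)
qed

text \<open>The pairs are covers, directed upwards. A cover of \<open>x\<close> by \<open>y\<close> forces every arrow on the other side of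
the polygon that \<open>y\<close> and \<open>z\<close> span above \<open>x\<close>, except for the first one, from \<open>x\<close> to \<open>z\<close>.\<close>

definition join_forcing_closed :: "('a, 'b) gorder_scheme \<Rightarrow> ('a \<times> 'a) set \<Rightarrow> bool" where
  "join_forcing_closed L C \<longleftrightarrow> (\<forall>x y. (x, y) \<in> C \<longrightarrow> covers L y x) \<and>
     (\<forall>x y z. (x, y) \<in> C \<longrightarrow> covers L z x \<longrightarrow> z \<noteq> y \<longrightarrow> (z, y \<squnion>\<^bsub>L\<^esub> z) \<in> C\<^sup>*)"

lemma (in upper_semilattice) join_absorb:
  assumes "x \<in> carrier L" "y \<in> carrier L" "x \<sqsubseteq> y"
  shows "x \<squnion> y = y" "y \<squnion> x = y"
  using assms by (auto intro!: le_antisym join_le join_right join_left)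

lemma (in upper_semilattice) join_assoc_eq:
  assumes "x \<in> carrier L" "y \<in> carrier L" "z \<in> carrier L"
  shows "(x \<squnion> y) \<squnion> z = x \<squnion> (y \<squnion> z)"
  using weak_join_assoc[OF assms] by (simp add: eq_is_equal)

text \<open>It suffices to treat \<open>z\<close> above \<open>x\<close>. If \<open>x1\<close> covers \<open>x\<close> below \<open>z\<close>, the polygon spanned by \<open>x1\<close> and \<open>y\<close>
replaces the pair \<open>(x, y)\<close> by a chain of pairs that start strictly above \<open>x\<close>, to which induction
applies.\<close>

lemma (in upper_semilattice) join_chain:
  fixes rk :: "'a \<Rightarrow> nat"
  assumes cover_below: "\<And>x y. \<lbrakk>x \<in> carrier L; y \<in> carrier L; x \<sqsubseteq> y; x \<noteq> y\<rbrakk> \<Longrightarrow> \<exists>z. covers L z x \<and> z \<sqsubseteq> y"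
    and rk: "\<And>x y. \<lbrakk>x \<in> carrier L; y \<in> carrier L; x \<sqsubseteq> y; x \<noteq> y\<rbrakk> \<Longrightarrow> rk y < rk x"
    and C: "join_forcing_closed L C"
    and edge: "(x, y) \<in> C" and z: "z \<in> carrier L"
  shows "(x \<squnion> z, y \<squnion> z) \<in> C\<^sup>*"
proof -
  have cov: "covers L v u" if "(u, v) \<in> C" for u v using C that by (auto simp: join_forcing_closed_def)
  have carC: "u \<in> carrier L" "v \<in> carrier L" "u \<sqsubseteq> v" "u \<noteq> v" if "(u, v) \<in> C" for u v
    using coversD[OF cov[OF that]] by auto
  have starC: "v \<in> carrier L \<and> u \<sqsubseteq> v" if "(u, v) \<in> C\<^sup>*" "u \<in> carrier L" for u v
    using that by (induction rule: rtrancl_induct) (auto dest: carC intro: le_trans)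
  have main: "(z, y \<squnion> z) \<in> C\<^sup>*" if "(x, y) \<in> C" "z \<in> carrier L" "x \<sqsubseteq> z" for x y z
    using that
  proof (induction "rk x" arbitrary: x y z rule: less_induct)
    case less
    note c = carC[OF less.prems(1)]
    show ?case
    proof (cases "x = z")
      case True
      then have "y \<squnion> z = y" using c by (auto intro: join_absorb)
      then show ?thesis using True less.prems by auto
    next
      case False
      obtain x1 where x1: "covers L x1 x" "x1 \<sqsubseteq> z" using cover_below[of x z] less.prems False c by auto
      note c1 = coversD[OF x1(1)]
      show ?thesis
      proof (cases "x1 = y")
        case True
        then show ?thesis using join_absorb(1)[of y z] c x1 less.prems by auto
      next
        case False
        have "(x1, y \<squnion> x1) \<in> C\<^sup>*" using C less.prems(1) x1(1) False by (auto simp: join_forcing_closed_def)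
        then have "(x1 \<squnion> z, (y \<squnion> x1) \<squnion> z) \<in> C\<^sup>*"
        proof (induction rule: rtrancl_induct)
          case base
          then show ?case by auto
        next
          case (step u v)
          have u: "u \<in> carrier L" "x1 \<sqsubseteq> u" using starC[OF step.hyps(1)] c1 by auto
          have v: "v \<in> carrier L" "u \<sqsubseteq> v" using carC[OF step.hyps(2)] by auto
          have "x \<sqsubseteq> u" using le_trans[of x x1 u] c1 u by auto
          moreover have "x \<noteq> u" using c1 u le_antisym by blast
          ultimately have "rk u < rk x" using rk c1 u by auto
          then have "(u \<squnion> z, v \<squnion> (u \<squnion> z)) \<in> C\<^sup>*"
            using less.hyps[OF _ step.hyps(2), of "u \<squnion> z"] u less.prems(2) join_left by auto
          moreover have "v \<squnion> (u \<squnion> z) = v \<squnion> z"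
            using join_assoc_eq[of v u z] join_absorb(2)[of u v] u v less.prems(2) by auto
          ultimately show ?case using step.IH by auto
        qed
        moreover have "x1 \<squnion> z = z" "(y \<squnion> x1) \<squnion> z = y \<squnion> z"
          using join_absorb(1)[of x1 z] join_assoc_eq[of y x1 z] x1 c1 c less.prems by auto
        ultimately show ?thesis by simp
      qed
    qed
  qed
  note c = carC[OF edge]
  have "(x \<squnion> z, y \<squnion> (x \<squnion> z)) \<in> C\<^sup>*"
    by (rule main[OF edge]) (use c z join_left in auto)
  moreover have "y \<squnion> (x \<squnion> z) = y \<squnion> z"
    using join_assoc_eq[of y x z] join_absorb(2)[of x y] c z by auto
  ultimately show ?thesis by simp
qed

text \<open>The congruence is the equivalence closure of \<open>C\<close>; by the preceding lemma and its dual it is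
compatible with joins and meets. It contracts no cover of \<open>x\<close> by \<open>y\<close> outside of \<open>C\<close>: the map
\<open>u \<mapsto> (u \<squnion> x) \<sqinter> y\<close> carries a path from \<open>x\<close> to \<open>y\<close> to a path inside \<open>{x, y}\<close>, which must at some
point use the pair \<open>(x, y)\<close> itself.\<close>

lemma (in lattice) forcing_closed_edges_congruence:
  fixes up down :: "'a \<Rightarrow> nat"
  assumes cover_below: "\<And>x y. \<lbrakk>x \<in> carrier L; y \<in> carrier L; x \<sqsubseteq> y; x \<noteq> y\<rbrakk> \<Longrightarrow> \<exists>z. covers L z x \<and> z \<sqsubseteq> y"
    and cover_above: "\<And>x y. \<lbrakk>x \<in> carrier L; y \<in> carrier L; x \<sqsubseteq> y; x \<noteq> y\<rbrakk> \<Longrightarrow> \<exists>z. covers L y z \<and> x \<sqsubseteq> z"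
    and up: "\<And>x y. \<lbrakk>x \<in> carrier L; y \<in> carrier L; x \<sqsubseteq> y; x \<noteq> y\<rbrakk> \<Longrightarrow> up y < up x"
    and down: "\<And>x y. \<lbrakk>x \<in> carrier L; y \<in> carrier L; x \<sqsubseteq> y; x \<noteq> y\<rbrakk> \<Longrightarrow> down x < down y"
    and join_closed: "join_forcing_closed L C"
    and meet_closed: "join_forcing_closed (inv_gorder L) (C\<inverse>)"
  shows "\<exists>\<theta>. lattice_congruence L \<theta> \<and> (\<forall>x y. covers L y x \<longrightarrow> (x, y) \<in> \<theta> \<longleftrightarrow> (x, y) \<in> C)"
proof -
  interpret dual: lattice "inv_gorder L"
    rewrites "carrier (inv_gorder L) = carrier L"
      and "le (inv_gorder L) = (\<lambda>x y. le L y x)"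
    using dual_lattice by auto
  have cov: "covers L v u" if "(u, v) \<in> C" for u v
    using join_closed that by (auto simp: join_forcing_closed_def)
  have carC: "u \<in> carrier L" "v \<in> carrier L" "u \<sqsubseteq> v" "u \<noteq> v" if "(u, v) \<in> C" for u v
    using coversD[OF cov[OF that]] by auto
  have joins: "(x \<squnion> z, y \<squnion> z) \<in> C\<^sup>*" if "(x, y) \<in> C" "z \<in> carrier L" for x y z
    by (rule join_chain[OF cover_below up join_closed that])
  have meets: "(x \<sqinter> z, y \<sqinter> z) \<in> C\<^sup>*" if "(x, y) \<in> C" "z \<in> carrier L" for x y z
  proof -
    have "(y \<squnion>\<^bsub>inv_gorder L\<^esub> z, x \<squnion>\<^bsub>inv_gorder L\<^esub> z) \<in> (C\<inverse>)\<^sup>*"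
      by (rule dual.join_chain[where rk = down and C = "C\<inverse>"])
        (use cover_above covers_dual that down meet_closed in auto)
    then show ?thesis by (simp add: rtrancl_converse)
  qed
  define \<theta> where "\<theta> = ((C \<union> C\<inverse>)\<^sup>* \<inter> carrier L \<times> carrier L)"
  have C\<theta>: "C\<^sup>* \<subseteq> (C \<union> C\<inverse>)\<^sup>*" "(C\<inverse>)\<^sup>* \<subseteq> (C \<union> C\<inverse>)\<^sup>*" by (rule rtrancl_mono, simp)+
  have sym: "sym ((C \<union> C\<inverse>)\<^sup>*)" by (rule sym_rtrancl) (auto simp: sym_def)
  have car: "v \<in> carrier L" if "(u, v) \<in> (C \<union> C\<inverse>)\<^sup>*" "u \<in> carrier L" for u v
    using that by (induction rule: rtrancl_induct) (auto dest: carC)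
  have eq: "equiv (carrier L) \<theta>"
    unfolding equiv_def \<theta>_def refl_on_def using sym by (auto simp: sym_def trans_def)
  have joins\<theta>: "(x \<squnion> z, y \<squnion> z) \<in> \<theta>" if "(x, y) \<in> \<theta>" "z \<in> carrier L" for x y z
  proof -
    have "(x, y) \<in> (C \<union> C\<inverse>)\<^sup>*" "x \<in> carrier L" "y \<in> carrier L" using that by (auto simp: \<theta>_def)
    then have "(x \<squnion> z, y \<squnion> z) \<in> (C \<union> C\<inverse>)\<^sup>*"
    proof (induction rule: rtrancl_induct)
      case base
      then show ?case by auto
    next
      case (step u v)
      have "(u \<squnion> z, v \<squnion> z) \<in> (C \<union> C\<inverse>)\<^sup>*"
        using step.hyps(2) joins[of u v z] joins[of v u z] that(2) C\<theta> sym
        by (auto simp: sym_def)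
      then show ?case using step car carC by (meson Un_iff converseD rtrancl_trans)
    qed
    then show ?thesis using that by (auto simp: \<theta>_def)
  qed
  have meets\<theta>: "(x \<sqinter> z, y \<sqinter> z) \<in> \<theta>" if "(x, y) \<in> \<theta>" "z \<in> carrier L" for x y z
  proof -
    have "(x, y) \<in> (C \<union> C\<inverse>)\<^sup>*" "x \<in> carrier L" "y \<in> carrier L" using that by (auto simp: \<theta>_def)
    then have "(x \<sqinter> z, y \<sqinter> z) \<in> (C \<union> C\<inverse>)\<^sup>*"
    proof (induction rule: rtrancl_induct)
      case base
      then show ?case by auto
    next
      case (step u v)
      have "(u \<sqinter> z, v \<sqinter> z) \<in> (C \<union> C\<inverse>)\<^sup>*"
        using step.hyps(2) meets[of u v z] meets[of v u z] that(2) C\<theta> sym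
        by (auto simp: sym_def)
      then show ?case using step car carC by (meson Un_iff converseD rtrancl_trans)
    qed
    then show ?thesis using that by (auto simp: \<theta>_def)
  qed
  have tr: "trans \<theta>" using eq by (auto simp: equiv_def)
  have sub: "\<theta> \<subseteq> carrier L \<times> carrier L" by (auto simp: \<theta>_def)
  have "lattice_congruence L \<theta>"
    unfolding lattice_congruence_def
  proof (intro conjI allI impI eq)
    fix x x' y y' assume h: "(x, x') \<in> \<theta>" "(y, y') \<in> \<theta>"
    then have c: "x \<in> carrier L" "x' \<in> carrier L" "y \<in> carrier L" "y' \<in> carrier L" using sub by auto
    have "(x \<squnion> y, x' \<squnion> y) \<in> \<theta>" "(y \<squnion> x', y' \<squnion> x') \<in> \<theta>" using joins\<theta> h c by auto
    then show "(x \<squnion> y, x' \<squnion> y') \<in> \<theta>" using tr by (metis join_comm transD)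
    have "(x \<sqinter> y, x' \<sqinter> y) \<in> \<theta>" "(y \<sqinter> x', y' \<sqinter> x') \<in> \<theta>" using meets\<theta> h c by auto
    then show "(x \<sqinter> y, x' \<sqinter> y') \<in> \<theta>" using tr by (metis meet_comm transD)
  qed
  moreover have "(x, y) \<in> \<theta> \<longleftrightarrow> (x, y) \<in> C" if xy: "covers L y x" for x y
  proof
    note c = coversD[OF xy]
    assume "(x, y) \<in> C"
    then show "(x, y) \<in> \<theta>" using c by (auto simp: \<theta>_def)
  next
    note c = coversD[OF xy]
    define p where "p u = (u \<squnion> x) \<sqinter> y" for u
    assume "(x, y) \<in> \<theta>"
    then have star: "(x, y) \<in> (C \<union> C\<inverse>)\<^sup>*" by (auto simp: \<theta>_def)
    have pC: "(p u, p v) \<in> C\<^sup>*" if "(u, v) \<in> C" for u v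
    proof -
      have "(u \<squnion> x, v \<squnion> x) \<in> C\<^sup>*" using joins[OF that] c by auto
      then have "((u \<squnion> x) \<sqinter> y, (v \<squnion> x) \<sqinter> y) \<in> C\<^sup>*"
      proof (induction rule: rtrancl_induct)
        case base
        then show ?case by auto
      next
        case (step s t)
        then show ?case using meets[of s t y] c by auto
      qed
      then show ?thesis by (simp add: p_def)
    qed
    have px: "x \<sqsubseteq> p u" "p u \<sqsubseteq> y" "p u \<in> carrier L" if "u \<in> carrier L" for u
      using that c join_right meet_right by (auto simp: p_def intro!: meet_le)
    have pxy: "p u = x \<or> p u = y" if "u \<in> carrier L" for u
      using px[OF that] xy by (auto simp: covers_def lless_eq)
    have starC: "v \<in> carrier L \<and> u \<sqsubseteq> v" if "(u, v) \<in> C\<^sup>*" "u \<in> carrier L" for u v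
      using that by (induction rule: rtrancl_induct) (auto dest: carC intro: le_trans)
    have xyC: "(x, y) \<in> C" if star1: "(x, y) \<in> C\<^sup>*"
    proof -
      obtain z where z: "(x, z) \<in> C" "(z, y) \<in> C\<^sup>*" using star1 c by (metis converse_rtranclE)
      have "z = y" using carC[OF z(1)] starC[OF z(2)] xy by (auto simp: covers_def lless_eq)
      then show ?thesis using z by auto
    qed
    have not_yx: "(y, x) \<notin> C\<^sup>*" using starC[of y x] c le_antisym by auto
    have "p y = y" "p x = x" using join_absorb c px(1)[of y] px(2)[of x] by (auto simp: p_def intro!: le_antisym meet_left meet_le)
    moreover have "p v = x \<or> (x, y) \<in> C" if "(x, v) \<in> (C \<union> C\<inverse>)\<^sup>*" for v
      using that
    proof (induction rule: rtrancl_induct)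
      case base
      then show ?case using \<open>p x = x\<close> by auto
    next
      case (step u v)
      have uv: "u \<in> carrier L" "v \<in> carrier L" using car[OF step.hyps(1)] step.hyps(2) carC c by auto
      then show ?case
        using pC[of u v] pC[of v u] step pxy[of u] pxy[of v] xyC not_yx by auto
    qed
    ultimately show "(x, y) \<in> C" using star c by metis
  qed
  ultimately show ?thesis by auto
qed

section \<open>Roots, inversions and length\<close>

text \<open>Half of the quadratic form of the Cartan matrix, so that roots have the value 1. An orientation is a
convenient way to run over every edge once.\<close>

definition tits_form :: "'v set \<Rightarrow> ('v \<times> 'v) set \<Rightarrow> ('v \<Rightarrow> int) \<Rightarrow> int" where
  "tits_form V Q x = (\<Sum>i\<in>V. x i * x i) - (\<Sum>(i, j)\<in>Q. x i * x j)"

definition simple_root :: "'v \<Rightarrow> 'v \<Rightarrow> int" where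
  "simple_root i = (\<lambda>v. if v = i then 1 else 0)"

locale oriented_graph =
  fixes V :: "'v set" and E :: "'v set set" and Q :: "('v \<times> 'v) set"
  assumes finite_V: "finite V"
    and edge: "e \<in> E \<Longrightarrow> \<exists>i\<in>V. \<exists>j\<in>V. i \<noteq> j \<and> e = {i, j}"
    and oriented: "orientation E Q"
begin

definition nbs :: "'v \<Rightarrow> 'v set" where
  "nbs i = {j. {i, j} \<in> E}"

lemma edge_verts: "{i, j} \<in> E \<Longrightarrow> i \<in> V \<and> j \<in> V \<and> i \<noteq> j"
  using edge[of "{i, j}"] by (auto simp: doubleton_eq_iff)

lemma no_loop [simp]: "{i} \<notin> E"
  using edge_verts[of i i] by auto

lemma finite_nbs: "finite (nbs i)" and not_nbs_self: "i \<notin> nbs i"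
proof -
  have "nbs i \<subseteq> V" using edge_verts by (auto simp: nbs_def)
  then show "finite (nbs i)" using finite_V finite_subset by blast
qed (simp add: nbs_def)

lemma nbs_sym: "j \<in> nbs i \<longleftrightarrow> i \<in> nbs j"
  by (simp add: nbs_def insert_commute)

lemma Q_edge: "(i, j) \<in> Q \<Longrightarrow> {i, j} \<in> E"
  using oriented by (auto simp: orientation_def bij_betw_def)

lemma Q_antisym: "(i, j) \<in> Q \<Longrightarrow> (j, i) \<notin> Q"
proof
  assume h: "(i, j) \<in> Q" "(j, i) \<in> Q"
  have "inj_on (\<lambda>(i, j). {i, j}) Q" using oriented by (auto simp: orientation_def bij_betw_def)
  then have "(i, j) = (j, i)" using h by (intro inj_onD[of "\<lambda>(i, j). {i, j}" Q]) auto
  then show False using edge_verts[OF Q_edge[OF h(1)]] by auto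
qed

lemma edge_Q: "{i, j} \<in> E \<longleftrightarrow> (i, j) \<in> Q \<or> (j, i) \<in> Q"
proof
  assume "{i, j} \<in> E"
  then have "{i, j} \<in> (\<lambda>(i, j). {i, j}) ` Q" using oriented by (auto simp: orientation_def bij_betw_def)
  then show "(i, j) \<in> Q \<or> (j, i) \<in> Q" by (auto simp: doubleton_eq_iff)
qed (auto simp: Q_edge insert_commute dest: Q_edge)

lemma Q_irrefl [simp]: "(i, i) \<notin> Q"
  using Q_edge[of i i] by auto

lemma finite_Q: "finite Q"
proof (rule finite_subset)
  show "Q \<subseteq> V \<times> V" using Q_edge edge_verts by auto
qed (use finite_V in simp)

abbreviation s :: "'v \<Rightarrow> ('v \<Rightarrow> int) \<Rightarrow> ('v \<Rightarrow> int)" where "s \<equiv> simple_reflection E"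
abbreviation word :: "'v list \<Rightarrow> ('v \<Rightarrow> int) \<Rightarrow> ('v \<Rightarrow> int)" where "word \<equiv> weyl_word E"
abbreviation W :: "(('v \<Rightarrow> int) \<Rightarrow> ('v \<Rightarrow> int)) set" where "W \<equiv> weyl_group V E"
abbreviation q :: "('v \<Rightarrow> int) \<Rightarrow> int" where "q \<equiv> tits_form V Q"
abbreviation \<alpha> :: "'v \<Rightarrow> 'v \<Rightarrow> int" where "\<alpha> \<equiv> simple_root"

definition pairing :: "'v \<Rightarrow> ('v \<Rightarrow> int) \<Rightarrow> int" where
  "pairing i x = 2 * x i - (\<Sum>j\<in>nbs i. x j)"

lemma s_pairing: "s i x = x(i := x i - pairing i x)"
  by (simp add: simple_reflection_def pairing_def nbs_def)

lemma q_update: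
  assumes "i \<in> V"
  shows "q (x(i := x i + c)) = q x + c * c + c * pairing i x"
proof -
  let ?y = "x(i := x i + c)"
  have "(\<Sum>v\<in>V. ?y v * ?y v) = (\<Sum>v\<in>V. x v * x v + (if v = i then 2 * c * x i + c * c else 0))"
    by (rule sum.cong) (auto simp: algebra_simps)
  then have 1: "(\<Sum>v\<in>V. ?y v * ?y v) = (\<Sum>v\<in>V. x v * x v) + (2 * c * x i + c * c)"
    using finite_V assms by (simp add: sum.distrib)
  have inner: "(\<Sum>(a, b)\<in>Q. (if a = i then x b else 0) + (if b = i then x a else 0)) = (\<Sum>j\<in>nbs i. x j)"
  proof -
    have "(\<Sum>(a, b)\<in>Q. if a = i then x b else 0) = (\<Sum>(a, b)\<in>{i} \<times> {j. (i, j) \<in> Q}. x b)"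
      by (rule sum.mono_neutral_cong_right[OF finite_Q]) (auto split: if_splits)
    then have a: "(\<Sum>(a, b)\<in>Q. if a = i then x b else 0) = (\<Sum>j | (i, j) \<in> Q. x j)"
      by (simp add: sum.cartesian_product[symmetric])
    have "(\<Sum>(a, b)\<in>Q. if b = i then x a else 0) = (\<Sum>(a, b)\<in>{j. (j, i) \<in> Q} \<times> {i}. x a)"
      by (rule sum.mono_neutral_cong_right[OF finite_Q]) (auto split: if_splits)
    then have b: "(\<Sum>(a, b)\<in>Q. if b = i then x a else 0) = (\<Sum>j | (j, i) \<in> Q. x j)"
      by (simp add: sum.cartesian_product[symmetric])
    have n: "nbs i = {j. (i, j) \<in> Q} \<union> {j. (j, i) \<in> Q}" by (auto simp: nbs_def edge_Q)
    have "(\<Sum>j\<in>nbs i. x j) = (\<Sum>j | (i, j) \<in> Q. x j) + (\<Sum>j | (j, i) \<in> Q. x j)"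
      unfolding n using finite_nbs[of i] n Q_antisym by (intro sum.union_disjoint) auto
    then show ?thesis using a b by (simp add: case_prod_unfold sum.distrib)
  qed
  have "(\<Sum>(a, b)\<in>Q. ?y a * ?y b)
      = (\<Sum>(a, b)\<in>Q. x a * x b + c * ((if a = i then x b else 0) + (if b = i then x a else 0)))"
    by (rule sum.cong) (use Q_edge edge_verts in \<open>auto simp: algebra_simps\<close>)
  also have "\<dots> = (\<Sum>(a, b)\<in>Q. x a * x b) + c * (\<Sum>j\<in>nbs i. x j)"
    unfolding inner[symmetric] by (simp add: case_prod_unfold sum.distrib flip: sum_distrib_left)
  finally show ?thesis
    unfolding tits_form_def using 1 by (simp add: pairing_def algebra_simps)
qed

lemma q_s: "i \<in> V \<Longrightarrow> q (s i x) = q x"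
  using q_update[of i x "- pairing i x"] by (simp add: s_pairing)

lemma pairing_q: "i \<in> V \<Longrightarrow> pairing i x = q (x + \<alpha> i) - q x - 1"
proof -
  assume "i \<in> V"
  moreover have "x + \<alpha> i = x(i := x i + 1)" by (auto simp: simple_root_def)
  ultimately show ?thesis using q_update[of i x 1] by simp
qed

lemma s_add: "s i (x + y) = s i x + s i y" and s_uminus: "s i (- x) = - s i x"
  by (auto simp: simple_reflection_def sum.distrib sum_negf fun_eq_iff)

lemma s_s: "s i (s i x) = x"
proof -
  have "(\<Sum>j | {i, j} \<in> E. s i x j) = (\<Sum>j | {i, j} \<in> E. x j)"
    by (rule sum.cong) (use edge_verts in \<open>auto simp: simple_reflection_def\<close>)
  then show ?thesis by (simp add: simple_reflection_def fun_eq_iff)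
qed

lemma word_Nil [simp]: "word [] = id"
  and word_Cons [simp]: "word (i # is) = s i \<circ> word is"
  by (simp_all add: weyl_word_def)

lemma word_append [simp]: "word (is @ js) = word is \<circ> word js"
  by (induction "is") auto

lemma s_s_comp: "s i \<circ> (s i \<circ> f) = f"
  by (rule ext) (simp add: s_s)

lemma comp_s_s: "f \<circ> s i \<circ> s i = f"
  by (rule ext) (simp add: s_s)

lemma word_rev: "word (rev is) \<circ> word is = id" "word is \<circ> word (rev is) = id"
proof -
  have "word (rev is) \<circ> (word is \<circ> f) = f" "word is \<circ> (word (rev is) \<circ> f) = f" for f :: "('v \<Rightarrow> int) \<Rightarrow> _"
    by (induction "is" arbitrary: f) (simp_all add: comp_assoc s_s_comp)
  from this[of id] show "word (rev is) \<circ> word is = id" "word is \<circ> word (rev is) = id" by simp_all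
qed

lemma W_word: "w \<in> W \<Longrightarrow> \<exists>is\<in>lists V. w = word is"
  by (auto simp: weyl_group_def)

lemma word_W [intro]: "is \<in> lists V \<Longrightarrow> word is \<in> W"
  by (auto simp: weyl_group_def)

lemma id_W [simp]: "id \<in> W" using word_W[of "[]"] by simp

lemma W_comp [intro]: "u \<in> W \<Longrightarrow> v \<in> W \<Longrightarrow> u \<circ> v \<in> W"
proof -
  assume "u \<in> W" "v \<in> W"
  then obtain "is" js where "is \<in> lists V" "js \<in> lists V" "u = word is" "v = word js" using W_word by metis
  then show ?thesis using word_W[of "is @ js"] by simp
qed

lemma s_W [intro]: "i \<in> V \<Longrightarrow> s i \<in> W" using word_W[of "[i]"] by simp

lemma W_add: "w \<in> W \<Longrightarrow> w (x + y) = w x + w y"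
  and W_uminus: "w \<in> W \<Longrightarrow> w (- x) = - w x"
  and q_W: "w \<in> W \<Longrightarrow> q (w x) = q x"
proof -
  have "word is (x + y) = word is x + word is y" "word is (- x) = - word is x" for "is"
    by (induction "is") (auto simp: s_add s_uminus)
  moreover have "q (word is x) = q x" if "is \<in> lists V" for "is"
    using that by (induction "is") (auto simp: q_s)
  ultimately show "w \<in> W \<Longrightarrow> w (x + y) = w x + w y" "w \<in> W \<Longrightarrow> w (- x) = - w x" "w \<in> W \<Longrightarrow> q (w x) = q x"
    by (auto dest!: W_word simp del: plus_fun_apply uminus_apply)
qed

lemma W_scale: "w \<in> W \<Longrightarrow> w (\<lambda>v. c * x v) = (\<lambda>v. c * w x v)"
proof -
  have "s i (\<lambda>v. c * x v) = (\<lambda>v. c * s i x v)" for i x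
    by (auto simp: simple_reflection_def sum_distrib_left algebra_simps fun_eq_iff)
  then have "word is (\<lambda>v. c * x v) = (\<lambda>v. c * word is x v)" for "is"
    by (induction "is") auto
  then show "w \<in> W \<Longrightarrow> w (\<lambda>v. c * x v) = (\<lambda>v. c * w x v)"
    by (auto dest!: W_word)
qed

lemma W_inverse: "w \<in> W \<Longrightarrow> \<exists>w'\<in>W. w' \<circ> w = id \<and> w \<circ> w' = id"
proof -
  assume "w \<in> W"
  then obtain "is" where "is \<in> lists V" "w = word is" using W_word by metis
  then show ?thesis using word_rev[of "is"] by (intro bexI[of _ "word (rev is)"] word_W) auto
qed

lemma W_bij: "w \<in> W \<Longrightarrow> bij w"
  using W_inverse o_bij by blast

lemma inv_W: "w \<in> W \<Longrightarrow> inv_into UNIV w \<in> W"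
  using W_inverse inv_unique_comp by fastforce

lemma W_inv_apply [simp]: "w \<in> W \<Longrightarrow> inv_into UNIV w (w x) = x" "w \<in> W \<Longrightarrow> w (inv_into UNIV w x) = x"
  using W_bij[of w] by (simp_all add: bij_is_inj bij_is_surj surj_f_inv_f)

lemma W_supp: "w \<in> W \<Longrightarrow> (\<And>v. v \<notin> V \<Longrightarrow> x v = 0) \<Longrightarrow> v \<notin> V \<Longrightarrow> w x v = 0"
proof -
  have "word is x v = 0" if "is \<in> lists V" "\<And>v. v \<notin> V \<Longrightarrow> x v = 0" "v \<notin> V" for "is" v
    using that by (induction "is") (auto simp: s_pairing)
  then show "w \<in> W \<Longrightarrow> (\<And>v. v \<notin> V \<Longrightarrow> x v = 0) \<Longrightarrow> v \<notin> V \<Longrightarrow> w x v = 0"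
    by (auto dest!: W_word)
qed

definition roots :: "('v \<Rightarrow> int) set" where
  "roots = {x. (\<forall>v. v \<notin> V \<longrightarrow> x v = 0) \<and> q x = 1}"

definition pos :: "('v \<Rightarrow> int) set" where
  "pos = {x \<in> roots. \<forall>v. x v \<ge> 0}"

lemma q_0 [simp]: "q 0 = 0" by (simp add: tits_form_def)

lemma W_roots: "w \<in> W \<Longrightarrow> x \<in> roots \<Longrightarrow> w x \<in> roots"
  using W_supp by (auto simp: roots_def q_W)

lemma simple_root_pos: "i \<in> V \<Longrightarrow> \<alpha> i \<in> pos"
proof -
  assume i: "i \<in> V"
  have "pairing i 0 = 0" by (simp add: pairing_def)
  then have "q (\<alpha> i) = 1" using pairing_q[OF i, of 0] by simp
  then show ?thesis using i by (auto simp: pos_def roots_def simple_root_def)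
qed

lemma pos_not_neg: "x \<in> pos \<Longrightarrow> - x \<notin> pos"
proof
  assume "x \<in> pos" "- x \<in> pos"
  then have "x v = 0" for v by (auto simp: pos_def) (metis antisym neg_0_le_iff_le)
  then have "x = 0" by (auto simp: fun_eq_iff)
  then show False using \<open>x \<in> pos\<close> by (auto simp: pos_def roots_def)
qed

lemma s_simple_root_self: "i \<in> V \<Longrightarrow> s i (\<alpha> i) = - \<alpha> i"
proof -
  assume "i \<in> V"
  have "(\<Sum>j\<in>nbs i. \<alpha> i j) = 0" using not_nbs_self by (intro sum.neutral) (auto simp: simple_root_def)
  then show ?thesis by (auto simp: s_pairing pairing_def simple_root_def fun_eq_iff)
qed

lemma s_simple_root_edge: "{i, j} \<in> E \<Longrightarrow> s i (\<alpha> j) = \<alpha> i + \<alpha> j"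
  and s_simple_root_nonedge: "{i, j} \<notin> E \<Longrightarrow> i \<noteq> j \<Longrightarrow> s i (\<alpha> j) = \<alpha> j"
proof -
  have "(\<Sum>k\<in>nbs i. \<alpha> j k) = (if j \<in> nbs i then 1 else 0)"
    using finite_nbs[of i] by (simp add: simple_root_def)
  then show "{i, j} \<in> E \<Longrightarrow> s i (\<alpha> j) = \<alpha> i + \<alpha> j" "{i, j} \<notin> E \<Longrightarrow> i \<noteq> j \<Longrightarrow> s i (\<alpha> j) = \<alpha> j"
    using edge_verts by (auto simp: s_pairing pairing_def simple_root_def fun_eq_iff nbs_def)
qed

lemma s_commute: "{i, j} \<notin> E \<Longrightarrow> i \<noteq> j \<Longrightarrow> s i \<circ> s j = s j \<circ> s i"
proof -
  assume h: "{i, j} \<notin> E" "i \<noteq> j"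
  then have "j \<notin> nbs i" "i \<notin> nbs j" by (auto simp: nbs_def insert_commute)
  then have "pairing i (x(j := c)) = pairing i x" "pairing j (x(i := c)) = pairing j x" for x c
    using h by (auto simp: pairing_def intro!: sum.cong)
  then show ?thesis using h by (auto simp: s_pairing fun_eq_iff)
qed

lemma s_braid: assumes "{i, j} \<in> E" shows "s i \<circ> s j \<circ> s i = s j \<circ> s i \<circ> s j"
proof -
  have p: "pairing i (x(j := x j + c)) = pairing i x - c" if "{i, j} \<in> E" for x c i j
  proof -
    have h: "j \<in> nbs i" "i \<noteq> j" using that edge_verts by (auto simp: nbs_def)
    have "(\<Sum>k\<in>nbs i. (x(j := x j + c)) k) = (\<Sum>k\<in>nbs i. x k + (if k = j then c else 0))"
      by (rule sum.cong) auto
    then show ?thesis using h finite_nbs[of i] by (simp add: pairing_def sum.distrib)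
  qed
  have p2: "pairing i (x(i := x i + c)) = pairing i x + 2 * c" for x c i
  proof -
    have "(\<Sum>k\<in>nbs i. (x(i := x i + c)) k) = (\<Sum>k\<in>nbs i. x k)"
      by (rule sum.cong) (use not_nbs_self in auto)
    then show ?thesis by (simp add: pairing_def)
  qed
  have ps: "pairing i (s j x) = pairing i x + pairing j x" if "{i, j} \<in> E" for x i j
    using p[of i j x "- pairing j x"] that by (simp add: s_pairing)
  have ps2: "pairing i (s i x) = - pairing i x" for x i
    using p2[of i x "- pairing i x"] by (simp add: s_pairing)
  have tri: "s i (s j (s i x)) = x(i := x i - pairing i x - pairing j x, j := x j - pairing i x - pairing j x)"
    if "{i, j} \<in> E" for x i j
  proof -
    have "{j, i} \<in> E" "i \<noteq> j" using that edge_verts by (auto simp: insert_commute)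
    then have 1: "pairing j (s i x) = pairing i x + pairing j x" using ps[of j i x] by simp
    have 2: "pairing i (s j (s i x)) = pairing j x" using ps[OF that, of "s i x"] ps2[of i x] 1 by simp
    define y where "y = s i x"
    define z where "z = s j y"
    have "y = x(i := x i - pairing i x)" by (simp add: y_def s_pairing)
    moreover have "z = y(j := y j - pairing i x - pairing j x)"
      using 1 s_pairing[of j y] by (simp add: z_def y_def diff_diff_eq)
    moreover have "s i z = z(i := z i - pairing j x)" using 2 s_pairing[of i z] by (simp add: z_def y_def)
    ultimately have "s i z = x(i := x i - pairing i x - pairing j x, j := x j - pairing i x - pairing j x)"
      using \<open>i \<noteq> j\<close> by auto
    then show ?thesis by (simp add: z_def y_def)
  qed
  have e: "{j, i} \<in> E" "i \<noteq> j" using assms edge_verts by (auto simp: insert_commute)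
  have "s i (s j (s i x)) = s j (s i (s j x))" for x
    unfolding tri[OF assms] tri[OF e(1)] using e(2) by (auto simp: fun_eq_iff)
  then show ?thesis by (auto simp: fun_eq_iff)
qed

end

text \<open>Bounding every coordinate by the form expresses at once that the form is positive definite and that
it takes each value only finitely often.\<close>

locale definite_graph = oriented_graph V E Q for V :: "'v set" and E Q +
  assumes coercive: "i \<in> V \<Longrightarrow> \<exists>N. \<forall>x. x i * x i \<le> N * tits_form V Q x"
begin

lemma q_pos: assumes "v \<in> V" "x v \<noteq> 0" shows "q x \<ge> 1"
proof (rule ccontr)
  assume "\<not> q x \<ge> 1"
  then have q: "q x \<le> 0" by simp
  obtain N where N: "\<And>x. x v * x v \<le> N * q x" using coercive[OF assms(1)] by auto
  have "1 \<le> N" using N[of "\<alpha> v"] simple_root_pos[OF assms(1)] by (simp add: simple_root_def pos_def roots_def)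
  then have "N * q x \<le> 0" using q by (simp add: mult_nonneg_nonpos)
  then have "x v * x v \<le> 0" using N[of x] by linarith
  moreover have "x v * x v > 0" using assms(2) by (simp add: zero_less_mult_iff linorder_neq_iff disj_commute)
  ultimately show False by simp
qed

text \<open>Write \<open>x = y - z\<close> with the positive part \<open>y\<close> and the negative part \<open>z\<close>. Products of a coordinate of \<open>y\<close>
with one of \<open>z\<close> contribute nonnegatively to the form, so its value at \<open>x\<close> is at least the sum of the
values at \<open>y\<close> and \<open>z\<close>. That would be at least 2 if neither part vanished.\<close>

lemma root_pos_or_neg: assumes x: "x \<in> roots" shows "x \<in> pos \<or> - x \<in> pos"
proof -
  define y z where "y = (\<lambda>v. max (x v) 0)" and "z = (\<lambda>v. max (- x v) 0)"
  have sq: "x v * x v = y v * y v + z v * z v" for v by (auto simp: y_def z_def max_def)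
  have le: "x a * x b \<le> y a * y b + z a * z b" for a b
    by (auto simp: y_def z_def max_def mult_nonneg_nonpos mult_nonpos_nonneg)
  have "(\<Sum>(a, b)\<in>Q. x a * x b) \<le> (\<Sum>(a, b)\<in>Q. y a * y b + z a * z b)"
    by (rule sum_mono) (use le in auto)
  then have "q x \<ge> q y + q z"
    unfolding tits_form_def by (simp add: sq sum.distrib case_prod_unfold)
  moreover have "q x = 1" using x by (auto simp: roots_def)
  moreover have "q y \<ge> 0" "q z \<ge> 0"
  proof -
    have "q u \<ge> 0" if "\<And>v. u v = 0 \<or> (\<exists>v\<in>V. u v \<noteq> 0)" for u
    proof (cases "\<exists>v\<in>V. u v \<noteq> 0")
      case True
      then show ?thesis using q_pos[of _ u] by fastforce
    next
      case False
      then have "u = 0" using that by (auto simp: fun_eq_iff)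
      then show ?thesis by simp
    qed
    moreover have "y v = 0 \<or> (\<exists>v\<in>V. y v \<noteq> 0)" "z v = 0 \<or> (\<exists>v\<in>V. z v \<noteq> 0)" for v
      using x by (auto simp: y_def z_def roots_def)
    ultimately show "q y \<ge> 0" "q z \<ge> 0" by blast+
  qed
  ultimately have "q y < 1 \<or> q z < 1" by linarith
  then have "(\<forall>v\<in>V. y v = 0) \<or> (\<forall>v\<in>V. z v = 0)" using q_pos by (meson linorder_not_le)
  then have "(\<forall>v\<in>V. x v \<le> 0) \<or> (\<forall>v\<in>V. x v \<ge> 0)"
    by (auto simp: y_def z_def max_def split: if_splits)
  moreover have "x v = 0" if "v \<notin> V" for v using x that by (auto simp: roots_def)
  moreover have "q (- x) = q x" by (simp add: tits_form_def)
  ultimately show ?thesis using x by (auto simp: pos_def roots_def)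
qed

lemma finite_pos: "finite pos"
proof -
  obtain N where N: "\<And>i x. i \<in> V \<Longrightarrow> x i * x i \<le> N i * q x" using coercive by metis
  define M where "M = (\<Sum>i\<in>V. \<bar>N i\<bar>)"
  have "x i \<in> {0..M}" if "x \<in> pos" "i \<in> V" for x i
  proof -
    have "N i \<le> M" unfolding M_def using member_le_sum[OF that(2), of "\<lambda>i. \<bar>N i\<bar>"] finite_V by fastforce
    then have "x i * x i \<le> M" "0 \<le> x i" using N[OF that(2), of x] that by (auto simp: pos_def roots_def)
    moreover have "x i \<le> x i * x i" if "0 \<le> x i" using that by (cases "x i = 0") (auto simp: mult_le_cancel_left1)
    ultimately show ?thesis by auto
  qed
  then have "pos \<subseteq> {f. \<forall>v. (v \<in> V \<longrightarrow> f v \<in> {0..M}) \<and> (v \<notin> V \<longrightarrow> f v = 0)}"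
    by (auto simp: pos_def roots_def)
  then show ?thesis
    using finite_set_of_finite_funs[OF finite_V, of "{0..M}" 0] finite_subset by blast
qed

lemma W_pos_or_neg: "w \<in> W \<Longrightarrow> x \<in> pos \<Longrightarrow> w x \<in> pos \<or> - w x \<in> pos"
  using root_pos_or_neg W_roots by (auto simp: pos_def)

text \<open>A positive root other than \<open>\<alpha>\<^sub>i\<close> has a positive coordinate away from \<open>i\<close>, which the reflection does not
change.\<close>

lemma s_pos: assumes i: "i \<in> V" and x: "x \<in> pos" "x \<noteq> \<alpha> i" shows "s i x \<in> pos"
proof -
  have "\<exists>k. k \<noteq> i \<and> x k \<noteq> 0"
  proof (rule ccontr)
    assume "\<not> ?thesis"
    then have x0: "x = 0(i := 0 + x i)" by (auto simp: fun_eq_iff)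
    have "pairing i 0 = 0" by (simp add: pairing_def)
    moreover have "q x = 1" "x i \<ge> 0" using x by (auto simp: pos_def roots_def)
    ultimately have "x i * x i = 1" using q_update[OF i, of 0 "x i"] x0 by simp
    then have "x i = 1" using \<open>x i \<ge> 0\<close> by (auto simp: zmult_eq_1_iff)
    then show False using x0 x(2) by (auto simp: simple_root_def fun_eq_iff zero_fun_def)
  qed
  then obtain k where k: "k \<noteq> i" "x k > 0" using x by (auto simp: pos_def) (metis order_le_less)
  then have "s i x k > 0" by (simp add: s_pairing)
  then have "- s i x \<notin> pos" by (auto simp: pos_def not_le)
  then show ?thesis using W_pos_or_neg[OF s_W[OF i] x(1)] by blast
qed

definition inversions :: "(('v \<Rightarrow> int) \<Rightarrow> ('v \<Rightarrow> int)) \<Rightarrow> ('v \<Rightarrow> int) set" where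
  "inversions w = {\<beta> \<in> pos. - inv_into UNIV w \<beta> \<in> pos}"

lemma finite_inversions: "finite (inversions w)"
  using finite_pos by (simp add: inversions_def)

lemma inv_s: "i \<in> V \<Longrightarrow> w \<in> W \<Longrightarrow> inv_into UNIV (w \<circ> s i) = s i \<circ> inv_into UNIV w"
  by (rule inv_unique_comp) (auto simp: fun_eq_iff s_s)

lemma not_inversion: "w \<in> W \<Longrightarrow> \<beta> \<in> pos \<Longrightarrow> \<beta> \<notin> inversions w \<longleftrightarrow> inv_into UNIV w \<beta> \<in> pos"
  using W_pos_or_neg[OF inv_W] pos_not_neg by (auto simp: inversions_def)

lemma inversions_ascent:
  assumes w: "w \<in> W" and i: "i \<in> V" and asc: "w (\<alpha> i) \<in> pos"
  shows "inversions (w \<circ> s i) = insert (w (\<alpha> i)) (inversions w)" "w (\<alpha> i) \<notin> inversions w"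
proof -
  have ai: "inv_into UNIV w (w (\<alpha> i)) = \<alpha> i" using w by simp
  show notin: "w (\<alpha> i) \<notin> inversions w"
    using not_inversion[OF w asc] ai simple_root_pos[OF i] by simp
  have "\<beta> \<in> inversions (w \<circ> s i) \<longleftrightarrow> \<beta> \<in> inversions w" if b: "\<beta> \<in> pos" "\<beta> \<noteq> w (\<alpha> i)" for \<beta>
  proof -
    define \<gamma> where "\<gamma> = inv_into UNIV w \<beta>"
    have \<beta>: "\<beta> = w \<gamma>" using w by (simp add: \<gamma>_def)
    have \<gamma>1: "\<gamma> \<noteq> \<alpha> i" using b \<beta> by auto
    have "- \<gamma> \<noteq> \<alpha> i"
    proof
      assume "- \<gamma> = \<alpha> i"
      then have "- \<beta> = w (\<alpha> i)" using \<beta> W_uminus[OF w, of \<gamma>] by simp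
      then show False using asc b pos_not_neg by metis
    qed
    then have "- \<gamma> \<in> pos \<longleftrightarrow> - s i \<gamma> \<in> pos"
      using s_pos[OF i, of "- \<gamma>"] s_pos[OF i, of "\<gamma>"] \<gamma>1 W_pos_or_neg[OF inv_W[OF w] b(1)] pos_not_neg
      by (auto simp: s_uminus \<gamma>_def)
    then show ?thesis using b by (simp add: inversions_def inv_s[OF i w] \<gamma>_def)
  qed
  moreover have "w (\<alpha> i) \<in> inversions (w \<circ> s i)"
    using asc simple_root_pos[OF i] by (simp add: inversions_def inv_s[OF i w] ai s_simple_root_self[OF i])
  moreover have "inversions (w \<circ> s i) \<subseteq> pos" "inversions w \<subseteq> pos" by (auto simp: inversions_def)
  ultimately show "inversions (w \<circ> s i) = insert (w (\<alpha> i)) (inversions w)" using asc by blast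
qed

lemma descent_s: "i \<in> V \<Longrightarrow> w \<in> W \<Longrightarrow> - w (\<alpha> i) = (w \<circ> s i) (\<alpha> i)"
  by (metis o_apply s_simple_root_self W_uminus)

lemma card_inversions_ascent:
  "w \<in> W \<Longrightarrow> i \<in> V \<Longrightarrow> w (\<alpha> i) \<in> pos \<Longrightarrow> card (inversions (w \<circ> s i)) = Suc (card (inversions w))"
  using inversions_ascent finite_inversions by simp

lemma card_inversions_descent:
  assumes "w \<in> W" "i \<in> V" "- w (\<alpha> i) \<in> pos"
  shows "card (inversions w) = Suc (card (inversions (w \<circ> s i)))"
proof -
  have "(w \<circ> s i) (\<alpha> i) \<in> pos" using assms(3) descent_s[OF assms(2,1)] by simp
  then show ?thesis
    using card_inversions_ascent[OF W_comp[OF assms(1) s_W[OF assms(2)]] assms(2)] by (simp only: comp_s_s)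
qed

lemma card_inversions_word:
  assumes "is \<in> lists V" and "\<And>xs j zs. is = xs @ j # zs \<Longrightarrow> word xs (\<alpha> j) \<in> pos"
  shows "card (inversions (word is)) = length is"
  using assms
proof (induction "is" rule: rev_induct)
  case Nil
  have "inversions id = {}" using pos_not_neg by (auto simp: inversions_def inv_id)
  then have "card (inversions (word [])) = length []" by simp
  then show ?case .
next
  case (snoc j "is")
  have "word is (\<alpha> j) \<in> pos" using snoc.prems(2)[of "is" j "[]"] by simp
  moreover have "card (inversions (word is)) = length is"
    using snoc.IH snoc.prems by auto
  ultimately have "card (inversions (word (is @ [j]))) = length (is @ [j])"
    using card_inversions_ascent[of "word is" j] snoc.prems(1) word_W[of "is"] by simp
  then show ?case .
qed

text \<open>The reflection at \<open>i\<close> is \<open>x \<mapsto> x - \<langle>x, \<alpha>\<^sub>i\<rangle>\<alpha>\<^sub>i\<close>, and the pairing can be read off from the Tits form,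
which \<open>u\<close> preserves.\<close>

lemma root_conjugate:
  assumes "u \<in> W" "i \<in> V" "j \<in> V" "u (\<alpha> j) = \<alpha> i"
  shows "u \<circ> s j = s i \<circ> u"
proof
  fix x
  have "q (u x + \<alpha> i) = q (x + \<alpha> j)"
    using W_add[OF assms(1), of x "\<alpha> j"] q_W[OF assms(1), of "x + \<alpha> j"] assms(4) by metis
  then have p: "pairing i (u x) = pairing j x"
    using pairing_q[OF assms(2), of "u x"] pairing_q[OF assms(3), of x] q_W[OF assms(1)] by simp
  have s: "s k y = y + (\<lambda>v. - pairing k y * \<alpha> k v)" for k y
    by (auto simp: s_pairing fun_eq_iff simple_root_def)
  have "u (s j x) = u x + (\<lambda>v. - pairing j x * \<alpha> i v)"
    by (simp only: s[of j x] W_add[OF assms(1)] W_scale[OF assms(1)] assms(4))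
  then show "(u \<circ> s j) x = (s i \<circ> u) x" using s[of i "u x"] p by simp
qed

text \<open>The deletion property. At a step that descends, the root has become negative because of an earlier
letter; conjugating one of the two reflections into the other shows that both letters can be
deleted.\<close>

lemma word_nonreduced:
  assumes "is \<in> lists V" "card (inversions (word is)) \<noteq> length is"
  shows "\<exists>js\<in>lists V. word js = word is \<and> length js < length is"
proof -
  obtain xs j zs where is_eq: "is = xs @ j # zs" and neg: "word xs (\<alpha> j) \<notin> pos"
    using card_inversions_word[OF assms(1)] assms(2) by blast
  have xs: "xs \<in> lists V" and j: "j \<in> V" and zs: "zs \<in> lists V" using assms(1) is_eq by auto
  have "\<exists>ys k us. xs = ys @ k # us \<and> word us (\<alpha> j) = \<alpha> k"
    using xs neg
  proof (induction xs)
    case Nil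
    then show ?case using simple_root_pos[OF j] by simp
  next
    case (Cons k xs)
    show ?case
    proof (cases "word xs (\<alpha> j) \<in> pos")
      case True
      have "k \<in> V" using Cons by simp
      then have "word xs (\<alpha> j) = \<alpha> k" using Cons.prems s_pos[OF \<open>k \<in> V\<close> True] by auto
      then show ?thesis by (intro exI[of _ "[]"]) auto
    next
      case False
      then obtain ys l us where "xs = ys @ l # us" "word us (\<alpha> j) = \<alpha> l" using Cons by auto
      then show ?thesis by (intro exI[of _ "k # ys"]) auto
    qed
  qed
  then obtain ys k us where xs_eq: "xs = ys @ k # us" and conj: "word us (\<alpha> j) = \<alpha> k" by auto
  have us: "us \<in> lists V" "k \<in> V" "ys \<in> lists V" using xs xs_eq by auto
  have c: "word us \<circ> s j = s k \<circ> word us" using root_conjugate[OF word_W[OF us(1)] us(2) j conj] .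
  have "s k \<circ> (word us \<circ> (s j \<circ> f)) = word us \<circ> f" for f :: "('v \<Rightarrow> int) \<Rightarrow> 'v \<Rightarrow> int"
  proof -
    have "s k \<circ> (word us \<circ> (s j \<circ> f)) = s k \<circ> ((word us \<circ> s j) \<circ> f)" by (simp only: comp_assoc)
    also have "\<dots> = word us \<circ> f" unfolding c by (simp only: comp_assoc s_s_comp)
    finally show ?thesis .
  qed
  then have "word (ys @ us @ zs) = word is" by (simp add: is_eq xs_eq comp_assoc)
  then show ?thesis using us zs by (intro bexI[of _ "ys @ us @ zs"]) (auto simp: is_eq xs_eq)
qed

lemma card_inversions_le_length: "is \<in> lists V \<Longrightarrow> card (inversions (word is)) \<le> length is"
proof (induction "is" rule: rev_induct)
  case Nil
  then have "card (inversions (word [])) \<le> length []" using card_inversions_word[of "[]"] by simp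
  then show ?case .
next
  case (snoc j "is")
  have j: "j \<in> V" and i: "word is \<in> W" using snoc.prems by auto
  have "word is (\<alpha> j) \<in> pos \<or> - word is (\<alpha> j) \<in> pos"
    using W_pos_or_neg[OF i simple_root_pos[OF j]] .
  then have "card (inversions (word (is @ [j]))) \<le> length (is @ [j])"
    using card_inversions_ascent[OF i j] card_inversions_descent[OF i j] snoc.IH snoc.prems by auto
  then show ?case .
qed

lemma weyl_length_inversions: assumes "w \<in> W" shows "weyl_length V E w = card (inversions w)"
proof -
  have ex: "\<exists>n. \<exists>is\<in>lists V. length is = n \<and> word is = w" using W_word[OF assms] by metis
  obtain "is" where rw: "is \<in> lists V" "length is = weyl_length V E w" "word is = w"
    using LeastI_ex[OF ex] unfolding weyl_length_def by auto
  have "weyl_length V E w \<le> length js" if "js \<in> lists V" "word js = w" for js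
    unfolding weyl_length_def using that by (intro Least_le) auto
  then show ?thesis using word_nonreduced[OF rw(1)] rw by (metis not_le)
qed

lemma reduced_word_iff:
  "w \<in> W \<Longrightarrow> reduced_word V E w is \<longleftrightarrow> is \<in> lists V \<and> word is = w \<and> length is = card (inversions w)"
  by (auto simp: reduced_word_def weyl_length_inversions)

lemma reduced_word_exists: assumes "w \<in> W" shows "\<exists>is. reduced_word V E w is"
proof -
  have ex: "\<exists>n. \<exists>is\<in>lists V. length is = n \<and> word is = w" using W_word[OF assms] by metis
  show ?thesis using LeastI_ex[OF ex] unfolding weyl_length_def reduced_word_def by auto
qed

lemma reduced_word_snoc:
  assumes w: "w \<in> W" and i: "i \<in> V" and asc: "w (\<alpha> i) \<in> pos"
  shows "reduced_word V E (w \<circ> s i) (is @ [i]) \<longleftrightarrow> reduced_word V E w is"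
proof -
  have "word is = w" if "word is \<circ> s i = w \<circ> s i"
    using that comp_s_s by metis
  then show ?thesis
    using card_inversions_ascent[OF assms] i
    by (auto simp: reduced_word_iff w W_comp s_W)
qed

lemma reduced_word_snocD:
  assumes w: "w \<in> W" and red: "reduced_word V E w (is @ [i])"
  shows "i \<in> V \<and> - w (\<alpha> i) \<in> pos"
proof -
  have rw: "is \<in> lists V" "i \<in> V" "word is \<circ> s i = w" "card (inversions w) = Suc (length is)"
    using red w by (auto simp: reduced_word_iff)
  have "word is (\<alpha> i) \<in> pos"
  proof (rule ccontr)
    assume "word is (\<alpha> i) \<notin> pos"
    then have "- word is (\<alpha> i) \<in> pos" using W_pos_or_neg[OF word_W[OF rw(1)] simple_root_pos[OF rw(2)]] by auto
    then have "card (inversions (word is)) = Suc (card (inversions w))"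
      using card_inversions_descent[OF word_W[OF rw(1)] rw(2)] rw(3) by simp
    then show False using card_inversions_le_length[OF rw(1)] rw(4) by simp
  qed
  moreover have "- w (\<alpha> i) = word is (\<alpha> i)"
    unfolding rw(3)[symmetric] using W_uminus[OF word_W[OF rw(1)], of "\<alpha> i"] s_simple_root_self[OF rw(2)] by simp
  ultimately show ?thesis using rw(2) by simp
qed

lemma no_descent_id:
  assumes w: "w \<in> W" and asc: "\<And>i. i \<in> V \<Longrightarrow> w (\<alpha> i) \<in> pos"
  shows "w = id"
proof -
  obtain "is" where rw: "reduced_word V E w is" using reduced_word_exists[OF w] by auto
  show ?thesis
  proof (cases "is" rule: rev_cases)
    case Nil
    then show ?thesis using rw by (simp add: reduced_word_def)
  next
    case (snoc js j)
    then show ?thesis using reduced_word_snocD[OF w] rw asc pos_not_neg by metis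
  qed
qed

end

section \<open>The weak order as inclusion of inversion sets\<close>

context definite_graph
begin

abbreviation L :: "(('v \<Rightarrow> int) \<Rightarrow> ('v \<Rightarrow> int)) gorder" where "L \<equiv> weak_order V E"

lemma carrier_L [simp]: "carrier L = W" and eq_L [simp]: "(.=\<^bsub>L\<^esub>) = (=)"
  by (simp_all add: weak_order_def)

lemma pos_neg_cases:
  assumes "w \<in> W" "i \<in> V" obtains "w (\<alpha> i) \<in> pos" "- w (\<alpha> i) \<notin> pos" | "- w (\<alpha> i) \<in> pos" "w (\<alpha> i) \<notin> pos"
  using W_pos_or_neg[OF assms(1) simple_root_pos[OF assms(2)]] pos_not_neg by blast

text \<open>If there were no such \<open>i\<close>, the element \<open>u\<inverse>v\<close> would send all simple roots to positive roots, and thus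
be the identity. The next lemma holds for the same reason.\<close>

lemma ascent_between:
  assumes v: "v \<in> W" and u: "u \<in> W" and sub: "inversions v \<subseteq> inversions u" and ne: "v \<noteq> u"
  shows "\<exists>i\<in>V. v (\<alpha> i) \<in> pos \<and> v (\<alpha> i) \<in> inversions u"
proof (rule ccontr)
  assume no: "\<not> ?thesis"
  let ?w = "inv_into UNIV u \<circ> v"
  have w: "?w \<in> W" using inv_W[OF u] v by auto
  have "?w (\<alpha> i) \<in> pos" if i: "i \<in> V" for i
    using v i
  proof (cases rule: pos_neg_cases)
    case 1
    then show ?thesis using no i not_inversion[OF u] by auto
  next
    case 2
    then have "- v (\<alpha> i) \<in> inversions v"
      using simple_root_pos[OF i] W_uminus[OF inv_W[OF v], of "v (\<alpha> i)"] v by (simp add: inversions_def)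
    then have "- v (\<alpha> i) \<in> inversions u" using sub by auto
    then show ?thesis using W_uminus[OF inv_W[OF u], of "v (\<alpha> i)"] by (simp add: inversions_def)
  qed
  then have "?w = id" using no_descent_id[OF w] by auto
  then have "v = u" using u by (metis W_inv_apply(2) comp_apply ext id_apply)
  then show False using ne by simp
qed

lemma descent_between:
  assumes v: "v \<in> W" and u: "u \<in> W" and sub: "inversions v \<subseteq> inversions u" and ne: "v \<noteq> u"
  shows "\<exists>i\<in>V. - u (\<alpha> i) \<in> pos \<and> - u (\<alpha> i) \<notin> inversions v"
proof (rule ccontr)
  assume no: "\<not> ?thesis"
  let ?w = "inv_into UNIV v \<circ> u"
  have w: "?w \<in> W" using inv_W[OF v] u by auto
  have "?w (\<alpha> i) \<in> pos" if i: "i \<in> V" for i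
    using u i
  proof (cases rule: pos_neg_cases)
    case 1
    then have "u (\<alpha> i) \<notin> inversions u" using not_inversion[OF u 1(1)] simple_root_pos[OF i] u by simp
    then show ?thesis using not_inversion[OF v 1(1)] sub by auto
  next
    case 2
    then have "- u (\<alpha> i) \<in> inversions v" using no i by auto
    then show ?thesis using W_uminus[OF inv_W[OF v], of "u (\<alpha> i)"] by (simp add: inversions_def)
  qed
  then have "?w = id" using no_descent_id[OF w] by auto
  then have "v = u" using v by (metis W_inv_apply(2) comp_apply ext id_apply)
  then show False using ne by simp
qed

lemma inversions_subset_factor:
  assumes "v \<in> W" "u \<in> W" "inversions v \<subseteq> inversions u"
  shows "\<exists>js\<in>lists V. u = v \<circ> word js \<and> card (inversions v) + length js = card (inversions u)"
  using assms
proof (induction "card (inversions u) - card (inversions v)" arbitrary: v rule: less_induct)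
  case less
  show ?case
  proof (cases "v = u")
    case True
    then show ?thesis by (intro bexI[of _ "[]"]) auto
  next
    case False
    then obtain i where i: "i \<in> V" "v (\<alpha> i) \<in> pos" "v (\<alpha> i) \<in> inversions u"
      using ascent_between less.prems by blast
    note inv = inversions_ascent[OF less.prems(1) i(1,2)]
    have sub: "inversions (v \<circ> s i) \<subseteq> inversions u" using inv i less.prems by auto
    have "card (inversions (v \<circ> s i)) \<le> card (inversions u)" using sub by (rule card_mono[OF finite_inversions])
    then have "card (inversions u) - card (inversions (v \<circ> s i)) < card (inversions u) - card (inversions v)"
      using card_inversions_ascent[OF less.prems(1) i(1,2)] by simp
    then obtain js where "js \<in> lists V" "u = (v \<circ> s i) \<circ> word js"
      "card (inversions (v \<circ> s i)) + length js = card (inversions u)"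
      using less.hyps[of "v \<circ> s i"] sub less.prems i by blast
    then show ?thesis
      using card_inversions_ascent[OF less.prems(1) i(1,2)] i(1)
      by (intro bexI[of _ "i # js"]) (auto simp: comp_assoc)
  qed
qed

lemma card_inversions_comp_le:
  assumes "v \<in> W" "is \<in> lists V"
  shows "card (inversions (v \<circ> word is)) \<le> card (inversions v) + length is"
proof -
  obtain vs where vs: "vs \<in> lists V" "word vs = v" "length vs = card (inversions v)"
    using reduced_word_exists[OF assms(1)] reduced_word_iff[OF assms(1)] by auto
  then show ?thesis using card_inversions_le_length[of "vs @ is"] assms(2) by simp
qed

lemma length_additive_inversions:
  assumes "v \<in> W" "js \<in> lists V" "card (inversions (v \<circ> word js)) = card (inversions v) + length js"
  shows "inversions v \<subseteq> inversions (v \<circ> word js)"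
  using assms(2,3)
proof (induction js rule: rev_induct)
  case Nil
  then show ?case by simp
next
  case (snoc j js)
  have js: "js \<in> lists V" "j \<in> V" using snoc.prems by auto
  define u where "u = v \<circ> word js"
  have u: "u \<in> W" using assms(1) js by (auto simp only: u_def)
  have eq: "v \<circ> word (js @ [j]) = u \<circ> s j" by (simp add: comp_assoc u_def)
  have "card (inversions (v \<circ> word (js @ [j]))) = card (inversions v) + length (js @ [j])"
    using snoc.prems(2) .
  then have prem: "card (inversions (u \<circ> s j)) = Suc (card (inversions v) + length js)"
    unfolding eq by (simp only: length_append list.size add_Suc_right add_0_right)
  have asc: "u (\<alpha> j) \<in> pos"
    using u js(2)
  proof (cases rule: pos_neg_cases)
    case 2
    then show ?thesis
      using card_inversions_descent[OF u js(2)] card_inversions_comp_le[OF assms(1) js(1), folded u_def] prem by simp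
  qed
  have "inversions v \<subseteq> inversions u"
    using snoc.IH[OF js(1)] card_inversions_ascent[OF u js(2) asc] prem by (fold u_def) simp
  then show ?case using inversions_ascent(1)[OF u js(2) asc] unfolding eq by blast
qed

text \<open>Additivity of lengths means that a reduced word of \<open>v\<inverse>u\<close> ascends from \<open>v\<close> to \<open>u\<close>, and every ascending
step adds one inversion; conversely one can ascend from \<open>v\<close> to \<open>u\<close> as long as some inversion of \<open>u\<close> is
missing.\<close>

lemma le_L: assumes "v \<in> W" "u \<in> W" shows "v \<sqsubseteq>\<^bsub>L\<^esub> u \<longleftrightarrow> inversions v \<subseteq> inversions u"
proof -
  let ?x = "inv_into UNIV v \<circ> u"
  have x: "?x \<in> W" using assms inv_W by auto
  have vx: "v \<circ> ?x = u" by (rule ext) (simp add: assms)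
  have le: "v \<sqsubseteq>\<^bsub>L\<^esub> u \<longleftrightarrow> card (inversions u) = card (inversions v) + card (inversions ?x)"
    using assms x by (simp add: weak_order_def weyl_length_inversions)
  obtain xs where xs: "xs \<in> lists V" "word xs = ?x" "length xs = card (inversions ?x)"
    using reduced_word_exists[OF x] reduced_word_iff[OF x] by auto
  show ?thesis
  proof
    assume "v \<sqsubseteq>\<^bsub>L\<^esub> u"
    then show "inversions v \<subseteq> inversions u"
      using length_additive_inversions[OF assms(1) xs(1)] le xs vx by simp
  next
    assume "inversions v \<subseteq> inversions u"
    then obtain js where js: "js \<in> lists V" "u = v \<circ> word js" "card (inversions v) + length js = card (inversions u)"
      using inversions_subset_factor assms by blast
    have "word js = ?x" unfolding js(2) by (rule ext) (simp add: assms(1))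
    then have a: "card (inversions ?x) \<le> length js" using card_inversions_le_length[OF js(1)] by simp
    have "card (inversions u) \<le> card (inversions v) + length xs"
      using card_inversions_comp_le[OF assms(1) xs(1)] xs(2) vx by simp
    then show "v \<sqsubseteq>\<^bsub>L\<^esub> u" using le a js(3) xs(3) by simp
  qed
qed

lemma inversions_eqD:
  assumes "v \<in> W" "u \<in> W" "inversions v = inversions u"
  shows "v = u"
proof (rule ccontr)
  assume "v \<noteq> u"
  then obtain i where i: "i \<in> V" "v (\<alpha> i) \<in> pos" "v (\<alpha> i) \<in> inversions v"
    using ascent_between[OF assms(1,2)] assms(3) by auto
  then show False using inversions_ascent(2)[OF assms(1) i(1,2)] by simp
qed

lemma partial_order_L: "partial_order L"
proof (unfold_locales, goal_cases)
  case (4 x)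
  then show ?case using le_L[of x x] by (simp only: carrier_L)
next
  case (5 x y)
  then show ?case using le_L[of x y] le_L[of y x] inversions_eqD[of x y] by (simp only: carrier_L eq_L subset_antisym)
next
  case (6 x y z)
  then have xyz: "x \<in> W" "y \<in> W" "z \<in> W" by (simp_all only: carrier_L)
  show ?case
    using 6(1,2) unfolding le_L[OF xyz(1,2)] le_L[OF xyz(2,3)] le_L[OF xyz(1,3)] by (rule subset_trans)
qed (auto simp only: eq_L)

lemma covers_ascent:
  assumes "w \<in> W" "i \<in> V" "w (\<alpha> i) \<in> pos"
  shows "covers L (w \<circ> s i) w"
proof -
  interpret partial_order L by (rule partial_order_L)
  define u where "u = w \<circ> s i"
  define \<beta> where "\<beta> = w (\<alpha> i)"
  have inv: "inversions u = insert \<beta> (inversions w)" "\<beta> \<notin> inversions w"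
    unfolding u_def \<beta>_def by (rule inversions_ascent[OF assms])+
  have u: "u \<in> W" unfolding u_def by (rule W_comp[OF assms(1) s_W[OF assms(2)]])
  have between: "B = A \<or> B = insert b A" if "A \<subseteq> B" "B \<subseteq> insert b A" for A B and b :: "'v \<Rightarrow> int"
    using that by blast
  have eq: "z = w \<or> z = u" if z: "z \<in> W" "w \<sqsubseteq>\<^bsub>L\<^esub> z" "z \<sqsubseteq>\<^bsub>L\<^esub> u" for z
    using between[of "inversions w" "inversions z" \<beta>] le_L[OF assms(1) z(1)] le_L[OF z(1) u] z(2,3)
      inversions_eqD[OF z(1) u] inversions_eqD[OF z(1) assms(1)] unfolding inv(1) by blast
  have ne: "w \<noteq> u" using inv by blast
  have le: "w \<sqsubseteq>\<^bsub>L\<^esub> u" using le_L[OF assms(1) u] unfolding inv(1) by blast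
  have "covers L u w"
    unfolding covers_def carrier_L lless_eq
  proof (intro conjI notI)
    assume "\<exists>z\<in>W. (w \<sqsubseteq>\<^bsub>L\<^esub> z \<and> w \<noteq> z) \<and> z \<sqsubseteq>\<^bsub>L\<^esub> u \<and> z \<noteq> u"
    then show False using eq by metis
  qed (use u assms(1) ne le in simp_all)
  then show ?thesis by (simp only: u_def)
qed

lemma ascent_le:
  assumes "x \<in> W" "y \<in> W" "x \<sqsubseteq>\<^bsub>L\<^esub> y" "x \<noteq> y"
  shows "\<exists>i\<in>V. x (\<alpha> i) \<in> pos \<and> x \<circ> s i \<sqsubseteq>\<^bsub>L\<^esub> y"
proof -
  have sub: "inversions x \<subseteq> inversions y" using assms(3) le_L[OF assms(1,2)] by simp
  obtain i where i: "i \<in> V" "x (\<alpha> i) \<in> pos" "x (\<alpha> i) \<in> inversions y"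
    using ascent_between[OF assms(1,2) sub assms(4)] by (elim bexE conjE)
  have "inversions (x \<circ> s i) \<subseteq> inversions y"
    unfolding inversions_ascent(1)[OF assms(1) i(1,2)] using sub i(3) by simp
  then have "x \<circ> s i \<sqsubseteq>\<^bsub>L\<^esub> y" using le_L[OF W_comp[OF assms(1) s_W[OF i(1)]] assms(2)] by (simp only:)
  then show ?thesis using i by (intro bexI[of _ i] conjI)
qed

lemma descent_le:
  assumes "x \<in> W" "y \<in> W" "x \<sqsubseteq>\<^bsub>L\<^esub> y" "x \<noteq> y"
  shows "\<exists>i\<in>V. (y \<circ> s i) (\<alpha> i) \<in> pos \<and> x \<sqsubseteq>\<^bsub>L\<^esub> y \<circ> s i"
proof -
  have sub: "inversions x \<subseteq> inversions y" using assms(3) le_L[OF assms(1,2)] by simp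
  obtain i where i: "i \<in> V" "- y (\<alpha> i) \<in> pos" "- y (\<alpha> i) \<notin> inversions x"
    using descent_between[OF assms(1,2) sub assms(4)] by (elim bexE conjE)
  define z where "z = y \<circ> s i"
  have z: "z \<in> W" unfolding z_def by (rule W_comp[OF assms(2) s_W[OF i(1)]])
  have zi: "z (\<alpha> i) = - y (\<alpha> i)" unfolding z_def using descent_s[OF i(1) assms(2)] by simp
  have "z \<circ> s i = y" unfolding z_def by (rule comp_s_s)
  then have "inversions y = insert (- y (\<alpha> i)) (inversions z)"
    using inversions_ascent(1)[OF z i(1)] i(2) unfolding zi by simp
  then have "inversions x \<subseteq> inversions z" using sub i(3) by (simp add: subset_insert)
  then have "x \<sqsubseteq>\<^bsub>L\<^esub> z" using le_L[OF assms(1) z] by (simp only:)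
  moreover have "z (\<alpha> i) \<in> pos" using i(2) zi by (simp only:)
  ultimately show ?thesis unfolding z_def using i(1) by (intro bexI[of _ i] conjI)
qed

lemma coversE:
  assumes "covers L y x"
  obtains i where "i \<in> V" "x \<in> W" "x (\<alpha> i) \<in> pos" "y = x \<circ> s i"
proof -
  interpret partial_order L by (rule partial_order_L)
  have xy: "x \<in> W" "y \<in> W" "x \<sqsubseteq>\<^bsub>L\<^esub> y" "x \<noteq> y" using coversD[OF assms] by simp_all
  obtain i where i: "i \<in> V" "x (\<alpha> i) \<in> pos" "x \<circ> s i \<sqsubseteq>\<^bsub>L\<^esub> y"
    using ascent_le[OF xy] by (elim bexE conjE)
  define z where "z = x \<circ> s i"
  have "covers L z x" using covers_ascent[OF xy(1) i(1,2)] by (simp only: z_def)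
  moreover have "z \<sqsubseteq>\<^bsub>L\<^esub> y" using i(3) by (simp only: z_def)
  ultimately have "z = y" using assms unfolding covers_def lless_eq by blast
  then show thesis using that[OF i(1) xy(1) i(2)] by (simp only: z_def)
qed

end

section \<open>Squares and hexagons in the weak order\<close>

context definite_graph
begin

lemma pos_add: assumes "x \<in> pos" "y \<in> pos" "x + y \<in> roots" shows "x + y \<in> pos"
  using assms by (simp add: pos_def)

lemma W_add_pos:
  assumes w: "w \<in> W" and e: "{i, j} \<in> E" and x: "w (\<alpha> i) \<in> pos" and y: "w (\<alpha> j) \<in> pos"
  shows "w (\<alpha> i) + w (\<alpha> j) \<in> pos"
proof -
  have ij: "i \<in> V" "j \<in> V" using edge_verts[OF e] by simp_all
  have "w (s i (\<alpha> j)) \<in> roots"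
    using W_roots[OF w W_roots[OF s_W[OF ij(1)]]] simple_root_pos[OF ij(2)] by (simp add: pos_def)
  then have "w (\<alpha> i) + w (\<alpha> j) \<in> roots" by (simp only: s_simple_root_edge[OF e] W_add[OF w])
  then show ?thesis using x y pos_add by simp
qed

lemma rank2_roots:
  assumes w: "w \<in> W"
  shows "{i, j} \<notin> E \<Longrightarrow> i \<noteq> j \<Longrightarrow> (w \<circ> s i) (\<alpha> j) = w (\<alpha> j)"
    and "{i, j} \<in> E \<Longrightarrow> (w \<circ> s i) (\<alpha> j) = w (\<alpha> i) + w (\<alpha> j)"
    and "{i, j} \<in> E \<Longrightarrow> (w \<circ> s i \<circ> s j) (\<alpha> i) = w (\<alpha> j)"
proof -
  show "{i, j} \<notin> E \<Longrightarrow> i \<noteq> j \<Longrightarrow> (w \<circ> s i) (\<alpha> j) = w (\<alpha> j)"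
    by (simp add: s_simple_root_nonedge)
  show "{i, j} \<in> E \<Longrightarrow> (w \<circ> s i) (\<alpha> j) = w (\<alpha> i) + w (\<alpha> j)"
    by (simp add: s_simple_root_edge W_add[OF w])
  assume e: "{i, j} \<in> E"
  have e': "{j, i} \<in> E" using e by (simp add: insert_commute)
  have i: "i \<in> V" using edge_verts[OF e] by simp
  have "s i (s j (\<alpha> i)) = s i (\<alpha> j + \<alpha> i)" by (simp only: s_simple_root_edge[OF e'])
  also have "\<dots> = \<alpha> j"
    by (simp add: s_add s_simple_root_edge[OF e] s_simple_root_self[OF i])
  finally show "(w \<circ> s i \<circ> s j) (\<alpha> i) = w (\<alpha> j)" by (simp only: o_apply)
qed

lemma inversions_square:
  assumes w: "w \<in> W" and ij: "i \<in> V" "j \<in> V" "i \<noteq> j" and e: "{i, j} \<notin> E"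
    and x: "w (\<alpha> i) \<in> pos" and y: "w (\<alpha> j) \<in> pos"
  shows "inversions (w \<circ> s i \<circ> s j) = insert (w (\<alpha> j)) (insert (w (\<alpha> i)) (inversions w))"
    and "w (\<alpha> j) \<notin> insert (w (\<alpha> i)) (inversions w)"
proof -
  have ws: "w \<circ> s i \<in> W" by (rule W_comp[OF w s_W[OF ij(1)]])
  have r: "(w \<circ> s i) (\<alpha> j) = w (\<alpha> j)" using rank2_roots(1)[OF w e ij(3)] .
  have p: "(w \<circ> s i) (\<alpha> j) \<in> pos" using y by (simp only: r)
  show "inversions (w \<circ> s i \<circ> s j) = insert (w (\<alpha> j)) (insert (w (\<alpha> i)) (inversions w))"
    using inversions_ascent(1)[OF ws ij(2) p] unfolding r inversions_ascent(1)[OF w ij(1) x] .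
  show "w (\<alpha> j) \<notin> insert (w (\<alpha> i)) (inversions w)"
    using inversions_ascent(2)[OF ws ij(2) p] unfolding r inversions_ascent(1)[OF w ij(1) x] .
qed

lemma inversions_hexagon:
  assumes w: "w \<in> W" and e: "{i, j} \<in> E"
    and x: "w (\<alpha> i) \<in> pos" and y: "w (\<alpha> j) \<in> pos"
  shows "inversions (w \<circ> s i \<circ> s j) = insert (w (\<alpha> i) + w (\<alpha> j)) (insert (w (\<alpha> i)) (inversions w))"
    and "w (\<alpha> i) + w (\<alpha> j) \<notin> insert (w (\<alpha> i)) (inversions w)"
    and "inversions (w \<circ> s i \<circ> s j \<circ> s i)
       = insert (w (\<alpha> j)) (insert (w (\<alpha> i) + w (\<alpha> j)) (insert (w (\<alpha> i)) (inversions w)))"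
    and "w (\<alpha> j) \<notin> insert (w (\<alpha> i) + w (\<alpha> j)) (insert (w (\<alpha> i)) (inversions w))"
    and "(w \<circ> s i) (\<alpha> j) \<in> pos" and "(w \<circ> s i \<circ> s j) (\<alpha> i) \<in> pos"
proof -
  have ij: "i \<in> V" "j \<in> V" using edge_verts[OF e] by simp_all
  have ws: "w \<circ> s i \<in> W" by (rule W_comp[OF w s_W[OF ij(1)]])
  have wss: "w \<circ> s i \<circ> s j \<in> W" by (rule W_comp[OF ws s_W[OF ij(2)]])
  note r = rank2_roots(2)[OF w e]
  note r2 = rank2_roots(3)[OF w e]
  show p: "(w \<circ> s i) (\<alpha> j) \<in> pos" using W_add_pos[OF w e x y] by (simp only: r)
  show p2: "(w \<circ> s i \<circ> s j) (\<alpha> i) \<in> pos" using y by (simp only: r2)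
  show 1: "inversions (w \<circ> s i \<circ> s j) = insert (w (\<alpha> i) + w (\<alpha> j)) (insert (w (\<alpha> i)) (inversions w))"
    using inversions_ascent(1)[OF ws ij(2) p] unfolding r inversions_ascent(1)[OF w ij(1) x] .
  show "w (\<alpha> i) + w (\<alpha> j) \<notin> insert (w (\<alpha> i)) (inversions w)"
    using inversions_ascent(2)[OF ws ij(2) p] unfolding r inversions_ascent(1)[OF w ij(1) x] .
  show "inversions (w \<circ> s i \<circ> s j \<circ> s i)
       = insert (w (\<alpha> j)) (insert (w (\<alpha> i) + w (\<alpha> j)) (insert (w (\<alpha> i)) (inversions w)))"
    using inversions_ascent(1)[OF wss ij(1) p2] unfolding r2 1 .
  show "w (\<alpha> j) \<notin> insert (w (\<alpha> i) + w (\<alpha> j)) (insert (w (\<alpha> i)) (inversions w))"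
    using inversions_ascent(2)[OF wss ij(1) p2] unfolding r2 1 .
qed

lemma neg_add: assumes "- x \<in> pos" "- y \<in> pos" "x + y \<in> roots" shows "- (x + y) \<in> pos"
proof -
  have "q (- (x + y)) = q (x + y)" unfolding tits_form_def by (simp only: uminus_apply minus_mult_minus)
  then have "- (x + y) \<in> roots" using assms(3) unfolding roots_def by (simp add: plus_fun_def)
  moreover have "- (x + y) = - x + - y" by simp
  ultimately show ?thesis using pos_add[OF assms(1,2)] by (simp only:)
qed

text \<open>Inversion sets are closed, and by the next lemma also coclosed, under sums of roots.
This makes the top of a polygon the join of the two elements above its bottom, and its bottom the
meet of the two elements below its top.\<close>

lemma inversions_add:
  assumes z: "z \<in> W" and x: "x \<in> inversions z" and y: "y \<in> inversions z" and xy: "x + y \<in> pos"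
  shows "x + y \<in> inversions z"
proof -
  define z' where "z' = inv_into UNIV z"
  have z': "z' \<in> W" unfolding z'_def by (rule inv_W[OF z])
  have "z' (x + y) \<in> roots" using W_roots[OF z'] xy by (simp only: pos_def mem_Collect_eq)
  then have r: "z' x + z' y \<in> roots" by (simp only: W_add[OF z'])
  have "- z' x \<in> pos" "- z' y \<in> pos" using x y by (simp_all only: inversions_def z'_def mem_Collect_eq)
  then have "- (z' x + z' y) \<in> pos" using neg_add r by (simp only:)
  then have "- z' (x + y) \<in> pos" by (simp only: W_add[OF z'])
  then show ?thesis using xy by (simp only: inversions_def z'_def mem_Collect_eq)
qed

lemma inversions_add_iff_not:
  assumes z: "z \<in> W" and x: "x \<in> pos" "x \<notin> inversions z" and y: "y \<in> pos" "y \<notin> inversions z" and xy: "x + y \<in> pos"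
  shows "x + y \<notin> inversions z"
proof -
  define z' where "z' = inv_into UNIV z"
  have z': "z' \<in> W" unfolding z'_def by (rule inv_W[OF z])
  have "z' (x + y) \<in> roots" using W_roots[OF z'] xy by (simp only: pos_def mem_Collect_eq)
  then have r: "z' x + z' y \<in> roots" by (simp only: W_add[OF z'])
  have "z' x \<in> pos" "z' y \<in> pos" using x y not_inversion[OF z] by (simp_all only: z'_def)
  then have "z' x + z' y \<in> pos" using pos_add r by (simp only:)
  then have "z' (x + y) \<in> pos" by (simp only: W_add[OF z'])
  then show ?thesis using not_inversion[OF z xy] by (simp only: z'_def)
qed

lemma least_LI:
  assumes "a \<in> W" "b \<in> W" "u \<in> W" "inversions a \<subseteq> inversions u" "inversions b \<subseteq> inversions u"
    and "\<And>z. z \<in> W \<Longrightarrow> inversions a \<subseteq> inversions z \<Longrightarrow> inversions b \<subseteq> inversions z \<Longrightarrow> inversions u \<subseteq> inversions z"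
  shows "least L u (Upper L {a, b})"
proof -
  interpret partial_order L by (rule partial_order_L)
  show ?thesis
  proof (rule least_UpperI)
    fix x assume "x \<in> {a, b}"
    then have "x = a \<or> x = b" by simp
    then show "x \<sqsubseteq>\<^bsub>L\<^esub> u" using le_L[OF assms(1,3)] le_L[OF assms(2,3)] assms(4,5) by (elim disjE) simp_all
  next
    fix z assume z: "z \<in> Upper L {a, b}"
    then have zW: "z \<in> W" using Upper_closed[of L "{a, b}"] by (simp add: subset_iff)
    have "a \<sqsubseteq>\<^bsub>L\<^esub> z" "b \<sqsubseteq>\<^bsub>L\<^esub> z" using Upper_memD[OF z, of a] Upper_memD[OF z, of b] assms(1,2) by simp_all
    then show "u \<sqsubseteq>\<^bsub>L\<^esub> z" using assms(6)[OF zW] le_L[OF assms(1) zW] le_L[OF assms(2) zW] le_L[OF assms(3) zW] by simp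
  qed (use assms(1-3) in simp_all)
qed

lemma greatest_LI:
  assumes "a \<in> W" "b \<in> W" "u \<in> W" "inversions u \<subseteq> inversions a" "inversions u \<subseteq> inversions b"
    and "\<And>z. z \<in> W \<Longrightarrow> inversions z \<subseteq> inversions a \<Longrightarrow> inversions z \<subseteq> inversions b \<Longrightarrow> inversions z \<subseteq> inversions u"
  shows "greatest L u (Lower L {a, b})"
proof -
  interpret partial_order L by (rule partial_order_L)
  show ?thesis
  proof (rule greatest_LowerI)
    fix x assume "x \<in> {a, b}"
    then have "x = a \<or> x = b" by simp
    then show "u \<sqsubseteq>\<^bsub>L\<^esub> x" using le_L[OF assms(3,1)] le_L[OF assms(3,2)] assms(4,5) by (elim disjE) simp_all
  next
    fix z assume z: "z \<in> Lower L {a, b}"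
    then have zW: "z \<in> W" using Lower_closed[of L "{a, b}"] by (simp add: subset_iff)
    have "z \<sqsubseteq>\<^bsub>L\<^esub> a" "z \<sqsubseteq>\<^bsub>L\<^esub> b" using Lower_memD[OF z, of a] Lower_memD[OF z, of b] assms(1,2) by simp_all
    then show "z \<sqsubseteq>\<^bsub>L\<^esub> u" using assms(6)[OF zW] le_L[OF zW assms(1)] le_L[OF zW assms(2)] le_L[OF zW assms(3)] by simp
  qed (use assms(1-3) in simp_all)
qed

lemma square_join_meet:
  assumes w: "w \<in> W" and ij: "i \<in> V" "j \<in> V" "i \<noteq> j" and e: "{i, j} \<notin> E"
    and x: "w (\<alpha> i) \<in> pos" and y: "w (\<alpha> j) \<in> pos"
  shows "least L (w \<circ> s i \<circ> s j) (Upper L {w \<circ> s i, w \<circ> s j})"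
    and "greatest L w (Lower L {w \<circ> s i, w \<circ> s j})"
proof -
  have W: "w \<circ> s i \<in> W" "w \<circ> s j \<in> W" "w \<circ> s i \<circ> s j \<in> W"
    by (intro W_comp w s_W ij)+
  define a b where "a = w (\<alpha> i)" and "b = w (\<alpha> j)"
  note inv = inversions_ascent(1)[OF w ij(1) x, folded a_def] inversions_ascent(1)[OF w ij(2) y, folded b_def]
    inversions_square(1)[OF w ij e x y, folded a_def b_def]
  note ne = inversions_square(2)[OF w ij e x y, folded a_def b_def]
  show "least L (w \<circ> s i \<circ> s j) (Upper L {w \<circ> s i, w \<circ> s j})"
  proof (rule least_LI[OF W(1,2,3)]; unfold inv)
    fix S assume "insert a (inversions w) \<subseteq> S" "insert b (inversions w) \<subseteq> S"
    then show "insert b (insert a (inversions w)) \<subseteq> S" by simp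
  qed (simp_all add: subset_insertI2 subset_insertI insert_mono)
  show "greatest L w (Lower L {w \<circ> s i, w \<circ> s j})"
  proof (rule greatest_LI[OF W(1,2) w]; unfold inv)
    fix S assume "S \<subseteq> insert a (inversions w)" "S \<subseteq> insert b (inversions w)"
    then show "S \<subseteq> inversions w" using ne by blast
  qed (rule subset_insertI)+
qed

lemma hexagon_join_meet:
  assumes w: "w \<in> W" and e: "{i, j} \<in> E"
    and x: "w (\<alpha> i) \<in> pos" and y: "w (\<alpha> j) \<in> pos"
  shows "least L (w \<circ> s i \<circ> s j \<circ> s i) (Upper L {w \<circ> s i, w \<circ> s j})"
    and "greatest L w (Lower L {w \<circ> s i \<circ> s j, w \<circ> s j \<circ> s i})"
proof -
  have ij: "i \<in> V" "j \<in> V" using edge_verts[OF e] by simp_all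
  have e': "{j, i} \<in> E" using e by (simp add: insert_commute)
  have W: "w \<circ> s i \<in> W" "w \<circ> s j \<in> W" "w \<circ> s i \<circ> s j \<in> W" "w \<circ> s j \<circ> s i \<in> W" "w \<circ> s i \<circ> s j \<circ> s i \<in> W"
    by (intro W_comp w s_W ij)+
  define a b where "a = w (\<alpha> i)" and "b = w (\<alpha> j)"
  note inv = inversions_ascent(1)[OF w ij(1) x, folded a_def] inversions_ascent(1)[OF w ij(2) y, folded b_def]
    inversions_hexagon(1)[OF w e x y, folded a_def b_def] inversions_hexagon(3)[OF w e x y, folded a_def b_def]
    inversions_hexagon(1)[OF w e' y x, folded a_def b_def]
  note ne = inversions_hexagon(2,4)[OF w e x y, folded a_def b_def]
  have ab: "a \<in> pos" "b \<in> pos" "a + b \<in> pos" using x y W_add_pos[OF w e x y] by (simp_all only: a_def b_def)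
  show "least L (w \<circ> s i \<circ> s j \<circ> s i) (Upper L {w \<circ> s i, w \<circ> s j})"
  proof (rule least_LI[OF W(1,2,5)]; unfold inv)
    fix z assume z: "z \<in> W" "insert a (inversions w) \<subseteq> inversions z" "insert b (inversions w) \<subseteq> inversions z"
    then have "a + b \<in> inversions z" using inversions_add[OF z(1) _ _ ab(3)] by simp
    then show "insert b (insert (a + b) (insert a (inversions w))) \<subseteq> inversions z" using z by simp
  qed (simp_all add: subset_insertI2 subset_insertI insert_mono)
  show "greatest L w (Lower L {w \<circ> s i \<circ> s j, w \<circ> s j \<circ> s i})"
  proof (rule greatest_LI[OF W(3,4) w]; unfold inv)
    fix z assume z: "z \<in> W" "inversions z \<subseteq> insert (a + b) (insert a (inversions w))"
      "inversions z \<subseteq> insert (b + a) (insert b (inversions w))"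
    have "b \<notin> inversions z" using z(2) ne(2) by blast
    moreover have "a \<notin> inversions z"
    proof
      assume "a \<in> inversions z"
      then have "a \<in> insert (b + a) (insert b (inversions w))" using z(3) by blast
      moreover have "a \<noteq> b + a" using ne(1) by (simp add: add.commute) 
      moreover have "a \<noteq> b" using ne(2) by blast
      moreover have "a \<notin> inversions w" unfolding a_def by (rule inversions_ascent(2)[OF w ij(1) x])
      ultimately show False by simp
    qed
    ultimately have "a + b \<notin> inversions z" using inversions_add_iff_not[OF z(1)] ab by simp
    then show "inversions z \<subseteq> inversions w" using z(2) \<open>a \<notin> inversions z\<close> by (simp add: subset_insert)
  qed (simp_all add: subset_insertI2 subset_insertI)
qed

text \<open>The bottom is \<open>t\<close> times the longest element of the subgroup generated by \<open>s\<^sub>i\<close> and \<open>s\<^sub>j\<close>.\<close>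

lemma rank2_bottom:
  assumes t: "t \<in> W" and ij: "i \<in> V" "j \<in> V" "i \<noteq> j" and x: "- t (\<alpha> i) \<in> pos" and y: "- t (\<alpha> j) \<in> pos"
  obtains (square) w where "{i, j} \<notin> E" "w \<in> W" "w (\<alpha> i) \<in> pos" "w (\<alpha> j) \<in> pos"
      "t = w \<circ> s i \<circ> s j" "t \<circ> s i = w \<circ> s j" "t \<circ> s j = w \<circ> s i"
    | (hexagon) w where "{i, j} \<in> E" "w \<in> W" "w (\<alpha> i) \<in> pos" "w (\<alpha> j) \<in> pos"
      "t = w \<circ> s i \<circ> s j \<circ> s i" "t \<circ> s i = w \<circ> s i \<circ> s j" "t \<circ> s j = w \<circ> s j \<circ> s i"
proof (cases "{i, j} \<in> E")
  case False
  define w where "w = t \<circ> s i \<circ> s j"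
  have sw: "w = t \<circ> s j \<circ> s i" unfolding w_def by (simp only: comp_assoc s_commute[OF False ij(3)])
  have w: "w \<in> W" unfolding w_def by (intro W_comp t s_W ij)
  have F: "{j, i} \<notin> E" "j \<noteq> i" using False ij by (simp_all add: insert_commute)
  have "w (\<alpha> i) = - t (\<alpha> i)"
    unfolding w_def by (simp only: o_apply s_simple_root_nonedge[OF F] s_simple_root_self[OF ij(1)] W_uminus[OF t])
  moreover have "w (\<alpha> j) = - t (\<alpha> j)"
    unfolding sw by (simp only: o_apply s_simple_root_nonedge[OF False ij(3)] s_simple_root_self[OF ij(2)] W_uminus[OF t])
  ultimately have p: "w (\<alpha> i) \<in> pos" "w (\<alpha> j) \<in> pos" using x y by (simp_all only:)
  have tsi: "t \<circ> s i = w \<circ> s j" unfolding w_def by (simp only: comp_s_s)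
  have tsj: "t \<circ> s j = w \<circ> s i" unfolding sw by (simp only: comp_s_s)
  have "t = w \<circ> s i \<circ> s j" unfolding tsj[symmetric] by (simp only: comp_s_s)
  then show thesis by (rule square[OF False w p _ tsi tsj])
next
  case True
  define w where "w = t \<circ> s i \<circ> s j \<circ> s i"
  have sw: "w = t \<circ> s j \<circ> s i \<circ> s j" unfolding w_def using s_braid[OF True] by (simp only: comp_assoc)
  have w: "w \<in> W" unfolding w_def by (intro W_comp t s_W ij)
  have T: "{j, i} \<in> E" using True by (simp add: insert_commute)
  have "w (\<alpha> i) = (t \<circ> s i \<circ> s j) (- \<alpha> i)" unfolding w_def by (simp only: o_apply s_simple_root_self[OF ij(1)])
  also have "\<dots> = - t (\<alpha> j)"
    using rank2_roots(3)[OF t True] W_uminus[OF W_comp[OF W_comp[OF t s_W[OF ij(1)]] s_W[OF ij(2)]], of "\<alpha> i"] by simp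
  finally have 1: "w (\<alpha> i) \<in> pos" using y by simp
  have "w (\<alpha> j) = (t \<circ> s j \<circ> s i) (- \<alpha> j)" unfolding sw by (simp only: o_apply s_simple_root_self[OF ij(2)])
  also have "\<dots> = - t (\<alpha> i)"
    using rank2_roots(3)[OF t T] W_uminus[OF W_comp[OF W_comp[OF t s_W[OF ij(2)]] s_W[OF ij(1)]], of "\<alpha> j"] by simp
  finally have 2: "w (\<alpha> j) \<in> pos" using x by simp
  have a: "w \<circ> s i = t \<circ> s i \<circ> s j" unfolding w_def by (simp only: comp_s_s)
  have a': "w \<circ> s i \<circ> s j = t \<circ> s i" unfolding a by (simp only: comp_s_s)
  have b: "w \<circ> s j = t \<circ> s j \<circ> s i" unfolding sw by (simp only: comp_s_s)
  have b': "w \<circ> s j \<circ> s i = t \<circ> s j" unfolding b by (simp only: comp_s_s)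
  have "t = w \<circ> s i \<circ> s j \<circ> s i" unfolding a' by (simp only: comp_s_s)
  then show thesis by (rule hexagon[OF True w 1 2 _ a'[symmetric] b'[symmetric]])
qed

end

section \<open>Congruences of the weak order\<close>

context definite_graph
begin

lemma card_inversions_mono:
  assumes "x \<in> W" "y \<in> W" "x \<sqsubseteq>\<^bsub>L\<^esub> y" "x \<noteq> y"
  shows "card (inversions x) < card (inversions y)"
proof -
  have "inversions x \<subseteq> inversions y" using assms(3) le_L[OF assms(1,2)] by simp
  moreover have "inversions x \<noteq> inversions y" using inversions_eqD[OF assms(1,2)] assms(4) by metis
  ultimately have "inversions x \<subset> inversions y" by (rule psubsetI)
  then show ?thesis by (rule psubset_card_mono[OF finite_inversions])
qed

lemma card_inversions_le: "card (inversions x) \<le> card pos"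
  by (rule card_mono[OF finite_pos]) (simp add: inversions_def subset_iff)

lemma covers_twoE:
  assumes "covers L y x" "covers L z x" "y \<noteq> z"
  obtains i j where "x \<in> W" "i \<in> V" "j \<in> V" "i \<noteq> j" "x (\<alpha> i) \<in> pos" "x (\<alpha> j) \<in> pos"
    "y = x \<circ> s i" "z = x \<circ> s j"
proof -
  obtain i where i: "i \<in> V" "x \<in> W" "x (\<alpha> i) \<in> pos" "y = x \<circ> s i" using coversE[OF assms(1)] .
  obtain j where j: "j \<in> V" "x \<in> W" "x (\<alpha> j) \<in> pos" "z = x \<circ> s j" using coversE[OF assms(2)] .
  have "i \<noteq> j" using assms(3) i(4) j(4) by metis
  then show thesis using that[OF i(2,1) j(1) _ i(3) j(3) i(4) j(4)] by simp
qed

lemma covered_twoE: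
  assumes "covers L t y" "covers L t z" "y \<noteq> z"
  obtains i j where "t \<in> W" "i \<in> V" "j \<in> V" "i \<noteq> j" "- t (\<alpha> i) \<in> pos" "- t (\<alpha> j) \<in> pos"
    "y = t \<circ> s i" "z = t \<circ> s j"
proof -
  have *: "\<exists>i\<in>V. t \<in> W \<and> - t (\<alpha> i) \<in> pos \<and> y = t \<circ> s i" if ty: "covers L t y" for y
  proof -
    obtain i where i: "i \<in> V" "y \<in> W" "y (\<alpha> i) \<in> pos" "t = y \<circ> s i" using coversE[OF ty] .
    have "- t (\<alpha> i) = y (\<alpha> i)"
      unfolding i(4) by (simp add: s_simple_root_self[OF i(1)] W_uminus[OF i(2)])
    moreover have "y = t \<circ> s i" unfolding i(4) by (simp only: comp_s_s)
    moreover have "t \<in> W" unfolding i(4) by (rule W_comp[OF i(2) s_W[OF i(1)]])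
    ultimately show ?thesis using i(1,3) by metis
  qed
  obtain i where i: "i \<in> V" "t \<in> W" "- t (\<alpha> i) \<in> pos" "y = t \<circ> s i" using *[OF assms(1)] by metis
  obtain j where j: "j \<in> V" "- t (\<alpha> j) \<in> pos" "z = t \<circ> s j" using *[OF assms(2)] by metis
  have "i \<noteq> j" using assms(3) i(4) j(3) by metis
  then show thesis using that[OF i(2,1) j(1) _ i(3) j(2) i(4) j(3)] by simp
qed

text \<open>The polygons provide the joins of two upper covers and the meets of two lower covers. Lower bounds
exist because of the identity element; a top element exists because the group is finite, so that the
join of all its elements is defined.\<close>

lemma lattice_L: "lattice L"
proof -
  interpret partial_order L by (rule partial_order_L)
  interpret up: upper_semilattice L
  proof (rule joins_of_covers_suffice[where rk = "\<lambda>x. card pos - card (inversions x)"])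
    fix x y assume xy: "x \<in> carrier L" "y \<in> carrier L" "x \<sqsubseteq>\<^bsub>L\<^esub> y" "x \<noteq> y"
    then obtain i where i: "i \<in> V" "x (\<alpha> i) \<in> pos" "x \<circ> s i \<sqsubseteq>\<^bsub>L\<^esub> y" using ascent_le[of x y] unfolding carrier_L by metis
    then show "\<exists>z. covers L z x \<and> z \<sqsubseteq>\<^bsub>L\<^esub> y" using covers_ascent[of x i] xy(1) unfolding carrier_L by metis
  next
    fix x y assume "covers L y x"
    then show "card pos - card (inversions y) < card pos - card (inversions x)"
      using card_inversions_mono[of x y] coversD[of y x] card_inversions_le[of y] by (simp add: diff_less_mono2)
  next
    fix x y z assume "covers L y x" "covers L z x" "y \<noteq> z"
    then obtain i j where ij: "x \<in> W" "i \<in> V" "j \<in> V" "i \<noteq> j" "x (\<alpha> i) \<in> pos" "x (\<alpha> j) \<in> pos"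
      "y = x \<circ> s i" "z = x \<circ> s j" by (rule covers_twoE)
    show "\<exists>s. least L s (Upper L {y, z})"
      unfolding ij(7,8)
      using square_join_meet(1)[OF ij(1-4) _ ij(5,6)] hexagon_join_meet(1)[OF ij(1) _ ij(5,6)] by metis
  next
    fix x y assume "x \<in> carrier L" "y \<in> carrier L"
    moreover have "inversions id = {}" using pos_not_neg by (auto simp: inversions_def inv_id)
    ultimately show "\<exists>z\<in>carrier L. z \<sqsubseteq>\<^bsub>L\<^esub> x \<and> z \<sqsubseteq>\<^bsub>L\<^esub> y"
      using le_L[OF id_W, of x] le_L[OF id_W, of y] by (intro bexI[of _ id]) simp_all
  qed
  interpret dual: partial_order "inv_gorder L" 
    rewrites "carrier (inv_gorder L) = carrier L"
      and "le (inv_gorder L) = (\<lambda>x y. le L y x)"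
    using dual_order by simp_all
  have finW: "finite W"
  proof (rule finite_imageD[of inversions])
    show "finite (inversions ` W)"
      by (rule finite_subset[of _ "Pow pos"]) (use finite_pos in \<open>simp_all add: inversions_def image_subset_iff\<close>)
    show "inj_on inversions W" using inversions_eqD by (rule inj_onI)
  qed
  have "least L (\<Squnion>\<^bsub>L\<^esub>W) (Upper L W)"
    by (rule up.finite_sup_least) (use finW id_W in \<open>auto simp only: carrier_L\<close>)
  then have top: "x \<sqsubseteq>\<^bsub>L\<^esub> \<Squnion>\<^bsub>L\<^esub>W" "\<Squnion>\<^bsub>L\<^esub>W \<in> carrier L" if "x \<in> carrier L" for x
    using least_Upper_above[of L _ W x] least_closed[of L "\<Squnion>\<^bsub>L\<^esub>W" "Upper L W"] that by simp_all
  have "upper_semilattice (inv_gorder L)"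
  proof (rule dual.joins_of_covers_suffice[where rk = "\<lambda>x. card (inversions x)"])
    fix x y assume xy: "x \<in> carrier L" "y \<in> carrier L" "y \<sqsubseteq>\<^bsub>L\<^esub> x" "x \<noteq> y"
    then obtain i where i: "i \<in> V" "(x \<circ> s i) (\<alpha> i) \<in> pos" "y \<sqsubseteq>\<^bsub>L\<^esub> x \<circ> s i"
      using descent_le[of y x] unfolding carrier_L by metis
    have xs: "x \<circ> s i \<in> W" using W_comp[OF _ s_W[OF i(1)], of x] xy(1) by simp
    have "covers L x (x \<circ> s i)"
      using covers_ascent[OF xs i(1,2)] unfolding comp_s_s .
    then show "\<exists>z. covers (inv_gorder L) z x \<and> y \<sqsubseteq>\<^bsub>L\<^esub> z" using i(3) unfolding covers_dual by metis
  next
    fix x y assume "covers (inv_gorder L) y x"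
    then show "card (inversions y) < card (inversions x)"
      unfolding covers_dual using card_inversions_mono[of y x] coversD[of x y] by simp
  next
    fix x y z assume "covers (inv_gorder L) y x" "covers (inv_gorder L) z x" "y \<noteq> z"
    then obtain i j where ij: "x \<in> W" "i \<in> V" "j \<in> V" "i \<noteq> j" "- x (\<alpha> i) \<in> pos" "- x (\<alpha> j) \<in> pos"
      "y = x \<circ> s i" "z = x \<circ> s j" unfolding covers_dual by (rule covered_twoE)
    show "\<exists>s. least (inv_gorder L) s (Upper (inv_gorder L) {y, z})"
      unfolding ij(7,8) least_dual Upper_dual
      using ij(1-6)
    proof (cases rule: rank2_bottom)
      case (square w)
      then show "\<exists>sa. greatest L sa (Lower L {x \<circ> s i, x \<circ> s j})"
        using square_join_meet(2)[OF square(2) ij(2-4) square(1,3,4)] by (metis insert_commute)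
    next
      case (hexagon w)
      then show "\<exists>sa. greatest L sa (Lower L {x \<circ> s i, x \<circ> s j})"
        using hexagon_join_meet(2)[OF hexagon(2) hexagon(1,3,4)] by metis
    qed
  next
    fix x y assume "x \<in> carrier L" "y \<in> carrier L"
    then show "\<exists>z\<in>carrier L. x \<sqsubseteq>\<^bsub>L\<^esub> z \<and> y \<sqsubseteq>\<^bsub>L\<^esub> z" using top by (intro bexI[of _ "\<Squnion>\<^bsub>L\<^esub>W"]) simp_all
  qed
  then interpret dual_up: upper_semilattice "inv_gorder L" .
  show ?thesis
  proof
    fix x y assume "x \<in> carrier L" "y \<in> carrier L"
    then have "\<exists>s. least (inv_gorder L) s (Upper (inv_gorder L) {x, y})"
      by (intro dual_up.sup_of_two_exists) simp_all
    then show "\<exists>s. greatest L s (Lower L {x, y})" unfolding least_dual Upper_dual .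
  qed
qed

definition ht :: "('v \<Rightarrow> int) \<Rightarrow> int" where
  "ht \<beta> = (\<Sum>v\<in>V. \<beta> v)"

lemma ht_pos: assumes "\<beta> \<in> pos" shows "ht \<beta> > 0"
proof (rule ccontr)
  assume "\<not> ht \<beta> > 0"
  moreover have "\<beta> v \<ge> 0" for v using assms by (simp add: pos_def)
  ultimately have "ht \<beta> = 0" unfolding ht_def using sum_nonneg[of V \<beta>] by fastforce
  then have "\<forall>v\<in>V. \<beta> v = 0" unfolding ht_def using \<open>\<And>v. \<beta> v \<ge> 0\<close> sum_nonneg_eq_0_iff[OF finite_V, of \<beta>] by simp
  then have "\<beta> = 0" using assms by (auto simp: pos_def roots_def fun_eq_iff)
  then show False using assms by (simp add: pos_def roots_def)
qed

lemma ht_add: "ht (x + y) = ht x + ht y"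
  by (simp add: ht_def sum.distrib)

text \<open>The root of an arrow is the only inversion by which its two ends differ, so the difference of the
weights of the ends is the height of the root.\<close>

definition inversion_weight :: "(('v \<Rightarrow> int) \<Rightarrow> ('v \<Rightarrow> int)) \<Rightarrow> int" where
  "inversion_weight w = sum ht (inversions w)"

lemma inversion_weight_ascent:
  assumes "w \<in> W" "i \<in> V" "w (\<alpha> i) \<in> pos"
  shows "inversion_weight (w \<circ> s i) = inversion_weight w + ht (w (\<alpha> i))"
  unfolding inversion_weight_def inversions_ascent(1)[OF assms]
  using sum.insert[OF finite_inversions inversions_ascent(2)[OF assms], of ht] by (simp only: add.commute)

text \<open>Here \<open>sim\<close> will be isomorphism of layers, for arrows given as pairs of lower and upper end. The
set \<open>C e0\<close> consists of the arrows with a root higher than that of \<open>e0\<close>, and of those of equal height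
that are related to \<open>e0\<close>. It is closed under forcing: opposite arrows of a polygon are related and
have equal roots, and the middle arrows of a hexagon are higher than the outer ones.\<close>

theorem congruence_determines_class:
  fixes sim :: "(('v \<Rightarrow> int) \<Rightarrow> ('v \<Rightarrow> int)) \<times> (('v \<Rightarrow> int) \<Rightarrow> ('v \<Rightarrow> int))
      \<Rightarrow> (('v \<Rightarrow> int) \<Rightarrow> ('v \<Rightarrow> int)) \<times> (('v \<Rightarrow> int) \<Rightarrow> ('v \<Rightarrow> int)) \<Rightarrow> bool"
  assumes sim_refl: "\<And>e. sim e e" and sim_sym: "\<And>e f. sim e f \<Longrightarrow> sim f e"
    and sim_trans: "\<And>e f g. sim e f \<Longrightarrow> sim f g \<Longrightarrow> sim e g"
    and square: "\<And>w i j. w \<in> W \<Longrightarrow> i \<in> V \<Longrightarrow> j \<in> V \<Longrightarrow> i \<noteq> j \<Longrightarrow> {i, j} \<notin> E \<Longrightarrow>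
      w (\<alpha> i) \<in> pos \<Longrightarrow> w (\<alpha> j) \<in> pos \<Longrightarrow> sim (w, w \<circ> s i) (w \<circ> s j, w \<circ> s j \<circ> s i)"
    and hexagon: "\<And>w i j. w \<in> W \<Longrightarrow> {i, j} \<in> E \<Longrightarrow> w (\<alpha> i) \<in> pos \<Longrightarrow> w (\<alpha> j) \<in> pos \<Longrightarrow>
      sim (w, w \<circ> s i) (w \<circ> s j \<circ> s i, w \<circ> s j \<circ> s i \<circ> s j)"
    and cov: "covers L y x" "covers L y' x'" and con: "con L y x = con L y' x'"
  shows "sim (x, y) (x', y')"
proof -
  interpret lattice L by (rule lattice_L)
  define wt where "wt e = inversion_weight (snd e) - inversion_weight (fst e)" for e
  define C where "C e0 = {(x, y). covers L y x \<and> (wt (x, y) > wt e0 \<or> wt (x, y) = wt e0 \<and> sim e0 (x, y))}" for e0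
  have wt: "wt (w, w \<circ> s i) = ht (w (\<alpha> i))" if "w \<in> W" "i \<in> V" "w (\<alpha> i) \<in> pos" for w i
    using inversion_weight_ascent[OF that] by (simp add: wt_def)
  have up: "covers L (w \<circ> s i) w" if "w \<in> W" "i \<in> V" "w (\<alpha> i) \<in> pos" for w i using covers_ascent[OF that] .
  have same: "f \<in> C e0" if "e \<in> C e0" "covers L (snd f) (fst f)" "wt f = wt e" "sim e f" for e f e0
    using that sim_trans[of e0 e f] unfolding C_def by (cases e; cases f) (auto simp only: mem_Collect_eq prod.case fst_conv snd_conv)
  have bigger: "f \<in> C e0" if "e \<in> C e0" "covers L (snd f) (fst f)" "wt f > wt e" for e f e0
    using that unfolding C_def by (cases e; cases f) auto
  have squareC: "(w, w \<circ> s i) \<in> C e0 \<longleftrightarrow> (w \<circ> s j, w \<circ> s j \<circ> s i) \<in> C e0"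
    if h: "w \<in> W" "i \<in> V" "j \<in> V" "i \<noteq> j" "{i, j} \<notin> E" "w (\<alpha> i) \<in> pos" "w (\<alpha> j) \<in> pos" for w i j e0
  proof -
    have ws: "w \<circ> s j \<in> W" by (rule W_comp[OF h(1) s_W[OF h(3)]])
    have e: "{j, i} \<notin> E" "j \<noteq> i" using h by (simp_all add: insert_commute)
    have r: "(w \<circ> s j) (\<alpha> i) = w (\<alpha> i)" by (rule rank2_roots(1)[OF h(1) e])
    have asc: "(w \<circ> s j) (\<alpha> i) \<in> pos" unfolding r by (rule h(6))
    have c: "covers L (w \<circ> s i) w" "covers L (w \<circ> s j \<circ> s i) (w \<circ> s j)"
      by (rule up[OF h(1,2,6)], rule up[OF ws h(2) asc])
    have eq: "wt (w, w \<circ> s i) = wt (w \<circ> s j, w \<circ> s j \<circ> s i)"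
      unfolding wt[OF h(1,2,6)] wt[OF ws h(2) asc] r ..
    show ?thesis
      using same[of "(w, w \<circ> s i)" e0 "(w \<circ> s j, w \<circ> s j \<circ> s i)"]
        same[of "(w \<circ> s j, w \<circ> s j \<circ> s i)" e0 "(w, w \<circ> s i)"] c eq square[OF h] sim_sym[OF square[OF h]]
      by (metis fst_conv snd_conv)
  qed
  have hexagonC: "(w, w \<circ> s i) \<in> C e0 \<longleftrightarrow> (w \<circ> s j \<circ> s i, w \<circ> s j \<circ> s i \<circ> s j) \<in> C e0"
    "(w, w \<circ> s i) \<in> C e0 \<Longrightarrow> (w \<circ> s j, w \<circ> s j \<circ> s i) \<in> C e0"
    "(w, w \<circ> s i) \<in> C e0 \<Longrightarrow> (w \<circ> s i, w \<circ> s i \<circ> s j) \<in> C e0"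
    if h: "w \<in> W" "{i, j} \<in> E" "w (\<alpha> i) \<in> pos" "w (\<alpha> j) \<in> pos" for w i j e0
  proof -
    have ij: "i \<in> V" "j \<in> V" using edge_verts[OF h(2)] by simp_all
    have e: "{j, i} \<in> E" using h by (simp add: insert_commute)
    have wi: "w \<circ> s i \<in> W" by (rule W_comp[OF h(1) s_W[OF ij(1)]])
    have wj: "w \<circ> s j \<in> W" by (rule W_comp[OF h(1) s_W[OF ij(2)]])
    have wji: "w \<circ> s j \<circ> s i \<in> W" by (rule W_comp[OF wj s_W[OF ij(1)]])
    note asc = inversions_hexagon(5,6)[OF h(1) e h(4,3)] inversions_hexagon(5)[OF h(1,2) h(3,4)]
    have c: "covers L (w \<circ> s i) w" "covers L (w \<circ> s j \<circ> s i \<circ> s j) (w \<circ> s j \<circ> s i)"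
      "covers L (w \<circ> s j \<circ> s i) (w \<circ> s j)" "covers L (w \<circ> s i \<circ> s j) (w \<circ> s i)"
      by (rule up[OF h(1) ij(1) h(3)], rule up[OF wji ij(2) asc(2)], rule up[OF wj ij(1) asc(1)], rule up[OF wi ij(2) asc(3)])
    have eq: "wt (w, w \<circ> s i) = wt (w \<circ> s j \<circ> s i, w \<circ> s j \<circ> s i \<circ> s j)"
      unfolding wt[OF h(1) ij(1) h(3)] wt[OF wji ij(2) asc(2)] rank2_roots(3)[OF h(1) e] ..
    have gt: "wt (w, w \<circ> s i) < wt (w \<circ> s j, w \<circ> s j \<circ> s i)" "wt (w, w \<circ> s i) < wt (w \<circ> s i, w \<circ> s i \<circ> s j)"
      unfolding wt[OF h(1) ij(1) h(3)] wt[OF wj ij(1) asc(1)] wt[OF wi ij(2) asc(3)]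
        rank2_roots(2)[OF h(1) e] rank2_roots(2)[OF h(1,2)] ht_add
      using ht_pos[OF h(3)] ht_pos[OF h(4)] by simp_all
    show "(w, w \<circ> s i) \<in> C e0 \<longleftrightarrow> (w \<circ> s j \<circ> s i, w \<circ> s j \<circ> s i \<circ> s j) \<in> C e0"
      using same[of "(w, w \<circ> s i)" e0 "(w \<circ> s j \<circ> s i, w \<circ> s j \<circ> s i \<circ> s j)"]
        same[of "(w \<circ> s j \<circ> s i, w \<circ> s j \<circ> s i \<circ> s j)" e0 "(w, w \<circ> s i)"] c(1,2) eq hexagon[OF h] sim_sym[OF hexagon[OF h]]
      by (metis fst_conv snd_conv)
    show "(w, w \<circ> s i) \<in> C e0 \<Longrightarrow> (w \<circ> s j, w \<circ> s j \<circ> s i) \<in> C e0"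
      "(w, w \<circ> s i) \<in> C e0 \<Longrightarrow> (w \<circ> s i, w \<circ> s i \<circ> s j) \<in> C e0"
      using bigger[of "(w, w \<circ> s i)" e0 "(w \<circ> s j, w \<circ> s j \<circ> s i)"] bigger[of "(w, w \<circ> s i)" e0 "(w \<circ> s i, w \<circ> s i \<circ> s j)"] c(3,4) gt
      by simp_all
  qed
  have join_eq: "y \<squnion>\<^bsub>L\<^esub> z = u" if "least L u (Upper L {y, z})" "y \<in> W" "z \<in> W" for y z u
    using least_unique[OF sup_of_two_least that(1)] that(2,3) by (simp add: join_def)
  have meet_eq: "y \<sqinter>\<^bsub>L\<^esub> z = u" if "greatest L u (Lower L {y, z})" "y \<in> W" "z \<in> W" for y z u
    using greatest_unique[OF inf_of_two_greatest that(1)] that(2,3) by (simp add: meet_def)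
  have Ccov: "covers L y x" if "(x, y) \<in> C e0" for x y e0 using that by (simp add: C_def)
  have join_closed: "join_forcing_closed L (C e0)" for e0
    unfolding join_forcing_closed_def
  proof (intro conjI allI impI)
    fix x y z assume xy: "(x, y) \<in> C e0" and xz: "covers L z x" and "z \<noteq> y"
    then have "y \<noteq> z" by simp
    obtain i j where h: "x \<in> W" "i \<in> V" "j \<in> V" "i \<noteq> j" "x (\<alpha> i) \<in> pos" "x (\<alpha> j) \<in> pos"
      "y = x \<circ> s i" "z = x \<circ> s j" using covers_twoE[OF Ccov[OF xy] xz \<open>y \<noteq> z\<close>] .
    have W: "x \<circ> s i \<in> W" "x \<circ> s j \<in> W" by (intro W_comp s_W h)+
    note xy' = xy[unfolded h(7)]
    show "(z, y \<squnion>\<^bsub>L\<^esub> z) \<in> (C e0)\<^sup>*"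
    proof (cases "{i, j} \<in> E")
      case False
      have "y \<squnion>\<^bsub>L\<^esub> z = x \<circ> s i \<circ> s j"
        unfolding h(7,8) by (rule join_eq[OF square_join_meet(1)[OF h(1-4) False h(5,6)] W])
      also have "\<dots> = x \<circ> s j \<circ> s i" by (simp only: comp_assoc s_commute[OF False h(4)])
      finally have j: "y \<squnion>\<^bsub>L\<^esub> z = x \<circ> s j \<circ> s i" .
      show ?thesis unfolding j unfolding h(8)
        using squareC[OF h(1-4) False h(5,6), of e0] xy' by (metis r_into_rtrancl)
    next
      case True
      have "y \<squnion>\<^bsub>L\<^esub> z = x \<circ> s i \<circ> s j \<circ> s i"
        unfolding h(7,8) by (rule join_eq[OF hexagon_join_meet(1)[OF h(1) True h(5,6)] W])
      also have "\<dots> = x \<circ> s j \<circ> s i \<circ> s j" using s_braid[OF True] by (simp only: comp_assoc)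
      finally have j: "y \<squnion>\<^bsub>L\<^esub> z = x \<circ> s j \<circ> s i \<circ> s j" .
      show ?thesis unfolding j unfolding h(8)
        using hexagonC(1,2)[OF h(1) True h(5,6), of e0] xy' by (meson r_into_rtrancl rtrancl_trans)
    qed
  qed (rule Ccov)
  have meet_closed: "join_forcing_closed (inv_gorder L) ((C e0)\<inverse>)" for e0
    unfolding join_forcing_closed_def covers_dual join_dual
  proof (intro conjI allI impI)
    fix t y z assume ty: "(t, y) \<in> (C e0)\<inverse>" and tz: "covers L t z" and "z \<noteq> y"
    then have "y \<noteq> z" and yt: "(y, t) \<in> C e0" by simp_all
    obtain i j where h: "t \<in> W" "i \<in> V" "j \<in> V" "i \<noteq> j" "- t (\<alpha> i) \<in> pos" "- t (\<alpha> j) \<in> pos"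
      "y = t \<circ> s i" "z = t \<circ> s j" using covered_twoE[OF Ccov[OF yt] tz \<open>y \<noteq> z\<close>] .
    have W: "y \<in> W" "z \<in> W" unfolding h(7,8) by (intro W_comp s_W h)+
    have "(y \<sqinter>\<^bsub>L\<^esub> z, z) \<in> (C e0)\<^sup>*"
      using h(1-6)
    proof (cases rule: rank2_bottom)
      case (square w)
      have y: "y = w \<circ> s j" and z: "z = w \<circ> s i" unfolding h(7,8) by (rule square)+
      have g: "greatest L w (Lower L {y, z})" unfolding y z
        using square_join_meet(2)[OF square(2) h(2-4) square(1,3,4)] by (simp only: insert_commute)
      have t: "t = w \<circ> s j \<circ> s i" unfolding square(5) by (simp only: comp_assoc s_commute[OF square(1) h(4)])
      show ?thesis unfolding meet_eq[OF g W]
        using squareC[OF square(2) h(2-4) square(1,3,4), of e0] yt unfolding y z t by (metis r_into_rtrancl)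
    next
      case (hexagon w)
      have y: "y = w \<circ> s i \<circ> s j" and z: "z = w \<circ> s j \<circ> s i" unfolding h(7,8) by (rule hexagon)+
      have g: "greatest L w (Lower L {y, z})" unfolding y z
        by (rule hexagon_join_meet(2)[OF hexagon(2,1,3,4)])
      have e: "{j, i} \<in> E" using hexagon(1) by (simp add: insert_commute)
      have "(w, w \<circ> s j) \<in> C e0"
        using hexagonC(1)[OF hexagon(2) e hexagon(4,3), of e0] yt unfolding y hexagon(5) by metis
      then show ?thesis unfolding meet_eq[OF g W] unfolding z
        using hexagonC(3)[OF hexagon(2) e hexagon(4,3), of e0] by (meson r_into_rtrancl rtrancl_trans)
    qed
    then show "(z, y \<sqinter>\<^bsub>L\<^esub> z) \<in> ((C e0)\<inverse>)\<^sup>*" by (simp add: rtrancl_converse)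
  qed (use Ccov in simp)
  have "\<exists>\<theta>. lattice_congruence L \<theta> \<and> (\<forall>x y. covers L y x \<longrightarrow> (x, y) \<in> \<theta> \<longleftrightarrow> (x, y) \<in> C e0)" for e0
  proof (rule forcing_closed_edges_congruence[where up = "\<lambda>x. card pos - card (inversions x)" and down = "\<lambda>x. card (inversions x)"])
    fix x y assume xy: "x \<in> carrier L" "y \<in> carrier L" "x \<sqsubseteq>\<^bsub>L\<^esub> y" "x \<noteq> y"
    then have W: "x \<in> W" "y \<in> W" by simp_all
    show "card (inversions x) < card (inversions y)" by (rule card_inversions_mono[OF W xy(3,4)])
    then show "card pos - card (inversions y) < card pos - card (inversions x)"
      using card_inversions_le[of y] by (simp add: diff_less_mono2)
    show "\<exists>z. covers L z x \<and> z \<sqsubseteq>\<^bsub>L\<^esub> y"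
      using ascent_le[OF W xy(3,4)] covers_ascent[OF W(1)] by metis
    obtain i where i: "i \<in> V" "(y \<circ> s i) (\<alpha> i) \<in> pos" "x \<sqsubseteq>\<^bsub>L\<^esub> y \<circ> s i"
      using descent_le[OF W xy(3,4)] by metis
    have "covers L y (y \<circ> s i)"
      using covers_ascent[OF W_comp[OF W(2) s_W[OF i(1)]] i(1,2)] unfolding comp_s_s .
    then show "\<exists>z. covers L y z \<and> x \<sqsubseteq>\<^bsub>L\<^esub> z" using i(3) by metis
  qed (rule join_closed meet_closed)+
  then obtain \<theta> where \<theta>: "\<And>e0. lattice_congruence L (\<theta> e0)"
    "\<And>e0 x y. covers L y x \<Longrightarrow> (x, y) \<in> \<theta> e0 \<longleftrightarrow> (x, y) \<in> C e0" by metis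
  \<comment> \<open>The congruence of each arrow contracts the other, so neither root is higher.\<close>
  have key: "(x', y') \<in> C (x, y)" if c: "covers L y x" "covers L y' x'" "con L y x = con L y' x'" for x y x' y'
  proof -
    have \<theta>sym: "(b, a) \<in> \<theta> e \<longleftrightarrow> (a, b) \<in> \<theta> e" for a b e
      using \<theta>(1)[of e] by (meson equivE lattice_congruence_def symE)
    have "(x, y) \<in> C (x, y)" using c(1) sim_refl by (simp add: C_def)
    then have "(y, x) \<in> \<theta> (x, y)" using \<theta>(2)[OF c(1)] \<theta>sym by metis
    then have "con L y x \<subseteq> \<theta> (x, y)" using \<theta>(1) unfolding con_def by (intro Inter_lower) simp
    moreover have "(y', x') \<in> con L y' x'" unfolding con_def by simp
    ultimately have "(y', x') \<in> \<theta> (x, y)" using c(3) by (simp add: subset_iff)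
    then show ?thesis using \<theta>(2)[OF c(2)] \<theta>sym by metis
  qed
  show ?thesis
    using key[OF cov con] key[OF cov(2,1) con[symmetric]] by (auto simp: C_def)
qed

end

section \<open>Positivity of the forms of types A, D and E\<close>

text \<open>The Tits form in terms of unordered edges, which can be transported along the numbering of the
vertices.\<close>

definition edge_form :: "nat set \<Rightarrow> nat set set \<Rightarrow> (nat \<Rightarrow> int) \<Rightarrow> int" where
  "edge_form V E y = (\<Sum>i\<in>V. y i * y i) - (\<Sum>e\<in>E. \<Prod>i\<in>e. y i)"

lemma (in oriented_graph) tits_form_transport:
  assumes f: "bij_betw f V' V" and E: "E = (\<lambda>e. f ` e) ` E'" and E': "\<And>e. e \<in> E' \<Longrightarrow> e \<subseteq> V'"
  shows "tits_form V Q x = edge_form V' E' (x \<circ> f)"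
proof -
  have inj: "inj_on f V'" and im: "f ` V' = V" using f by (simp_all add: bij_betw_def)
  have 1: "(\<Sum>i\<in>V. x i * x i) = (\<Sum>i\<in>V'. x (f i) * x (f i))"
    unfolding im[symmetric] by (simp add: sum.reindex[OF inj])
  have bij: "bij_betw (\<lambda>(i, j). {i, j}) Q E" using oriented by (simp add: orientation_def)
  have "(\<Sum>(i, j)\<in>Q. x i * x j) = (\<Sum>p\<in>Q. \<Prod>i\<in>(\<lambda>(i, j). {i, j}) p. x i)"
  proof (rule sum.cong)
    fix p assume "p \<in> Q"
    then obtain i j where "p = (i, j)" "i \<noteq> j" using Q_irrefl by (cases p) metis
    then show "(case p of (i, j) \<Rightarrow> x i * x j) = (\<Prod>i\<in>(\<lambda>(i, j). {i, j}) p. x i)" by simp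
  qed simp
  also have "\<dots> = (\<Sum>e\<in>E. \<Prod>i\<in>e. x i)" by (rule sum.reindex_bij_betw[OF bij])
  also have "\<dots> = (\<Sum>e\<in>E'. \<Prod>i\<in>f ` e. x i)"
  proof -
    have "inj_on (\<lambda>e. f ` e) E'"
      using inj E' by (meson inj_on_image inj_on_def inj_on_image_eq_iff)
    then show ?thesis unfolding E by (simp add: sum.reindex)
  qed
  also have "\<dots> = (\<Sum>e\<in>E'. \<Prod>i\<in>e. x (f i))"
  proof (rule sum.cong)
    fix e assume "e \<in> E'"
    then have "inj_on f e" using inj E' inj_on_subset by blast
    then show "(\<Prod>i\<in>f ` e. x i) = (\<Prod>i\<in>e. x (f i))" by (simp add: prod.reindex)
  qed simp
  finally show ?thesis unfolding tits_form_def edge_form_def 1 by simp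
qed

lemma sum_chain_edges:
  "(\<Sum>e\<in>{{i, i + 1} |i::nat. a \<le> i \<and> i < m}. \<Prod>i\<in>e. y i) = (\<Sum>i\<in>{a..<m}. y i * (y (i + 1) :: int))"
proof -
  have eq: "{{i, i + 1} |i. a \<le> i \<and> i < m} = (\<lambda>i. {i, i + 1}) ` {a..<m}" by auto
  have "inj_on (\<lambda>i::nat. {i, i + 1}) {a..<m}" by (auto simp: inj_on_def doubleton_eq_iff)
  then show ?thesis unfolding eq by (simp add: sum.reindex)
qed

lemma chain_squares:
  assumes "m \<ge> 1"
  shows "2 * (\<Sum>i\<in>{1..m}. y i * y i) - 2 * (\<Sum>i\<in>{1..<m}. y i * y (i + 1))
    = y 1 * y 1 + y m * y m + (\<Sum>i\<in>{1..<m}. (y i - y (i + 1)) * (y i - y (i + 1 :: nat) :: int))"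
  using assms
proof (induction m rule: dec_induct)
  case base
  then show ?case by simp
next
  case (step m)
  then have "{1..Suc m} = insert (Suc m) {1..m}" "{1..<Suc m} = insert m {1..<m}" by auto
  then show ?case using step.IH by (simp add: algebra_simps)
qed

text \<open>Bounds propagate along an edge: \<open>(au)\<^sup>2 \<le> 2(au - bv)\<^sup>2 + 2(bv)\<^sup>2\<close>.\<close>

lemma square_step:
  fixes u v :: int
  assumes "(a * u - b * v) * (a * u - b * v) \<le> S" "v * v \<le> N * S" "a \<noteq> 0"
  shows "u * u \<le> (2 + 2 * (b * b) * N) * S"
proof -
  have "1 \<le> a * a" using assms(3) by (metis int_one_le_iff_zero_less zero_less_mult_iff linorder_neqE_linordered_idom)
  then have "u * u \<le> a * a * (u * u)" by (simp add: mult_le_cancel_right1)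
  also have "\<dots> \<le> 2 * ((a * u - b * v) * (a * u - b * v)) + 2 * (b * b) * (v * v)"
    using zero_le_square[of "a * u - 2 * (b * v)"] by (simp add: algebra_simps)
  also have "\<dots> \<le> 2 * S + 2 * (b * b) * (N * S)"
    using assms(1,2) by (intro add_mono mult_left_mono) auto
  finally show ?thesis by (simp add: algebra_simps)
qed

lemma chain_bound:
  fixes k :: nat
  shows "k \<ge> 1 \<Longrightarrow> \<exists>N. \<forall>y S. y 1 * y 1 + (\<Sum>i\<in>{1..<k}. (y i - y (i + 1)) * (y i - y (i + 1))) \<le> S \<longrightarrow> y k * y k \<le> N * (S::int)"
proof (induction k rule: dec_induct)
  case base
  show ?case by (intro exI[of _ 1]) auto
next
  case (step k)
  then obtain N where N: "\<And>y S. y 1 * y 1 + (\<Sum>i\<in>{1..<k}. (y i - y (i + 1)) * (y i - y (i + 1))) \<le> S \<Longrightarrow> y k * y k \<le> N * (S::int)" by auto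
  show ?case
  proof (intro exI[of _ "2 + 2 * N"] allI impI)
    fix y :: "nat \<Rightarrow> int" and S :: int
    assume h: "y 1 * y 1 + (\<Sum>i\<in>{1..<Suc k}. (y i - y (i + 1)) * (y i - y (i + 1))) \<le> S"
    have "{1..<Suc k} = insert k {1..<k}" using step by auto
    then have h': "y 1 * y 1 + ((y k - y (Suc k)) * (y k - y (Suc k)) + (\<Sum>i\<in>{1..<k}. (y i - y (i + 1)) * (y i - y (i + 1)))) \<le> S"
      using h by simp
    have "0 \<le> (\<Sum>i\<in>{1..<k}. (y i - y (i + 1)) * (y i - y (i + 1)))" by (intro sum_nonneg) simp
    then have "(y k - y (Suc k)) * (y k - y (Suc k)) \<le> S" "y 1 * y 1 + (\<Sum>i\<in>{1..<k}. (y i - y (i + 1)) * (y i - y (i + 1))) \<le> S"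
      using h' zero_le_square[of "y 1"] zero_le_square[of "y k - y (Suc k)"] by linarith+
    then show "y (Suc k) * y (Suc k) \<le> (2 + 2 * N) * S"
      using square_step[of 1 "y (Suc k)" 1 "y k" S N] N[of y S] by (simp add: algebra_simps)
  qed
qed

definition form_coercive :: "dynkin_type \<Rightarrow> bool" where
  "form_coercive t \<longleftrightarrow> (\<forall>k\<in>type_verts t. \<exists>N. \<forall>y. y k * y k \<le> N * edge_form (type_verts t) (type_edges t) y)"

lemma coercive_A: "n \<ge> 1 \<Longrightarrow> form_coercive (TypeA n)"
  unfolding form_coercive_def
proof
  fix k assume n: "n \<ge> 1" and "k \<in> type_verts (TypeA n)"
  then have k: "1 \<le> k" "k \<le> n" by auto
  obtain N where N: "\<And>y S. y 1 * y 1 + (\<Sum>i\<in>{1..<k}. (y i - y (i + 1)) * (y i - y (i + 1))) \<le> S \<Longrightarrow> y k * y k \<le> N * (S::int)"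
    using chain_bound[OF k(1)] by auto
  show "\<exists>N. \<forall>y. y k * y k \<le> N * edge_form (type_verts (TypeA n)) (type_edges (TypeA n)) y"
  proof (intro exI[of _ "2 * N"] allI)
    fix y
    have "2 * edge_form (type_verts (TypeA n)) (type_edges (TypeA n)) y
      = y 1 * y 1 + y n * y n + (\<Sum>i\<in>{1..<n}. (y i - y (i + 1)) * (y i - y (i + 1)))"
      using chain_squares[OF n, of y] sum_chain_edges[where a = 1 and m = n and y = y] by (simp add: edge_form_def)
    moreover have "(\<Sum>i\<in>{1..<k}. (y i - y (i + 1)) * (y i - y (i + 1))) \<le> (\<Sum>i\<in>{1..<n}. (y i - y (i + 1)) * (y i - y (i + 1)))"
      using k by (intro sum_mono2) auto
    ultimately show "y k * y k \<le> 2 * N * edge_form (type_verts (TypeA n)) (type_edges (TypeA n)) y"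
      using N[of y "2 * edge_form (type_verts (TypeA n)) (type_edges (TypeA n)) y"] zero_le_square[of "y n"]
      by (simp add: algebra_simps)
  qed
qed

text \<open>Twice the form is the sum of the squares of the coordinates when the roots are realised as
\<open>\<plusminus>\<epsilon>\<^sub>i \<plusminus> \<epsilon>\<^sub>j\<close>.\<close>

lemma coercive_D: "n \<ge> 4 \<Longrightarrow> form_coercive (TypeD n)"
  unfolding form_coercive_def
proof
  fix k assume "n \<ge> 4" and k: "k \<in> type_verts (TypeD n)"
  define m where "m = n - 2"
  have n: "n = Suc (Suc m)" "m \<ge> 2" using \<open>n \<ge> 4\<close> by (auto simp: m_def)
  let ?q = "\<lambda>y. edge_form (type_verts (TypeD n)) (type_edges (TypeD n)) y"
  have q: "2 * ?q y = y 1 * y 1 + (\<Sum>i\<in>{1..<m}. (y i - y (i + 1)) * (y i - y (i + 1)))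
     + (y (Suc m) + y n - y m) * (y (Suc m) + y n - y m) + (y (Suc m) - y n) * (y (Suc m) - y n)" for y
  proof -
    have E: "type_edges (TypeD n) = {{i, i + 1} |i. 1 \<le> i \<and> i < Suc m} \<union> {{m, n}}" by (simp add: n)
    have "{m, n} \<notin> {{i, i + 1} |i. 1 \<le> i \<and> i < Suc m}" by (auto simp: n doubleton_eq_iff)
    moreover have "finite {{i, i + 1} |i. 1 \<le> i \<and> i < Suc m}" by simp
    ultimately have "(\<Sum>e\<in>type_edges (TypeD n). \<Prod>i\<in>e. y i) = (\<Sum>i\<in>{1..<Suc m}. y i * y (i + 1)) + y m * y n"
      unfolding E using sum_chain_edges[where a = 1 and m = "Suc m" and y = y] by (simp add: n)
    moreover have "(\<Sum>i\<in>type_verts (TypeD n). y i * y i) = (\<Sum>i\<in>{1..Suc m}. y i * y i) + y n * y n"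
      by (simp add: n)
    moreover have "{1..<Suc m} = insert m {1..<m}" using n by auto
    ultimately show ?thesis
      using chain_squares[of "Suc m" y] n(2) unfolding edge_form_def by (simp add: algebra_simps)
  qed
  have nn: "0 \<le> (\<Sum>i\<in>{1..<m}. (y i - y (i + 1)) * (y i - y (i + 1)))" for y :: "nat \<Rightarrow> int" by (intro sum_nonneg) simp
  have low: "\<exists>N. \<forall>y. y k * y k \<le> N * ?q y" if km: "1 \<le> k" "k \<le> m" for k
  proof -
    obtain N where N: "\<And>y S. y 1 * y 1 + (\<Sum>i\<in>{1..<k}. (y i - y (i + 1)) * (y i - y (i + 1))) \<le> S \<Longrightarrow> y k * y k \<le> N * (S::int)"
      using chain_bound[OF km(1)] by auto
    show ?thesis
    proof (intro exI[of _ "2 * N"] allI)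
      fix y :: "nat \<Rightarrow> int"
      have "(\<Sum>i\<in>{1..<k}. (y i - y (i + 1)) * (y i - y (i + 1))) \<le> (\<Sum>i\<in>{1..<m}. (y i - y (i + 1)) * (y i - y (i + 1)))"
        using that by (intro sum_mono2) auto
      then show "y k * y k \<le> 2 * N * ?q y"
        using N[of y "2 * ?q y"] q[of y] zero_le_square[of "y (Suc m) + y n - y m"] zero_le_square[of "y (Suc m) - y n"]
        by (simp add: algebra_simps)
    qed
  qed
  have sq3: "x * x \<le> 3 * (a * a + b * b + c * c)" if "2 * x = a + b + c" for x a b c :: int
  proof -
    have "x * x \<le> (2 * x) * (2 * x)" using zero_le_square[of x] by simp
    also have "\<dots> = (a + b + c) * (a + b + c)" by (simp only: that)
    also have "\<dots> \<le> 3 * (a * a + b * b + c * c)"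
      using zero_le_square[of "a - b"] zero_le_square[of "a - c"] zero_le_square[of "b - c"] by (simp add: algebra_simps)
    finally show ?thesis .
  qed
  obtain N where N: "\<And>y. y m * y m \<le> N * ?q y" using low[of m] n by auto
  show "\<exists>N. \<forall>y. y k * y k \<le> N * ?q y"
  proof (cases "k \<le> m")
    case True
    then show ?thesis using low[of k] k by simp
  next
    case False
    then have "k = Suc m \<or> k = n" using k n by auto
    then have "y k * y k \<le> (12 + 3 * N) * ?q y" for y
    proof -
      let ?a = "y (Suc m) + y n - y m" and ?b = "y (Suc m) - y n"
      have "?a * ?a \<le> 2 * ?q y" "?b * ?b \<le> 2 * ?q y"
        using q[of y] nn[of y] zero_le_square[of ?a] zero_le_square[of ?b] zero_le_square[of "y 1"] by linarith+
      then have b: "3 * (?a * ?a + ?b * ?b + y m * y m) \<le> (12 + 3 * N) * ?q y"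
        using N[of y] by (simp add: algebra_simps)
      have "y k * y k \<le> 3 * (?a * ?a + ?b * ?b + y m * y m)"
        using \<open>k = Suc m \<or> k = n\<close> sq3[of "y (Suc m)" ?a ?b "y m"] sq3[of "y n" ?a "- ?b" "y m"] by (elim disjE) (simp_all add: algebra_simps)
      then show ?thesis using b by linarith
    qed
    then show ?thesis by blast
  qed
qed

definition E8_form :: "int \<Rightarrow> int \<Rightarrow> int \<Rightarrow> int \<Rightarrow> int \<Rightarrow> int \<Rightarrow> int \<Rightarrow> int \<Rightarrow> int" where
  "E8_form a b c d e f g h = a*a + b*b + c*c + d*d + e*e + f*f + g*g + h*h
     - a*c - b*d - c*d - d*e - e*f - f*g - g*h"

text \<open>Completing squares along the three arms, from the leaves towards the branching vertex with coordinate
\<open>d\<close>, leaves a remainder of \<open>d\<^sup>2/60\<close>. Thus \<open>d\<close> is bounded, and the bounds spread outwards along the arms.\<close>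

lemma E8_form_bound:
  "\<exists>N. \<forall>a b c d e f g h. \<forall>x\<in>{a, b, c, d, e, f, g, h}. x * x \<le> N * E8_form a b c d e f g h"
proof -
  have sum: "120 * E8_form a b c d e f g h = 30 * ((2*b - 1*d)*(2*b - 1*d)) + 30 * ((2*a - 1*c)*(2*a - 1*c))
    + 10 * ((3*c - 2*d)*(3*c - 2*d)) + 30 * ((2*h - 1*g)*(2*h - 1*g)) + 10 * ((3*g - 2*f)*(3*g - 2*f))
    + 5 * ((4*f - 3*e)*(4*f - 3*e)) + 3 * ((5*e - 4*d)*(5*e - 4*d)) + 2 * (d * d)" for a b c d e f g h
    by (simp add: E8_form_def algebra_simps)
  define N1 N2 N3 N4 N5 N6 :: int where "N1 = 2 + 2 * (4 * 4) * 1" and "N2 = 2 + 2 * (3 * 3) * N1"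
    and "N3 = 2 + 2 * (2 * 2) * N2" and "N4 = 2 + 2 * (1 * 1) * N3"
    and "N5 = 2 + 2 * (2 * 2) * 1" and "N6 = 2 + 2 * (1 * 1) * N5"
  have N: "N1 \<le> N4" "N2 \<le> N4" "N3 \<le> N4" "N5 \<le> N4" "N6 \<le> N4" "1 \<le> N4"
    by (simp_all add: N1_def N2_def N3_def N4_def N5_def N6_def)
  have "x * x \<le> (N4 * 120) * E8_form a b c d e f g h" if x: "x \<in> {a, b, c, d, e, f, g, h}" for a b c d e f g h x
  proof -
    define S where "S = 120 * E8_form a b c d e f g h"
    note sq = zero_le_square[of "2*b - 1*d"] zero_le_square[of "2*a - 1*c"] zero_le_square[of "3*c - 2*d"]
      zero_le_square[of "2*h - 1*g"] zero_le_square[of "3*g - 2*f"] zero_le_square[of "4*f - 3*e"]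
      zero_le_square[of "5*e - 4*d"] zero_le_square[of d]
    note S = sum[of a b c d e f g h, folded S_def]
    have le: "(2*b - 1*d)*(2*b - 1*d) \<le> S" "(2*a - 1*c)*(2*a - 1*c) \<le> S" "(3*c - 2*d)*(3*c - 2*d) \<le> S"
      "(2*h - 1*g)*(2*h - 1*g) \<le> S" "(3*g - 2*f)*(3*g - 2*f) \<le> S" "(4*f - 3*e)*(4*f - 3*e) \<le> S"
      "(5*e - 4*d)*(5*e - 4*d) \<le> S" "d * d \<le> 1 * S"
      using sq S by linarith+
    have e: "e * e \<le> N1 * S" unfolding N1_def by (rule square_step[OF le(7,8)]) simp
    have f: "f * f \<le> N2 * S" unfolding N2_def by (rule square_step[OF le(6) e]) simp
    have g: "g * g \<le> N3 * S" unfolding N3_def by (rule square_step[OF le(5) f]) simp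
    have h: "h * h \<le> N4 * S" unfolding N4_def by (rule square_step[OF le(4) g]) simp
    have c: "c * c \<le> N5 * S" unfolding N5_def by (rule square_step[OF le(3,8)]) simp
    have a: "a * a \<le> N6 * S" unfolding N6_def by (rule square_step[OF le(2) c]) simp
    have b: "b * b \<le> 4 * S" using square_step[OF le(1,8)] by simp
    have "0 \<le> S" using le(8) zero_le_square[of d] by linarith
    then have mono: "K * S \<le> N4 * S" if "K \<le> N4" for K using that by (rule mult_right_mono[rotated])
    have "4 \<le> N4" by (simp add: N1_def N2_def N3_def N4_def)
    have "a * a \<le> N4 * S" "b * b \<le> N4 * S" "c * c \<le> N4 * S" "d * d \<le> N4 * S"
      "e * e \<le> N4 * S" "f * f \<le> N4 * S" "g * g \<le> N4 * S"
      using a b c le(8) e f g mono[OF N(1)] mono[OF N(2)] mono[OF N(3)] mono[OF N(4)] mono[OF N(5)] mono[OF N(6)] mono[OF \<open>4 \<le> N4\<close>]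
      by linarith+
    then have "x * x \<le> N4 * S" using x h by (elim insertE emptyE) (simp_all only:)
    then show ?thesis by (simp add: S_def)
  qed
  then show ?thesis by blast
qed

text \<open>The forms of \<open>E\<^sub>6\<close> and \<open>E\<^sub>7\<close> are restrictions of that of \<open>E\<^sub>8\<close> to vectors with vanishing last coordinates.\<close>

lemma coercive_E:
  assumes n: "n \<in> {6, 7, 8}" shows "form_coercive (TypeE n)"
proof -
  define z where "z y k = (if k \<in> {1..n} then y k else 0)" for y :: "nat \<Rightarrow> int" and k
  have E: "(\<Sum>e\<in>type_edges (TypeE n). \<Prod>i\<in>e. y i) = y 1 * y 3 + y 2 * y 4 + (\<Sum>i\<in>{3..<n}. y i * y (i + 1))" for y :: "nat \<Rightarrow> int"
  proof -
    have "{1, 3} \<notin> {{i, i + 1} |i::nat. 3 \<le> i \<and> i < n}" "{2, 4} \<notin> {{i, i + 1} |i::nat. 3 \<le> i \<and> i < n}"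
      by (auto simp: doubleton_eq_iff)
    moreover have "{1, 3} \<noteq> {2, 4::nat}" by (auto simp: doubleton_eq_iff)
    moreover have "finite {{i, i + 1} |i::nat. 3 \<le> i \<and> i < n}" by simp
    ultimately show ?thesis using sum_chain_edges[where a = 3 and m = n and y = y] by simp
  qed
  have form: "edge_form (type_verts (TypeE n)) (type_edges (TypeE n)) y
     = E8_form (z y 1) (z y 2) (z y 3) (z y 4) (z y 5) (z y 6) (z y 7) (z y 8)" for y
  proof -
    have sets: "{3..<8::nat} = {3,4,5,6,7}" "{3..<7::nat} = {3,4,5,6}" "{3..<6::nat} = {3,4,5}"
      "{1..8::nat} = {1,2,3,4,5,6,7,8}" "{1..7::nat} = {1,2,3,4,5,6,7}" "{1..6::nat} = {1,2,3,4,5,6}" by auto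
    show ?thesis
      using n unfolding edge_form_def E type_verts.simps
      by (elim insertE emptyE) (simp_all only: sets, simp_all add: z_def E8_form_def)
  qed
  obtain N where N: "\<And>a b c d e f g h x. x \<in> {a, b, c, d, e, f, g, h} \<Longrightarrow> x * x \<le> N * E8_form a b c d e f g h"
    using E8_form_bound by blast
  show ?thesis
    unfolding form_coercive_def
  proof (intro ballI exI[of _ N] allI)
    fix k y assume "k \<in> type_verts (TypeE n)"
    then have k: "z y k = y k" "k \<in> {1..8}" using n by (auto simp: z_def)
    have "z y k \<in> {z y 1, z y 2, z y 3, z y 4, z y 5, z y 6, z y 7, z y 8}"
    proof -
      have "{1..8::nat} = {1,2,3,4,5,6,7,8}" by auto
      then show ?thesis using k(2) by (auto simp only: insert_iff empty_iff)
    qed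
    then show "y k * y k \<le> N * edge_form (type_verts (TypeE n)) (type_edges (TypeE n)) y"
      unfolding form using N k(1) by metis
  qed
qed

lemma type_edges_subset:
  "valid_type t \<Longrightarrow> e \<in> type_edges t \<Longrightarrow> \<exists>i\<in>type_verts t. \<exists>j\<in>type_verts t. i \<noteq> j \<and> e = {i, j}"
proof (cases t)
  case (TypeA n)
  assume "valid_type t" "e \<in> type_edges t"
  then obtain i where "e = {i, i + 1}" "1 \<le> i" "i < n" using TypeA by auto
  then show ?thesis using TypeA by (intro bexI[of _ i] bexI[of _ "i + 1"]) auto
next
  case (TypeD n)
  assume v: "valid_type t" "e \<in> type_edges t"
  then consider i where "e = {i, i + 1}" "1 \<le> i" "i < n - 1" | "e = {n - 2, n}" using TypeD by auto
  then show ?thesis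
  proof cases
    case (1 i)
    then show ?thesis using TypeD by (intro bexI[of _ i] bexI[of _ "i + 1"]) auto
  next
    case 2
    then show ?thesis using TypeD v by (intro bexI[of _ "n - 2"] bexI[of _ n]) auto
  qed
next
  case (TypeE n)
  assume v: "valid_type t" "e \<in> type_edges t"
  then consider i where "e = {i, i + 1}" "3 \<le> i" "i < n" | "e = {1, 3}" | "e = {2, 4}" using TypeE by auto
  then show ?thesis
  proof cases
    case (1 i)
    then show ?thesis using TypeE by (intro bexI[of _ i] bexI[of _ "i + 1"]) auto
  next
    case 2
    then show ?thesis using TypeE v by (intro bexI[of _ 1] bexI[of _ 3]) auto
  next
    case 3
    then show ?thesis using TypeE v by (intro bexI[of _ 2] bexI[of _ 4]) auto
  qed
qed

theorem dynkin_definite_graph: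
  assumes "simply_laced_dynkin V E" "orientation E Q"
  shows "definite_graph V E Q"
proof -
  obtain t f where t: "valid_type t" and f: "bij_betw f (type_verts t) V" and E: "E = (\<lambda>e. f ` e) ` type_edges t"
    using assms(1) unfolding simply_laced_dynkin_def by blast
  have inj: "inj_on f (type_verts t)" and im: "f ` type_verts t = V" using f by (simp_all add: bij_betw_def)
  have fin: "finite (type_verts t)" by (cases t) auto
  interpret oriented_graph V E Q
  proof
    show "finite V" using fin im by auto
    show "orientation E Q" by (rule assms(2))
    fix e assume "e \<in> E"
    then obtain e' where e': "e' \<in> type_edges t" "e = f ` e'" using E by blast
    obtain i j where ij: "i \<in> type_verts t" "j \<in> type_verts t" "i \<noteq> j" "e' = {i, j}"
      using type_edges_subset[OF t e'(1)] by blast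
    then have "f i \<noteq> f j" using inj by (auto dest: inj_onD)
    then show "\<exists>i\<in>V. \<exists>j\<in>V. i \<noteq> j \<and> e = {i, j}" using ij e' im by (intro bexI[of _ "f i"] bexI[of _ "f j"]) auto
  qed
  show ?thesis
  proof
    fix i assume "i \<in> V"
    then obtain k where k: "k \<in> type_verts t" "i = f k" using im by blast
    have "form_coercive t" using t coercive_A coercive_D coercive_E by (cases t) auto
    then obtain N where N: "\<And>y. y k * y k \<le> N * edge_form (type_verts t) (type_edges t) y"
      using k(1) unfolding form_coercive_def by blast
    have "e \<subseteq> type_verts t" if "e \<in> type_edges t" for e using type_edges_subset[OF t that] by auto
    then have "tits_form V Q x = edge_form (type_verts t) (type_edges t) (x \<circ> f)" for x
      using tits_form_transport[OF f E] by blast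
    then show "\<exists>N. \<forall>x. x i * x i \<le> N * tits_form V Q x" using N[of "_ \<circ> f"] k(2) by (intro exI[of _ N]) simp
  qed
qed

section \<open>Products with vertex ideals, computed at the vertices\<close>

text \<open>The group is the path algebra with its pointwise addition. The operator \<open>e i\<close> is right
multiplication by the idempotent at \<open>i\<close>, and \<open>a k i\<close> is right multiplication by the arrow from \<open>k\<close>
to \<open>i\<close>. \<open>F\<close> is the set of elements of the path algebra, and \<open>J\<close> the ideal generated by the
preprojective relation, whose part at \<open>i\<close> is the last assumption. Working with preimages modulo \<open>J\<close>
instead of cosets keeps the elements in an additive group type.\<close>

locale preprojective_action =
  fixes nb :: "'v \<Rightarrow> 'v set"
    and e :: "'v \<Rightarrow> 'g::ab_group_add \<Rightarrow> 'g"
    and a :: "'v \<Rightarrow> 'v \<Rightarrow> 'g \<Rightarrow> 'g"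
    and positive :: "'v \<Rightarrow> 'v \<Rightarrow> bool"
    and J F :: "'g set"
  assumes finite_nb: "finite (nb i)" and nb_irrefl: "i \<notin> nb i" and nb_sym: "j \<in> nb i \<Longrightarrow> i \<in> nb j"
    and e_add: "e i (x + y) = e i x + e i y" and a_add: "a k i (x + y) = a k i x + a k i y"
    and e_idem: "e i (e i x) = e i x" and e_orth: "i \<noteq> j \<Longrightarrow> e i (e j x) = 0"
    and a_e: "a k i (e k x) = a k i x" and e_a: "e i (a k i x) = a k i x"
    and J_zero: "0 \<in> J" and J_diff: "x \<in> J \<Longrightarrow> y \<in> J \<Longrightarrow> x - y \<in> J"
    and J_e: "x \<in> J \<Longrightarrow> e i x \<in> J"
    and relation: "x \<in> F \<Longrightarrow> (\<Sum>k\<in>nb i. a k i (if positive i k then a i k x else - a i k x)) \<in> J"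
begin

text \<open>The first factor of the summands \<open>\<plusminus>aa\<^sup>*\<close> of the relation, with its sign.\<close>

definition signed_arrow :: "'v \<Rightarrow> 'v \<Rightarrow> 'g \<Rightarrow> 'g" where
  "signed_arrow i k x = (if positive i k then a i k x else - a i k x)"

definition submodule :: "'g set \<Rightarrow> bool" where
  "submodule M \<longleftrightarrow> J \<subseteq> M \<and> M \<subseteq> F \<and> (\<forall>x\<in>M. \<forall>y\<in>M. x - y \<in> M) \<and>
     (\<forall>x\<in>M. \<forall>i. e i x \<in> M) \<and> (\<forall>x\<in>M. \<forall>i. \<forall>k\<in>nb i. a k i x \<in> M)"

lemma additive_e: "additive (e i)" and additive_a: "additive (a k i)"
  by (simp_all add: additive_def e_add a_add)

lemmas e_zero [simp] = additive.zero[OF additive_e] and a_zero [simp] = additive.zero[OF additive_a]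
lemmas e_minus = additive.minus[OF additive_e] additive.diff[OF additive_e]
lemmas a_minus = additive.minus[OF additive_a] additive.diff[OF additive_a]
lemmas e_sum = additive.sum[OF additive_e]

lemma e_a_orth: "j \<noteq> i \<Longrightarrow> e j (a k i x) = 0"
  using e_a[of i k x] e_orth[of j i "a k i x"] by simp

lemma J_neg: "x \<in> J \<Longrightarrow> - x \<in> J" using J_diff[OF J_zero, of x] by simp

lemma J_add: "x \<in> J \<Longrightarrow> y \<in> J \<Longrightarrow> x + y \<in> J" using J_diff[of x "- y"] J_neg by simp

lemma relation_b: "x \<in> F \<Longrightarrow> (\<Sum>k\<in>nb i. a k i (signed_arrow i k x)) \<in> J"
  using relation[of x i] by (simp add: signed_arrow_def)

context
  fixes M assumes M: "submodule M"
begin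

lemma M_J: "x \<in> J \<Longrightarrow> x \<in> M" and M_F: "x \<in> M \<Longrightarrow> x \<in> F"
  and M_diff: "x \<in> M \<Longrightarrow> y \<in> M \<Longrightarrow> x - y \<in> M" and M_e: "x \<in> M \<Longrightarrow> e i x \<in> M"
  and M_a: "x \<in> M \<Longrightarrow> k \<in> nb i \<Longrightarrow> a k i x \<in> M"
  using M by (auto simp: submodule_def)

lemma M_zero: "0 \<in> M" using M_J J_zero by blast

lemma M_neg: "x \<in> M \<Longrightarrow> - x \<in> M" using M_diff[OF M_zero, of x] by simp

lemma M_add: "x \<in> M \<Longrightarrow> y \<in> M \<Longrightarrow> x + y \<in> M" using M_diff[of x "- y"] M_neg by simp

lemma M_cong: "x \<in> M \<Longrightarrow> y - x \<in> J \<Longrightarrow> y \<in> M" using M_add[of x "y - x"] M_J by simp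

lemma M_sum: "(\<And>k. k \<in> S \<Longrightarrow> g k \<in> M) \<Longrightarrow> (\<Sum>k\<in>S. g k) \<in> M"
  by (induction S rule: infinite_finite_induct) (auto intro: M_zero M_add)

lemma M_b: "x \<in> M \<Longrightarrow> k \<in> nb i \<Longrightarrow> signed_arrow i k x \<in> M"
  using M_a[of x i k] M_neg nb_sym by (auto simp: signed_arrow_def)

end

text \<open>Modulo \<open>J\<close>, the sum of the images of \<open>M\<close> under the arrows that lead from \<open>S\<close> to \<open>i\<close>.\<close>

definition arrow_span :: "'g set \<Rightarrow> 'v \<Rightarrow> 'v set \<Rightarrow> 'g set" where
  "arrow_span M i S = {x. \<exists>y. (\<forall>k\<in>S. y k \<in> M) \<and> x - (\<Sum>k\<in>S. a k i (y k)) \<in> J}"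

text \<open>Modulo \<open>J\<close>, the product of \<open>M\<close> with the ideal generated by \<open>1 - e\<^sub>i\<close>: it agrees with \<open>M\<close> at all
vertices other than \<open>i\<close>, and at \<open>i\<close> only paths that come from a neighbour remain.\<close>

definition red :: "'v \<Rightarrow> 'g set \<Rightarrow> 'g set" where
  "red i M = {x \<in> M. e i x \<in> arrow_span M i (nb i)}"

lemma span_mono: "M \<subseteq> N \<Longrightarrow> arrow_span M i S \<subseteq> arrow_span N i S"
  by (auto simp: arrow_span_def)

lemma span_cong: "x \<in> arrow_span M i S \<Longrightarrow> x' - x \<in> J \<Longrightarrow> x' \<in> arrow_span M i S"
  unfolding arrow_span_def using J_add[of "x' - x"] by fastforce

lemma span_diff:
  assumes M: "submodule M" and x: "x \<in> arrow_span M i S" "x' \<in> arrow_span M i S" shows "x - x' \<in> arrow_span M i S"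
proof -
  obtain y y' where y: "\<forall>k\<in>S. y k \<in> M" "x - (\<Sum>k\<in>S. a k i (y k)) \<in> J" and
    y': "\<forall>k\<in>S. y' k \<in> M" "x' - (\<Sum>k\<in>S. a k i (y' k)) \<in> J" using x by (auto simp: arrow_span_def)
  have "x - x' - (\<Sum>k\<in>S. a k i (y k - y' k)) = (x - (\<Sum>k\<in>S. a k i (y k))) - (x' - (\<Sum>k\<in>S. a k i (y' k)))"
    by (simp add: a_minus sum_subtractf)
  then have "x - x' - (\<Sum>k\<in>S. a k i (y k - y' k)) \<in> J" using J_diff[OF y(2) y'(2)] by (simp only:)
  then show ?thesis
    using y(1) y'(1) M_diff[OF M] unfolding arrow_span_def
    by (intro CollectI exI[of _ "\<lambda>k. y k - y' k"] conjI ballI) simp_all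
qed

lemma span_J: "submodule M \<Longrightarrow> x \<in> J \<Longrightarrow> x \<in> arrow_span M i S"
  unfolding arrow_span_def using M_zero by (auto intro!: exI[of _ "\<lambda>_. 0"])

lemma span_add:
  assumes M: "submodule M" and x: "x \<in> arrow_span M i S" "x' \<in> arrow_span M i S" shows "x + x' \<in> arrow_span M i S"
  using span_diff[OF M x(1) span_diff[OF M span_J[OF M J_zero] x(2)]] by simp

lemma span_neg: "submodule M \<Longrightarrow> x \<in> arrow_span M i S \<Longrightarrow> - x \<in> arrow_span M i S"
  using span_diff[OF _ span_J[OF _ J_zero], of M x i S] by simp

lemma span_mem:
  assumes M: "submodule M" and "S \<subseteq> nb i" "x \<in> arrow_span M i S" shows "x \<in> M"
proof -
  obtain y where y: "\<forall>k\<in>S. y k \<in> M" "x - (\<Sum>k\<in>S. a k i (y k)) \<in> J" using assms by (auto simp: arrow_span_def)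
  have "(\<Sum>k\<in>S. a k i (y k)) \<in> M" using assms(2) y M_a[OF M] by (intro M_sum[OF M]) auto
  then show ?thesis using M_cong[OF M _ y(2)] by blast
qed

lemma span_e: 
  assumes "x \<in> arrow_span M i S" shows "e i x - x \<in> J"
proof -
  obtain y where y: "x - (\<Sum>k\<in>S. a k i (y k)) \<in> J" using assms by (auto simp: arrow_span_def)
  have "e i x - x = e i (x - (\<Sum>k\<in>S. a k i (y k))) - (x - (\<Sum>k\<in>S. a k i (y k)))"
    by (simp add: e_minus e_sum e_a)
  then show ?thesis using J_diff[OF J_e[OF y] y] by (simp only:)
qed

lemma span_e_other:
  assumes "x \<in> arrow_span M i S" "j \<noteq> i" shows "e j x \<in> J"
proof -
  have "e j x = e j (x - e i x)" using e_orth[OF assms(2)] by (simp add: e_minus)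
  then show ?thesis using J_e[OF J_neg[OF span_e[OF assms(1)]], of j] by simp
qed

lemma span_split:
  assumes S: "finite S" "j \<in> S"
  shows "x \<in> arrow_span M i S \<longleftrightarrow> (\<exists>m\<in>M. x - a j i m \<in> arrow_span M i (S - {j}))"
proof
  assume "x \<in> arrow_span M i S"
  then obtain y where y: "\<forall>k\<in>S. y k \<in> M" "x - (\<Sum>k\<in>S. a k i (y k)) \<in> J" by (auto simp: arrow_span_def)
  have "(\<Sum>k\<in>S. a k i (y k)) = a j i (y j) + (\<Sum>k\<in>S - {j}. a k i (y k))" by (rule sum.remove[OF S])
  then have "x - a j i (y j) - (\<Sum>k\<in>S - {j}. a k i (y k)) \<in> J" using y(2) by (simp add: diff_diff_eq)
  then show "\<exists>m\<in>M. x - a j i m \<in> arrow_span M i (S - {j})" using y(1) S(2) by (auto simp: arrow_span_def)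
next
  assume "\<exists>m\<in>M. x - a j i m \<in> arrow_span M i (S - {j})"
  then obtain m y where m: "m \<in> M" and y: "\<forall>k\<in>S - {j}. y k \<in> M" "x - a j i m - (\<Sum>k\<in>S - {j}. a k i (y k)) \<in> J"
    by (auto simp: arrow_span_def)
  let ?y = "y(j := m)"
  have "(\<Sum>k\<in>S. a k i (?y k)) = a j i m + (\<Sum>k\<in>S - {j}. a k i (y k))"
    by (simp add: sum.remove[OF S])
  then have "x - (\<Sum>k\<in>S. a k i (?y k)) \<in> J" using y(2) by (simp add: diff_diff_eq)
  moreover have "\<forall>k\<in>S. ?y k \<in> M" using y(1) m by auto
  ultimately show "x \<in> arrow_span M i S" unfolding arrow_span_def by blast
qed

lemma submodule_red: assumes M: "submodule M" shows "submodule (red i M)"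
  unfolding submodule_def
proof (intro conjI ballI allI)
  show "J \<subseteq> red i M"
  proof
    fix x assume "x \<in> J"
    then show "x \<in> red i M" using M_J[OF M] span_J[OF M J_e] by (simp add: red_def)
  qed
  show "red i M \<subseteq> F"
  proof
    fix x assume "x \<in> red i M"
    then show "x \<in> F" using M_F[OF M] by (simp add: red_def)
  qed
  show "x - y \<in> red i M" if "x \<in> red i M" "y \<in> red i M" for x y
    using that M_diff[OF M, of x y] span_diff[OF M, of "e i x" i "nb i" "e i y"] by (simp add: red_def e_minus)
  show "e j x \<in> red i M" if "x \<in> red i M" for j x
    using that M_e[OF M, of x j] span_J[OF M J_zero, of i "nb i"]
    by (cases "i = j") (simp_all add: red_def e_idem e_orth)
  show "a k j x \<in> red i M" if x: "x \<in> red i M" and k: "k \<in> nb j" for j k x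
  proof (cases "i = j")
    case True
    have "x \<in> M" using x by (simp add: red_def)
    moreover have "a k i x - a k i x \<in> arrow_span M i (nb i - {k})" using span_J[OF M J_zero] by simp
    ultimately have "a k i x \<in> arrow_span M i (nb i)"
      using span_split[OF finite_nb, of k i "a k i x" M i] k True by blast
    then show ?thesis using True M_a[OF M \<open>x \<in> M\<close> k] by (simp add: red_def e_a)
  next
    case False
    then show ?thesis using x M_a[OF M _ k, of x] span_J[OF M J_zero, of i "nb i"] by (simp add: red_def e_a_orth)
  qed
qed

lemma red_subset: "red i M \<subseteq> M" by (auto simp: red_def)

lemma e_red: assumes "submodule M" "x \<in> M" "k \<noteq> i" shows "e k x \<in> red i M"
  using assms M_e[OF assms(1)] span_J[OF assms(1) J_zero] by (simp add: red_def e_orth)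

lemma span_red: assumes M: "submodule M" and "i \<notin> S" shows "arrow_span (red i M) j S = arrow_span M j S"
proof
  show "arrow_span (red i M) j S \<subseteq> arrow_span M j S" by (rule span_mono[OF red_subset])
  show "arrow_span M j S \<subseteq> arrow_span (red i M) j S"
  proof
    fix x assume "x \<in> arrow_span M j S"
    then obtain y where y: "\<forall>k\<in>S. y k \<in> M" "x - (\<Sum>k\<in>S. a k j (y k)) \<in> J" by (auto simp: arrow_span_def)
    have "e k (y k) \<in> red i M" if "k \<in> S" for k
      using that y(1) assms(2) by (intro e_red[OF M]) auto
    moreover have "x - (\<Sum>k\<in>S. a k j (e k (y k))) \<in> J" using y(2) by (simp only: a_e)
    ultimately show "x \<in> arrow_span (red i M) j S"
      unfolding arrow_span_def by (intro CollectI exI[of _ "\<lambda>k. e k (y k)"] conjI ballI)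
  qed
qed

lemma red_commute:
  assumes M: "submodule M" and ij: "i \<noteq> j" "j \<notin> nb i"
  shows "red i (red j M) = {x \<in> M. e i x \<in> arrow_span M i (nb i) \<and> e j x \<in> arrow_span M j (nb j)}"
  using span_red[OF M ij(2), of i] by (auto simp: red_def)

text \<open>Let \<open>K\<^sub>i\<close> be the sum of the images of \<open>M\<close> under the arrows that lead to \<open>i\<close> from neighbours other than \<open>j\<close>,
and \<open>K\<^sub>j\<close> the same with \<open>i\<close> and \<open>j\<close> exchanged. The next definitions are \<open>K\<^sub>i\<close>, and the sum of \<open>K\<^sub>i\<close> and
the image of \<open>K\<^sub>j\<close> under the arrow from \<open>j\<close> to \<open>i\<close>.\<close>

definition side_span :: "'g set \<Rightarrow> 'v \<Rightarrow> 'v \<Rightarrow> 'g set" where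
  "side_span M i j = arrow_span M i (nb i - {j})"

definition edge_span :: "'g set \<Rightarrow> 'v \<Rightarrow> 'v \<Rightarrow> 'g set" where
  "edge_span M i j = {x. \<exists>u\<in>side_span M j i. x - a j i u \<in> side_span M i j}"

text \<open>The relation at \<open>i\<close> expresses the path from \<open>i\<close> to \<open>j\<close> and back through the other neighbours of \<open>i\<close>.\<close>

lemma path_through_neighbour:
  assumes M: "submodule M" and x: "x \<in> M" and j: "j \<in> nb i"
  shows "a j i (a i j x) \<in> side_span M i j"
proof -
  have "(\<Sum>k\<in>nb i. a k i (signed_arrow i k x)) = a j i (signed_arrow i j x) + (\<Sum>k\<in>nb i - {j}. a k i (signed_arrow i k x))"
    by (rule sum.remove[OF finite_nb j])
  then have "a j i (signed_arrow i j x) - (\<Sum>k\<in>nb i - {j}. a k i (- signed_arrow i k x)) \<in> J"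
    using relation_b[OF M_F[OF M x], of i] by (simp add: a_minus sum_negf)
  then have "a j i (signed_arrow i j x) \<in> side_span M i j"
    unfolding side_span_def arrow_span_def using M_neg[OF M M_b[OF M x]]
    by (intro CollectI exI[of _ "\<lambda>k. - signed_arrow i k x"]) simp
  then show ?thesis
    using span_neg[OF M, of "a j i (signed_arrow i j x)" i "nb i - {j}"] by (auto simp: signed_arrow_def a_minus side_span_def split: if_splits)
qed

context
  fixes M i j assumes M: "submodule M" and ij: "j \<in> nb i"
begin

lemma edge_sym: "i \<in> nb j" "i \<noteq> j" using ij nb_sym nb_irrefl by auto

lemma side_span_subset: "side_span M i j \<subseteq> arrow_span M i (nb i)"
proof
  fix x assume "x \<in> side_span M i j"
  then have "x - a j i 0 \<in> arrow_span M i (nb i - {j})" by (simp add: side_span_def)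
  then show "x \<in> arrow_span M i (nb i)" using span_split[OF finite_nb ij, of x M i] M_zero[OF M] by blast
qed

lemma side_span_mem: "x \<in> side_span M i j \<Longrightarrow> x \<in> M" using span_mem[OF M, of "nb i - {j}" i x] by (auto simp: side_span_def)

lemma arrow_span_eq_edge: "arrow_span M i (nb i) = {x. \<exists>m\<in>M. x - a j i m \<in> side_span M i j}"
  using span_split[OF finite_nb ij, of _ M i] by (auto simp: side_span_def)

lemma edge_span_subset: "edge_span M i j \<subseteq> arrow_span M i (nb i)"
  unfolding arrow_span_eq_edge edge_span_def using span_mem[OF M, of "nb j - {i}" j] by (auto simp: side_span_def)

end

text \<open>After multiplication with the vertex ideal of \<open>j\<close>, the part of \<open>M\<close> at \<open>j\<close> is the sum of \<open>K\<^sub>j\<close> and the image of \<open>M\<close>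
under the arrow from \<open>i\<close>. Continuing along the arrow to \<open>i\<close>, the second summand ends in \<open>K\<^sub>i\<close> by the
relation.\<close>

lemma span_red_edge:
  assumes M: "submodule M" and ij: "j \<in> nb i"
  shows "arrow_span (red j M) i (nb i) = edge_span M i j"
proof
  note i = edge_sym[OF M ij]
  show "arrow_span (red j M) i (nb i) \<subseteq> edge_span M i j"
  proof
    fix x assume "x \<in> arrow_span (red j M) i (nb i)"
    then obtain m where m: "m \<in> red j M" "x - a j i m \<in> side_span M i j"
      using arrow_span_eq_edge[OF submodule_red[OF M] ij] span_red[OF M, of j "nb i - {j}" i] by (auto simp: side_span_def)
    then obtain t where t: "t \<in> M" "e j m - a i j t \<in> side_span M j i"
      using arrow_span_eq_edge[OF M i(1)] by (auto simp: red_def)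
    define u where "u = e j m - a i j t"
    have "a j i m = a j i u + a j i (a i j t)" unfolding u_def using a_e[of j i m] by (simp add: a_minus)
    then have eq: "x - a j i u = (x - a j i m) + a j i (a i j t)" by simp
    have "x - a j i u \<in> side_span M i j"
      unfolding eq side_span_def
      by (rule span_add[OF M m(2)[unfolded side_span_def] path_through_neighbour[OF M t(1) ij, unfolded side_span_def]])
    then show "x \<in> edge_span M i j" using t(2) by (auto simp: edge_span_def u_def)
  qed
  show "edge_span M i j \<subseteq> arrow_span (red j M) i (nb i)"
  proof
    fix x assume "x \<in> edge_span M i j"
    then obtain u where u: "u \<in> side_span M j i" "x - a j i u \<in> side_span M i j" by (auto simp: edge_span_def)
    have "u \<in> M" using side_span_mem[OF M i(1)] u(1) by blast
    moreover have "e j u \<in> arrow_span M j (nb j)"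
      using span_cong[OF _ span_e[of u M j "nb j - {i}"]] u(1) side_span_subset[OF M i(1)] by (auto simp: side_span_def)
    ultimately have "u \<in> red j M" by (simp add: red_def)
    then show "x \<in> arrow_span (red j M) i (nb i)"
      using u(2) arrow_span_eq_edge[OF submodule_red[OF M] ij] span_red[OF M, of j "nb i - {j}" i] by (auto simp: side_span_def)
  qed
qed

lemma red_red_edge:
  assumes M: "submodule M" and ij: "j \<in> nb i"
  shows "red i (red j M) = {x \<in> red j M. e i x \<in> edge_span M i j}"
  unfolding red_def[of i "red j M"] span_red_edge[OF M ij] ..

lemma span_red_red_edge:
  assumes M: "submodule M" and ij: "j \<in> nb i"
  shows "arrow_span (red i (red j M)) j (nb j) = edge_span M j i"
proof
  note i = edge_sym[OF M ij]
  let ?N = "red i (red j M)"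
  have N: "submodule ?N" by (intro submodule_red M)
  have side_span: "arrow_span ?N j (nb j - {i}) = side_span M j i"
    using span_red[OF submodule_red[OF M], of i "nb j - {i}" j j] span_red[OF M, of j "nb j - {i}" j] nb_irrefl[of j]
    by (simp add: side_span_def)
  show "arrow_span ?N j (nb j) \<subseteq> edge_span M j i"
  proof
    fix x assume "x \<in> arrow_span ?N j (nb j)"
    then obtain n where n: "n \<in> ?N" "x - a i j n \<in> side_span M j i"
      using arrow_span_eq_edge[OF N i(1)] side_span by (auto simp: side_span_def)
    then obtain u where u: "u \<in> side_span M j i" "e i n - a j i u \<in> side_span M i j"
      using red_red_edge[OF M ij] by (auto simp: edge_span_def)
    define v where "v = e i n - a j i u"
    have "a i j n = a i j v + a i j (a j i u)" unfolding v_def using a_e[of i j n] by (simp add: a_minus)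
    then have eq: "x - a i j v = (x - a i j n) + a i j (a j i u)" by simp
    have "x - a i j v \<in> side_span M j i"
      unfolding eq side_span_def
      by (rule span_add[OF M n(2)[unfolded side_span_def] path_through_neighbour[OF M side_span_mem[OF M i(1) u(1)] i(1), unfolded side_span_def]])
    then show "x \<in> edge_span M j i" using u(2) by (auto simp: edge_span_def v_def)
  qed
  show "edge_span M j i \<subseteq> arrow_span ?N j (nb j)"
  proof
    fix x assume "x \<in> edge_span M j i"
    then obtain v where v: "v \<in> side_span M i j" "x - a i j v \<in> side_span M j i" by (auto simp: edge_span_def)
    have vM: "v \<in> M" using side_span_mem[OF M ij] v(1) by blast
    have "e j v \<in> arrow_span M j (nb j)"
      using span_J[OF M span_e_other[of v M i "nb i - {j}" j]] v(1) i(2) by (auto simp: side_span_def)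
    then have vj: "v \<in> red j M" using vM by (simp add: red_def)
    have "e i v \<in> side_span M i j" using span_cong[OF _ span_e[of v M i "nb i - {j}"]] v(1) by (simp add: side_span_def)
    moreover have "0 \<in> side_span M j i" using span_J[OF M J_zero] by (simp add: side_span_def)
    ultimately have "e i v \<in> edge_span M i j" unfolding edge_span_def by (intro CollectI bexI[of _ 0]) auto
    then have "v \<in> ?N" using vj red_red_edge[OF M ij] by simp
    then show "x \<in> arrow_span ?N j (nb j)"
      using v(2) arrow_span_eq_edge[OF N i(1)] side_span by (auto simp: side_span_def)
  qed
qed

text \<open>Both sides are the part of \<open>M\<close> that lies in \<open>edge_span M i j\<close> at \<open>i\<close> and in \<open>edge_span M j i\<close> at \<open>j\<close>, which is
symmetric in \<open>i\<close> and \<open>j\<close>.\<close>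

theorem red_braid:
  assumes M: "submodule M" and ij: "j \<in> nb i"
  shows "red j (red i (red j M)) = red i (red j (red i M))"
proof -
  note i = edge_sym[OF M ij]
  have *: "red j (red i (red j M)) = {x \<in> M. e i x \<in> edge_span M i j \<and> e j x \<in> edge_span M j i}" if ij: "j \<in> nb i" for i j
  proof -
    have "red j (red i (red j M)) = {x \<in> red i (red j M). e j x \<in> edge_span M j i}"
      by (subst red_def) (simp only: span_red_red_edge[OF M ij])
    then show ?thesis
      unfolding red_red_edge[OF M ij] using edge_span_subset[OF M edge_sym(1)[OF M ij]] by (auto simp: red_def)
  qed
  show ?thesis unfolding *[OF ij] *[OF i(1)] by auto
qed

text \<open>Modulo \<open>J\<close>, exactness in the middle of \<open>Me\<^sub>j \<rightarrow> \<Oplus> Me\<^sub>k \<rightarrow> Me\<^sub>j\<close>, where the first map multiplies with the signed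
arrows that start in \<open>j\<close> and the second map sums the products with the arrows that end in \<open>j\<close>.\<close>

definition exact :: "'g set \<Rightarrow> 'v \<Rightarrow> bool" where
  "exact M j \<longleftrightarrow> (\<forall>y. (\<forall>k\<in>nb j. y k \<in> M) \<longrightarrow> (\<Sum>k\<in>nb j. a k j (y k)) \<in> J \<longrightarrow>
     (\<exists>z\<in>M. \<forall>k\<in>nb j. e k (y k) - signed_arrow j k z \<in> J))"

lemma signed_arrow_e: "signed_arrow j k (e j z) = signed_arrow j k z"
  by (simp add: signed_arrow_def a_e)

text \<open>Only the part at \<open>j\<close> of the witness matters, and there \<open>M\<close> and \<open>red i M\<close> agree.\<close>

lemma exact_red:
  assumes M: "submodule M" and ij: "i \<noteq> j" and ex: "exact M j"
  shows "exact (red i M) j"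
  unfolding exact_def
proof (intro allI impI)
  fix y assume y: "\<forall>k\<in>nb j. y k \<in> red i M" "(\<Sum>k\<in>nb j. a k j (y k)) \<in> J"
  then have "\<forall>k\<in>nb j. y k \<in> M" by (simp add: red_def)
  then obtain z where z: "z \<in> M" "\<forall>k\<in>nb j. e k (y k) - signed_arrow j k z \<in> J" using ex y(2) unfolding exact_def by blast
  have "e j z \<in> red i M" using e_red[OF M z(1)] ij by simp
  then show "\<exists>z\<in>red i M. \<forall>k\<in>nb j. e k (y k) - signed_arrow j k z \<in> J"
    using z(2) signed_arrow_e by (intro bexI[of _ "e j z"]) auto
qed

text \<open>The hypothesis completes \<open>x\<close> to a family on the neighbours of \<open>i\<close> whose products with the arrows sum to zero;
by exactness \<open>x\<close> is a multiple of the arrow from \<open>i\<close> to \<open>j\<close> up to the parts away from \<open>j\<close>.\<close>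

lemma exact_cancel:
  assumes M: "submodule M" and ij: "j \<in> nb i" and ex: "exact M i" and x: "x \<in> M" "a j i x \<in> side_span M i j"
  shows "e j x \<in> arrow_span M j (nb j)"
proof -
  note i = edge_sym[OF M ij]
  obtain y where y: "\<forall>k\<in>nb i - {j}. y k \<in> M" "a j i x - (\<Sum>k\<in>nb i - {j}. a k i (y k)) \<in> J"
    using x(2) by (auto simp: side_span_def arrow_span_def)
  define y' where "y' k = (if k = j then x else - y k)" for k
  have "(\<Sum>k\<in>nb i. a k i (y' k)) = a j i (y' j) + (\<Sum>k\<in>nb i - {j}. a k i (y' k))"
    by (rule sum.remove[OF finite_nb ij])
  also have "\<dots> = a j i x - (\<Sum>k\<in>nb i - {j}. a k i (y k))"
    by (simp add: y'_def a_minus sum_negf)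
  finally have "(\<Sum>k\<in>nb i. a k i (y' k)) \<in> J" using y(2) by simp
  moreover have "\<forall>k\<in>nb i. y' k \<in> M" using y(1) x(1) M_neg[OF M] by (simp add: y'_def)
  ultimately obtain z where z0: "z \<in> M" "\<forall>k\<in>nb i. e k (y' k) - signed_arrow i k z \<in> J"
    using ex unfolding exact_def by blast
  have z: "z \<in> M" "e j x - signed_arrow i j z \<in> J" using z0(1) bspec[OF z0(2) ij] by (simp_all add: y'_def)
  define z' where "z' = (if positive i j then z else - z)"
  have "signed_arrow i j z = a i j z'" by (simp add: signed_arrow_def z'_def a_minus)
  moreover have "z' \<in> M" using z(1) M_neg[OF M] by (simp add: z'_def)
  moreover have "e j x - signed_arrow i j z \<in> side_span M j i" unfolding side_span_def by (rule span_J[OF M z(2)])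
  ultimately show ?thesis using arrow_span_eq_edge[OF M i(1)] by auto
qed

text \<open>Exactness of \<open>M\<close> at \<open>j\<close> provides a witness \<open>z\<close> in \<open>M\<close>, and it remains to see that its part at \<open>j\<close> lies in the
smaller module. Its image under the arrow to \<open>i\<close> equals, modulo \<open>K\<^sub>i\<close>, that of some \<open>u\<close> in \<open>K\<^sub>j\<close>;
exactness at \<open>i\<close> then cancels this arrow from the difference.\<close>

lemma exact_red_red:
  assumes M: "submodule M" and ij: "j \<in> nb i" and ex: "exact M i" "exact M j"
  shows "exact (red i (red j M)) j"
  unfolding exact_def
proof (intro allI impI)
  note i = edge_sym[OF M ij]
  let ?N = "red i (red j M)"
  fix y assume y: "\<forall>k\<in>nb j. y k \<in> ?N" "(\<Sum>k\<in>nb j. a k j (y k)) \<in> J"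
  then have "\<forall>k\<in>nb j. y k \<in> M" by (simp add: red_def)
  then obtain z where z: "z \<in> M" "\<forall>k\<in>nb j. e k (y k) - signed_arrow j k z \<in> J" using ex(2) y(2) unfolding exact_def by blast
  define z' where "z' = (if positive j i then z else - z)"
  have z'M: "z' \<in> M" using z(1) M_neg[OF M] by (simp add: z'_def)
  have "e i (y i) - a j i z' \<in> J" using bspec[OF z(2) i(1)] by (cases "positive j i") (simp_all add: signed_arrow_def z'_def a_minus)
  moreover have "e i (y i) \<in> edge_span M i j" using y(1) i(1) red_red_edge[OF M ij] by simp
  ultimately have "a j i z' \<in> edge_span M i j"
    using span_cong[of "e i (y i)" "red j M" i "nb i" "a j i z'"] J_neg[of "e i (y i) - a j i z'"]
    unfolding span_red_edge[OF M ij] by simp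
  then obtain u where u: "u \<in> side_span M j i" "a j i z' - a j i u \<in> side_span M i j" by (auto simp: edge_span_def)
  have uM: "u \<in> M" by (rule side_span_mem[OF M i(1) u(1)])
  have "a j i (z' - u) \<in> side_span M i j" using u(2) by (simp add: a_minus)
  then have "e j (z' - u) \<in> arrow_span M j (nb j)"
    by (rule exact_cancel[OF M ij ex(1) M_diff[OF M z'M uM]])
  moreover have "e j u \<in> arrow_span M j (nb j)"
    using span_cong[OF _ span_e[of u M j "nb j - {i}"]] u(1) side_span_subset[OF M i(1)] by (auto simp: side_span_def)
  ultimately have "e j z' \<in> arrow_span M j (nb j)"
    using span_add[OF M, of "e j (z' - u)" j "nb j" "e j u"] by (simp add: e_minus)
  then have "e j z \<in> arrow_span M j (nb j)"
    using span_neg[OF M, of "e j z'" j "nb j"] by (cases "positive j i") (simp_all add: z'_def e_minus)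
  then have "e j z \<in> red j M" using M_e[OF M z(1)] by (simp add: red_def e_idem)
  then have "e j (e j z) \<in> ?N" using e_red[OF submodule_red[OF M], of _ j j i] i(2) by metis
  then show "\<exists>z\<in>?N. \<forall>k\<in>nb j. e k (y k) - signed_arrow j k z \<in> J"
    using z(2) signed_arrow_e by (intro bexI[of _ "e j z"]) (auto simp: e_idem)
qed

text \<open>The inclusion of \<open>red j M\<close> into \<open>M\<close> induces an isomorphism of the two quotients by the steps at \<open>i\<close>,
because the step at \<open>j\<close> changes neither \<open>Me\<^sub>i\<close> nor the parts of \<open>M\<close> at the neighbours of \<open>i\<close>.\<close>

lemma layer_square:
  assumes M: "submodule M" and ij: "i \<noteq> j" "j \<notin> nb i"
  shows "red j M \<subseteq> M" "x \<in> M \<Longrightarrow> \<exists>y\<in>red j M. x - y \<in> red i M"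
    "x \<in> red j M \<Longrightarrow> x \<in> red i (red j M) \<longleftrightarrow> x \<in> red i M"
proof -
  show "red j M \<subseteq> M" by (rule red_subset)
  show "\<exists>y\<in>red j M. x - y \<in> red i M" if "x \<in> M"
    using e_red[OF M that ij(1)] M_diff[OF M that M_e[OF M that, of i]] span_J[OF M J_zero, of i "nb i"]
    by (intro bexI[of _ "e i x"]) (simp_all add: red_def e_minus e_idem)
  show "x \<in> red i (red j M) \<longleftrightarrow> x \<in> red i M" if "x \<in> red j M"
    using that red_commute[OF M ij] by (auto simp: red_def)
qed

text \<open>At the vertex \<open>j\<close>, the upper layer is the quotient of \<open>K\<^sub>j + Ma\<close> by \<open>K\<^sub>j + K\<^sub>ia\<close>, where \<open>a\<close> is the arrow from \<open>i\<close> to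
\<open>j\<close>, so right multiplication by \<open>a\<close> maps onto it. The kernel is controlled by cancelling \<open>a\<close>, which is
where exactness at \<open>j\<close> enters.\<close>

lemma layer_hexagon:
  assumes M: "submodule M" and ij: "j \<in> nb i" and ex: "exact M j"
  shows "x \<in> M \<Longrightarrow> a i j x \<in> red i (red j M)"
    and "x \<in> M \<Longrightarrow> a i j x \<in> red j (red i (red j M)) \<longleftrightarrow> x \<in> red i M"
    and "y \<in> red i (red j M) \<Longrightarrow> \<exists>x\<in>M. y - a i j x \<in> red j (red i (red j M))"
proof -
  note i = edge_sym[OF M ij]
  let ?N = "red i (red j M)"
  have N: "submodule ?N" by (intro submodule_red M)
  have N': "x \<in> red j ?N \<longleftrightarrow> x \<in> ?N \<and> e j x \<in> edge_span M j i" for x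
    by (subst red_def) (simp only: span_red_red_edge[OF M ij] mem_Collect_eq)
  have aN: "a i j x \<in> ?N" if x: "x \<in> M" for x
  proof -
    have "0 \<in> side_span M j i" using span_J[OF M J_zero] by (simp add: side_span_def)
    then have "a i j x - a i j x \<in> side_span M j i" by simp
    then have "a i j x \<in> arrow_span M j (nb j)" using x arrow_span_eq_edge[OF M i(1)] by blast
    then have "a i j x \<in> red j M" using M_a[OF M x i(1)] by (simp add: red_def e_a)
    then have "e j (a i j x) \<in> ?N" using e_red[OF submodule_red[OF M], of _ j j i] i(2) by metis
    then show ?thesis by (simp add: e_a)
  qed
  then show "x \<in> M \<Longrightarrow> a i j x \<in> ?N" .
  show "a i j x \<in> red j ?N \<longleftrightarrow> x \<in> red i M" if x: "x \<in> M"
  proof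
    assume "a i j x \<in> red j ?N"
    then obtain v where v: "v \<in> side_span M i j" "a i j x - a i j v \<in> side_span M j i" using N' by (auto simp: e_a edge_span_def)
    have vM: "v \<in> M" by (rule side_span_mem[OF M ij v(1)])
    have "a i j (x - v) \<in> side_span M j i" using v(2) by (simp add: a_minus)
    then have 1: "e i (x - v) \<in> arrow_span M i (nb i)" by (rule exact_cancel[OF M i(1) ex M_diff[OF M x vM]])
    have 2: "e i v \<in> arrow_span M i (nb i)"
      using span_cong[OF _ span_e[of v M i "nb i - {j}"]] v(1) side_span_subset[OF M ij] by (auto simp: side_span_def)
    have "e i x \<in> arrow_span M i (nb i)" using span_add[OF M 1 2] by (simp add: e_minus)
    then show "x \<in> red i M" using x by (simp add: red_def)
  next
    assume "x \<in> red i M"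
    then obtain t where t: "t \<in> M" "e i x - a j i t \<in> side_span M i j" using arrow_span_eq_edge[OF M ij] by (auto simp: red_def)
    define v where "v = e i x - a j i t"
    have "a i j x - a i j v = a i j (a j i t)" unfolding v_def using a_e[of i j x] by (simp add: a_minus)
    then have "a i j x - a i j v \<in> side_span M j i" using path_through_neighbour[OF M t(1) i(1)] by (simp only:)
    moreover have "v \<in> side_span M i j" using t(2) by (simp only: v_def)
    ultimately have "a i j x \<in> edge_span M j i" unfolding edge_span_def by blast
    then show "a i j x \<in> red j ?N" using N' aN[OF x] by (simp add: e_a)
  qed
  show "\<exists>x\<in>M. y - a i j x \<in> red j ?N" if y: "y \<in> ?N"
  proof -
    have "e j y \<in> arrow_span M j (nb j)" using y by (simp add: red_def)
    then obtain t where t: "t \<in> M" "e j y - a i j t \<in> side_span M j i" using arrow_span_eq_edge[OF M i(1)] by auto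
    have "0 \<in> side_span M i j" using span_J[OF M J_zero] by (simp add: side_span_def)
    then have "e j (y - a i j t) \<in> edge_span M j i"
      using t(2) unfolding edge_span_def by (intro CollectI bexI[of _ 0]) (simp_all add: e_minus e_a)
    moreover have "y - a i j t \<in> ?N" using M_diff[OF N y aN[OF t(1)]] .
    ultimately show ?thesis using N' t(1) by blast
  qed
qed

end

section \<open>The path algebra\<close>

definition conv :: "('v list \<Rightarrow> 'k::field) \<Rightarrow> ('v list \<Rightarrow> 'k) \<Rightarrow> 'v list \<Rightarrow> 'k" where
  "conv f g = (\<lambda>p. \<Sum>t<length p. f (take (Suc t) p) * g (drop t p))"

definition path_functions :: "'v set \<Rightarrow> ('v \<times> 'v) set \<Rightarrow> ('v list \<Rightarrow> 'k::field) set" where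
  "path_functions V A = {f. finite {p. f p \<noteq> 0} \<and> {p. f p \<noteq> 0} \<subseteq> paths V A}"

lemma path_algebra_simps [simp]:
  "carrier (path_algebra V A) = path_functions V A"
  "mult (path_algebra V A) = conv"
  "zero (path_algebra V A) = 0"
  "add (path_algebra V A) = (+)"
  "one (path_algebra V A) = (\<lambda>p. if \<exists>i\<in>V. p = [i] then 1 else 0)"
  by (simp_all add: path_algebra_def path_functions_def conv_def fun_eq_iff)

lemma conv_add_left: "conv (f + g) h = conv f h + conv g h"
  and conv_add_right: "conv h (f + g) = conv h f + conv h g"
  by (simp_all add: conv_def fun_eq_iff algebra_simps sum.distrib)

lemma additive_conv: "additive (conv f)" and additive_conv_left: "additive (\<lambda>f. conv f g)"
  by (simp_all add: additive_def conv_add_left conv_add_right)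

text \<open>Both sides sum over the ways to cut a path at two vertices \<open>t \<le> u\<close>.\<close>

lemma conv_assoc: "conv (conv f g) h = conv f (conv g h)"
proof
  fix p :: "'a list"
  define X where "X t u = f (take (Suc t) p) * g (drop t (take (Suc u) p)) * h (drop u p)" for t u
  have "conv f (conv g h) p = (\<Sum>t<length p. \<Sum>s<length p - t. X t (t + s))"
    unfolding conv_def X_def
    by (auto simp: sum_distrib_left mult.assoc take_drop add.commute intro!: sum.cong)
  also have "\<dots> = (\<Sum>t<length p. \<Sum>u\<in>{u \<in> {..<length p}. t \<le> u}. X t u)"
  proof (rule sum.cong[OF refl])
    fix t assume "t \<in> {..<length p}"
    then have "bij_betw ((+) t) {..<length p - t} {u \<in> {..<length p}. t \<le> u}"
      by (intro bij_betwI[of _ _ _ "\<lambda>u. u - t"]) auto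
    then show "(\<Sum>s<length p - t. X t (t + s)) = (\<Sum>u\<in>{u \<in> {..<length p}. t \<le> u}. X t u)"
      by (rule sum.reindex_bij_betw)
  qed
  also have "\<dots> = (\<Sum>u<length p. \<Sum>t\<in>{t \<in> {..<length p}. t \<le> u}. X t u)"
    by (rule sum.swap_restrict) auto
  also have "\<dots> = (\<Sum>u<length p. \<Sum>t<Suc u. X t u)"
    by (intro sum.cong) auto
  also have "\<dots> = conv (conv f g) h p"
    unfolding conv_def[of "conv f g"]
  proof (rule sum.cong[OF refl])
    fix u assume "u \<in> {..<length p}"
    then have "length (take (Suc u) p) = Suc u" by simp
    moreover have "take (Suc t) (take (Suc u) p) = take (Suc t) p" if "t < Suc u" for t
      using that by (simp add: min_def)
    ultimately show "(\<Sum>t<Suc u. X t u) = conv f g (take (Suc u) p) * h (drop u p)"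
      unfolding conv_def X_def sum_distrib_right by (intro sum.cong) simp_all
  qed
  finally show "conv (conv f g) h p = conv f (conv g h) p" by simp
qed

lemma path_cut:
  assumes "t < length p"
  shows "p \<in> paths V A \<longleftrightarrow> take (Suc t) p \<in> paths V A \<and> drop t p \<in> paths V A"
proof -
  have "set p = set (take (Suc t) p) \<union> set (drop t p)"
  proof -
    have "set p = set (take (Suc t) p) \<union> set (drop (Suc t) p)"
      by (metis append_take_drop_id set_append)
    moreover have "set (drop t p) \<subseteq> set p" "set (drop (Suc t) p) \<subseteq> set (drop t p)"
      using set_drop_subset set_drop_subset_set_drop by (metis, metis le_SucI le_refl)
    ultimately show ?thesis by auto
  qed
  moreover have "(\<forall>i. Suc i < length p \<longrightarrow> (p ! i, p ! Suc i) \<in> A) \<longleftrightarrow>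
     (\<forall>i. Suc i < length (take (Suc t) p) \<longrightarrow> (take (Suc t) p ! i, take (Suc t) p ! Suc i) \<in> A) \<and>
     (\<forall>i. Suc i < length (drop t p) \<longrightarrow> (drop t p ! i, drop t p ! Suc i) \<in> A)" (is "?P \<longleftrightarrow> ?Q1 \<and> ?Q2")
  proof
    assume ?P
    then show "?Q1 \<and> ?Q2" using assms by auto
  next
    assume Q: "?Q1 \<and> ?Q2"
    show ?P
    proof (intro allI impI)
      fix i assume i: "Suc i < length p"
      show "(p ! i, p ! Suc i) \<in> A"
      proof (cases "i < t")
        case True
        then show ?thesis using Q assms by auto
      next
        case False
        then have "Suc (i - t) < length (drop t p)" using i by auto
        then show ?thesis using Q assms False i by (auto dest!: spec[of _ "i - t"])
      qed
    qed
  qed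
  ultimately show ?thesis using assms by (auto simp: paths_def successively_conv_nth)
qed

lemma conv_closed:
  assumes "f \<in> path_functions V A" "g \<in> path_functions V A"
  shows "conv f g \<in> path_functions V A"
proof -
  have cut: "\<exists>t<length p. f (take (Suc t) p) \<noteq> 0 \<and> g (drop t p) \<noteq> 0" if "conv f g p \<noteq> 0" for p
  proof (rule ccontr)
    assume "\<not> ?thesis"
    then have "conv f g p = 0" unfolding conv_def by (intro sum.neutral) auto
    then show False using that by simp
  qed
  have "{p. conv f g p \<noteq> 0} \<subseteq> (\<lambda>(q, r). q @ tl r) ` ({p. f p \<noteq> 0} \<times> {p. g p \<noteq> 0})"
  proof
    fix p assume "p \<in> {p. conv f g p \<noteq> 0}"
    then obtain t where t: "t < length p" "f (take (Suc t) p) \<noteq> 0" "g (drop t p) \<noteq> 0" using cut by auto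
    have "p = take (Suc t) p @ tl (drop t p)"
      using append_take_drop_id[of "Suc t" p] by (simp add: drop_Suc tl_drop del: append_take_drop_id)
    then show "p \<in> (\<lambda>(q, r). q @ tl r) ` ({p. f p \<noteq> 0} \<times> {p. g p \<noteq> 0})" using t by (auto intro!: image_eqI[of _ _ "(take (Suc t) p, drop t p)"])
  qed
  moreover have "finite ({p. f p \<noteq> 0} \<times> {p. g p \<noteq> 0})" using assms by (simp add: path_functions_def)
  ultimately have "finite {p. conv f g p \<noteq> 0}" by (meson finite_imageI finite_subset)
  moreover have "p \<in> paths V A" if p: "conv f g p \<noteq> 0" for p
  proof -
    obtain t where t: "t < length p" "f (take (Suc t) p) \<noteq> 0" "g (drop t p) \<noteq> 0" using cut[OF p] by auto
    then have "take (Suc t) p \<in> paths V A" "drop t p \<in> paths V A" using assms by (auto simp: path_functions_def)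
    then show ?thesis using path_cut[OF t(1)] by blast
  qed
  ultimately show ?thesis by (auto simp: path_functions_def)
qed

lemma path_functions_add: "f \<in> path_functions V A \<Longrightarrow> g \<in> path_functions V A \<Longrightarrow> f + g \<in> path_functions V A"
proof -
  assume fg: "f \<in> path_functions V A" "g \<in> path_functions V A"
  have "{p. (f + g) p \<noteq> 0} \<subseteq> {p. f p \<noteq> 0} \<union> {p. g p \<noteq> 0}" by auto
  then show "f + g \<in> path_functions V A" using fg unfolding path_functions_def
    by (auto intro: finite_subset)
qed

lemma path_functions_minus: "f \<in> path_functions V A \<Longrightarrow> - f \<in> path_functions V A"
  by (simp add: path_functions_def)

lemma path_functions_zero: "0 \<in> path_functions V A"
  by (simp add: path_functions_def)

lemma path_functions_Nil: "f \<in> path_functions V A \<Longrightarrow> f [] = 0"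
  by (auto simp: path_functions_def paths_def)

lemma one_conv:
  assumes g: "g \<in> path_functions V A"
  shows "conv (\<lambda>p. if \<exists>i\<in>V. p = [i] then 1 else 0) g = g"
proof
  fix p
  show "conv (\<lambda>p. if \<exists>i\<in>V. p = [i] then 1 else 0) g p = g p"
  proof (cases p)
    case Nil
    then show ?thesis using path_functions_Nil[OF g] by (simp add: conv_def)
  next
    case (Cons v q)
    have "(\<Sum>t<length p. (if \<exists>i\<in>V. take (Suc t) p = [i] then 1 else 0) * g (drop t p))
       = (\<Sum>t\<in>{0}. (if \<exists>i\<in>V. take (Suc t) p = [i] then 1 else 0) * g (drop t p))"
      by (rule sum.mono_neutral_right) (auto simp: Cons take_Cons' split: if_splits)
    moreover have "g p = 0" if "v \<notin> V" using g that Cons by (auto simp: path_functions_def paths_def)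
    ultimately show ?thesis by (auto simp: conv_def Cons)
  qed
qed

lemma conv_one:
  assumes g: "g \<in> path_functions V A"
  shows "conv g (\<lambda>p. if \<exists>i\<in>V. p = [i] then 1 else 0) = g"
proof
  fix p
  show "conv g (\<lambda>p. if \<exists>i\<in>V. p = [i] then 1 else 0) p = g p"
  proof (cases p rule: rev_cases)
    case Nil
    then show ?thesis using path_functions_Nil[OF g] by (simp add: conv_def)
  next
    case (snoc q v)
    have "(\<Sum>t<length p. g (take (Suc t) p) * (if \<exists>i\<in>V. drop t p = [i] then 1 else 0))
       = (\<Sum>t\<in>{length q}. g (take (Suc t) p) * (if \<exists>i\<in>V. drop t p = [i] then 1 else 0))"
    proof (rule sum.mono_neutral_right)
      show "\<forall>t\<in>{..<length p} - {length q}. g (take (Suc t) p) * (if \<exists>i\<in>V. drop t p = [i] then 1 else 0) = 0"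
      proof
        fix t assume t: "t \<in> {..<length p} - {length q}"
        then have "length (drop t p) \<noteq> 1" by (auto simp: snoc)
        then have "\<not> (\<exists>i\<in>V. drop t p = [i])" by (metis length_Cons list.size(3) One_nat_def)
        then show "g (take (Suc t) p) * (if \<exists>i\<in>V. drop t p = [i] then 1 else 0) = 0" by simp
      qed
    qed (auto simp: snoc)
    moreover have "g p = 0" if "v \<notin> V" using g that snoc by (auto simp: path_functions_def paths_def)
    ultimately show ?thesis by (auto simp: conv_def snoc)
  qed
qed

lemma ring_path_algebra:
  assumes "finite V" shows "ring (path_algebra V A :: ('v list \<Rightarrow> 'k::field) ring)"
proof (rule ringI)
  show "abelian_group (path_algebra V A :: ('v list \<Rightarrow> 'k) ring)"
  proof (rule abelian_groupI)
    fix f :: "'v list \<Rightarrow> 'k" assume "f \<in> carrier (path_algebra V A)"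
    then show "\<exists>g\<in>carrier (path_algebra V A). g \<oplus>\<^bsub>path_algebra V A\<^esub> f = \<zero>\<^bsub>path_algebra V A\<^esub>"
      by (intro bexI[of _ "- f"]) (simp_all add: path_functions_minus)
  qed (simp_all add: path_functions_add path_functions_zero ac_simps)
  have "(\<lambda>p. if \<exists>i\<in>V. p = [i] then 1 else 0 :: 'k) \<in> path_functions V A"
  proof -
    have "{p. \<exists>i\<in>V. p = [i]} = (\<lambda>i. [i]) ` V" by auto
    then show ?thesis using assms by (auto simp: path_functions_def paths_def)
  qed
  then show "Group.monoid (path_algebra V A :: ('v list \<Rightarrow> 'k) ring)"
    by (intro monoidI) (simp_all add: conv_closed conv_assoc one_conv conv_one)
qed (simp_all add: conv_add_left conv_add_right)

lemma path_algebra_a_inv: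
  fixes f :: "'v list \<Rightarrow> 'k::field"
  assumes "finite V" "f \<in> path_functions V A"
  shows "\<ominus>\<^bsub>path_algebra V A\<^esub> f = - f"
proof -
  interpret ring "path_algebra V A :: ('v list \<Rightarrow> 'k) ring" by (rule ring_path_algebra[OF assms(1)])
  show ?thesis using minus_equality[of "- f" f] assms(2) by (simp add: path_functions_minus)
qed

lemma path_algebra_finsum:
  fixes f :: "'x \<Rightarrow> 'v list \<Rightarrow> 'k::field"
  assumes "finite V" "finite S" "\<And>x. x \<in> S \<Longrightarrow> f x \<in> path_functions V A"
  shows "finsum (path_algebra V A) f S = (\<Sum>x\<in>S. f x)"
proof -
  interpret ring "path_algebra V A :: ('v list \<Rightarrow> 'k) ring" by (rule ring_path_algebra[OF assms(1)])
  show ?thesis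
    using assms(2,3)
  proof (induction S)
    case empty
    then show ?case by simp
  next
    case (insert x S)
    then have "finsum (path_algebra V A) f (insert x S) = f x \<oplus>\<^bsub>path_algebra V A\<^esub> finsum (path_algebra V A) f S"
      by (intro finsum_insert) auto
    then show ?case using insert by simp
  qed
qed

text \<open>Right multiplication by the idempotent at \<open>i\<close>, as a formula for the coefficients; the next definition does
the same for the arrow from \<open>k\<close> to \<open>i\<close>.\<close>

definition end_at :: "'v \<Rightarrow> ('v list \<Rightarrow> 'k::field) \<Rightarrow> 'v list \<Rightarrow> 'k" where
  "end_at i f = (\<lambda>p. if p \<noteq> [] \<and> last p = i then f p else 0)"

definition then_arrow :: "'v \<Rightarrow> 'v \<Rightarrow> ('v list \<Rightarrow> 'k::field) \<Rightarrow> 'v list \<Rightarrow> 'k" where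
  "then_arrow k i f = (\<lambda>p. if length p \<ge> 2 \<and> last p = i \<and> last (butlast p) = k then f (butlast p) else 0)"

lemma conv_vertex: "conv f (path_basis [i]) = end_at i f"
proof
  fix p
  show "conv f (path_basis [i]) p = end_at i f p"
  proof (cases p rule: rev_cases)
    case (snoc q v)
    have "(\<Sum>t<length p. f (take (Suc t) p) * path_basis [i] (drop t p))
       = (\<Sum>t\<in>{length q}. f (take (Suc t) p) * path_basis [i] (drop t p))"
    proof (rule sum.mono_neutral_right)
      show "\<forall>t\<in>{..<length p} - {length q}. f (take (Suc t) p) * path_basis [i] (drop t p) = 0"
      proof
        fix t assume t: "t \<in> {..<length p} - {length q}"
        then have "length (drop t p) \<noteq> 1" by (auto simp: snoc)
        then have "drop t p \<noteq> [i]" by (metis length_Cons list.size(3) One_nat_def)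
        then show "f (take (Suc t) p) * path_basis [i] (drop t p) = 0" by (simp add: path_basis_def)
      qed
    qed (auto simp: snoc)
    then show ?thesis by (auto simp: conv_def snoc path_basis_def end_at_def)
  qed (simp add: conv_def end_at_def)
qed

lemma conv_arrow: "conv f (path_basis [k, i]) = then_arrow k i f"
proof
  fix p
  show "conv f (path_basis [k, i]) p = then_arrow k i f p"
  proof (cases "length p \<ge> 2")
    case True
    then obtain q u v where p: "p = q @ [u, v]"
      by (metis append_butlast_last_id append.assoc append_Cons append_Nil butlast.simps(1) length_butlast
          length_0_conv diff_is_0_eq not_less_eq_eq numeral_2_eq_2 One_nat_def)
    have "(\<Sum>t<length p. f (take (Suc t) p) * path_basis [k, i] (drop t p))
       = (\<Sum>t\<in>{length q}. f (take (Suc t) p) * path_basis [k, i] (drop t p))"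
    proof (rule sum.mono_neutral_right)
      show "\<forall>t\<in>{..<length p} - {length q}. f (take (Suc t) p) * path_basis [k, i] (drop t p) = 0"
      proof
        fix t assume t: "t \<in> {..<length p} - {length q}"
        then have "length (drop t p) \<noteq> 2" by (auto simp: p)
        then have "drop t p \<noteq> [k, i]" by (metis length_Cons list.size(3) numeral_2_eq_2)
        then show "f (take (Suc t) p) * path_basis [k, i] (drop t p) = 0" by (simp add: path_basis_def)
      qed
    qed (auto simp: p)
    then show ?thesis by (auto simp: conv_def p path_basis_def then_arrow_def butlast_append)
  next
    case False
    have "drop t p \<noteq> [k, i]" for t
    proof
      assume "drop t p = [k, i]"
      then have "length (drop t p) = 2" by simp
      then show False using False by simp
    qed
    then show ?thesis using False by (simp add: conv_def path_basis_def then_arrow_def)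
  qed
qed

section \<open>The preprojective relation\<close>

lemma end_at_add: "end_at i (f + g) = end_at i f + end_at i g"
  and then_arrow_add: "then_arrow k i (f + g) = then_arrow k i f + then_arrow k i g"
  by (auto simp: end_at_def then_arrow_def fun_eq_iff)

lemma additive_end_at: "additive (end_at i)" and additive_then_arrow: "additive (then_arrow k i)"
  by (simp_all add: additive_def end_at_add then_arrow_add)

lemma butlast_ne: "2 \<le> length p \<Longrightarrow> butlast p \<noteq> []"
  by (cases p rule: rev_cases) auto

lemma end_at_end_at: "end_at i (end_at j f) = (if i = j then end_at j f else 0)"
  and end_at_then_arrow: "end_at j (then_arrow k i f) = (if j = i then then_arrow k i f else 0)"
  and then_arrow_end_at: "then_arrow k i (end_at k f) = then_arrow k i f"
  using butlast_ne by (auto simp: end_at_def then_arrow_def fun_eq_iff)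

text \<open>The parameter \<open>scalars\<close> only fixes the type of the coefficients.\<close>

locale preprojective = oriented_graph V E Q
  for V :: "'v set" and E :: "'v set set" and Q :: "('v \<times> 'v) set" +
  fixes scalars :: "'k::field itself"
begin

abbreviation R :: "('v list \<Rightarrow> 'k) ring" where "R \<equiv> path_algebra V (double_quiver Q)"
abbreviation F :: "('v list \<Rightarrow> 'k) set" where "F \<equiv> path_functions V (double_quiver Q)"
abbreviation J :: "('v list \<Rightarrow> 'k) set" where "J \<equiv> preprojective_ideal V Q"
abbreviation \<rho> :: "'v list \<Rightarrow> 'k" where "\<rho> \<equiv> preprojective_relation V Q"
abbreviation unit_path :: "'v list \<Rightarrow> 'k" where "unit_path \<equiv> \<lambda>p. if \<exists>i\<in>V. p = [i] then 1 else 0"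

sublocale R: ring R by (rule ring_path_algebra[OF finite_V])

lemma arrow_iff: "(i, j) \<in> double_quiver Q \<longleftrightarrow> {i, j} \<in> E"
  by (auto simp: double_quiver_def edge_Q)

lemma basis_vertex: "i \<in> V \<Longrightarrow> path_basis [i] \<in> F"
  and basis_arrow: "{i, j} \<in> E \<Longrightarrow> path_basis [i, j] \<in> F"
  using edge_verts by (auto simp: path_functions_def path_basis_def paths_def arrow_iff)

lemma end_at_outside: "f \<in> F \<Longrightarrow> i \<notin> V \<Longrightarrow> end_at i f = 0"
proof -
  assume f: "f \<in> F" "i \<notin> V"
  have "f p = 0" if "p \<noteq> []" "last p = i" for p
  proof (rule ccontr)
    assume "f p \<noteq> 0"
    then have "p \<in> paths V (double_quiver Q)" using f(1) by (auto simp: path_functions_def)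
    then have "last p \<in> V" using that(1) last_in_set by (auto simp: paths_def)
    then show False using that f(2) by simp
  qed
  then show "end_at i f = 0" by (auto simp: end_at_def fun_eq_iff)
qed

definition relation_term :: "'v \<times> 'v \<Rightarrow> 'v list \<Rightarrow> 'k" where
  "relation_term = (\<lambda>(i, j). conv (path_basis [i, j]) (path_basis [j, i]) - conv (path_basis [j, i]) (path_basis [i, j]))"

lemma relation_term_closed: "p \<in> Q \<Longrightarrow> relation_term p \<in> F"
  and relation_term_eq: "p \<in> Q \<Longrightarrow>
    (case p of (i, j) \<Rightarrow> path_basis [i, j] \<otimes>\<^bsub>R\<^esub> path_basis [j, i] \<ominus>\<^bsub>R\<^esub> path_basis [j, i] \<otimes>\<^bsub>R\<^esub> path_basis [i, j])
      = relation_term p"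
proof -
  assume "p \<in> Q"
  obtain i j where p: "p = (i, j)" by (cases p)
  then have "{i, j} \<in> E" "{j, i} \<in> E" using Q_edge \<open>p \<in> Q\<close> by (auto simp: insert_commute)
  then have F: "conv (path_basis [i, j]) (path_basis [j, i]) \<in> F" "conv (path_basis [j, i]) (path_basis [i, j]) \<in> F"
    using conv_closed[OF basis_arrow basis_arrow, of i j j i] conv_closed[OF basis_arrow basis_arrow, of j i i j] by simp_all
  show "relation_term p \<in> F"
    using path_functions_add[OF F(1) path_functions_minus[OF F(2)]] by (simp add: p relation_term_def)
  show "(case p of (i, j) \<Rightarrow> path_basis [i, j] \<otimes>\<^bsub>R\<^esub> path_basis [j, i] \<ominus>\<^bsub>R\<^esub> path_basis [j, i] \<otimes>\<^bsub>R\<^esub> path_basis [i, j])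
      = relation_term p"
    using path_algebra_a_inv[OF finite_V F(2)] by (simp add: p a_minus_def relation_term_def)
qed

lemma relation_sum: "\<rho> = (\<Sum>p\<in>Q. relation_term p)"
proof -
  have "\<rho> = finsum R relation_term Q"
    unfolding preprojective_relation_def Let_def
  proof (rule R.finsum_cong'[OF refl])
    show "relation_term \<in> Q \<rightarrow> carrier R" using relation_term_closed by simp
  qed (rule relation_term_eq)
  then show ?thesis using path_algebra_finsum[OF finite_V finite_Q relation_term_closed] by simp
qed

lemma relation_closed: "\<rho> \<in> F"
proof -
  have "(\<Sum>x\<in>S. f x) \<in> F" if "\<And>x. x \<in> S \<Longrightarrow> f x \<in> F" for S :: "('v \<times> 'v) set" and f
    using that by (induction S rule: infinite_finite_induct) (auto intro: path_functions_add path_functions_zero)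
  then show ?thesis unfolding relation_sum using relation_term_closed by blast
qed

lemma relation_at_vertex:
  "end_at j (conv x \<rho>) = (\<Sum>k\<in>nbs j. then_arrow k j (if (j, k) \<in> Q then then_arrow j k x else - then_arrow j k x))"
proof -
  define g where "g k = then_arrow k j (then_arrow j k x)" for k
  have "conv x \<rho> = (\<Sum>(a, c)\<in>Q. then_arrow c a (then_arrow a c x) - then_arrow a c (then_arrow c a x))"
    unfolding relation_sum additive.sum[OF additive_conv] relation_term_def
    by (rule sum.cong) (auto simp: additive.diff[OF additive_conv] simp flip: conv_assoc conv_arrow)
  then have "end_at j (conv x \<rho>) = (\<Sum>(a, c)\<in>Q. (if a = j then g c else 0) - (if c = j then g a else 0))"
    unfolding g_def
    by (auto simp: additive.sum[OF additive_end_at] additive.diff[OF additive_end_at] end_at_then_arrow intro!: sum.cong)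
  also have "\<dots> = (\<Sum>(a, c)\<in>Q. if a = j then g c else 0) - (\<Sum>(a, c)\<in>Q. if c = j then g a else 0)"
    by (simp add: case_prod_unfold sum_subtractf)
  also have "(\<Sum>(a, c)\<in>Q. if a = j then g c else 0) = (\<Sum>(a, c)\<in>{j} \<times> {k. (j, k) \<in> Q}. g c)"
    by (rule sum.mono_neutral_cong_right[OF finite_Q]) (auto split: if_splits)
  also have "\<dots> = (\<Sum>k | (j, k) \<in> Q. g k)" by (simp add: sum.cartesian_product[symmetric])
  also have "(\<Sum>(a, c)\<in>Q. if c = j then g a else 0) = (\<Sum>(a, c)\<in>{k. (k, j) \<in> Q} \<times> {j}. g a)"
    by (rule sum.mono_neutral_cong_right[OF finite_Q]) (auto split: if_splits)
  also have "\<dots> = (\<Sum>k | (k, j) \<in> Q. g k)" by (simp add: sum.cartesian_product[symmetric])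
  also have "(\<Sum>k | (j, k) \<in> Q. g k) - (\<Sum>k | (k, j) \<in> Q. g k)
    = (\<Sum>k | (j, k) \<in> Q. if (j, k) \<in> Q then g k else - g k) + (\<Sum>k | (k, j) \<in> Q. if (j, k) \<in> Q then g k else - g k)"
  proof -
    have "(\<Sum>k | (j, k) \<in> Q. if (j, k) \<in> Q then g k else - g k) = (\<Sum>k | (j, k) \<in> Q. g k)"
      by (rule sum.cong) auto
    moreover have "(\<Sum>k | (k, j) \<in> Q. if (j, k) \<in> Q then g k else - g k) = (\<Sum>k | (k, j) \<in> Q. - g k)"
      by (rule sum.cong) (auto dest: Q_antisym)
    ultimately show ?thesis by (simp add: sum_negf)
  qed
  also have "\<dots> = (\<Sum>k\<in>nbs j. if (j, k) \<in> Q then g k else - g k)"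
  proof -
    have n: "nbs j = {k. (j, k) \<in> Q} \<union> {k. (k, j) \<in> Q}" by (auto simp: nbs_def edge_Q)
    show ?thesis unfolding n
      using finite_nbs[of j] n Q_antisym by (intro sum.union_disjoint[symmetric]) auto
  qed
  also have "\<dots> = (\<Sum>k\<in>nbs j. then_arrow k j (if (j, k) \<in> Q then then_arrow j k x else - then_arrow j k x))"
    by (rule sum.cong) (auto simp: g_def additive.minus[OF additive_then_arrow])
  finally show ?thesis .
qed

lemma ideal_J: "ideal J R"
  unfolding preprojective_ideal_def using relation_closed by (intro R.genideal_ideal) simp

sublocale J: ideal J R by (rule ideal_J)

lemma relation_in_J: "\<rho> \<in> J"
  unfolding preprojective_ideal_def using relation_closed by (intro R.genideal_self') simp

lemma J_subset: "x \<in> J \<Longrightarrow> x \<in> F" using J.Icarr by simp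

lemma J_conv_right: "x \<in> J \<Longrightarrow> g \<in> F \<Longrightarrow> conv x g \<in> J"
  and J_conv_left: "x \<in> J \<Longrightarrow> g \<in> F \<Longrightarrow> conv g x \<in> J"
  using J.I_r_closed[of x g] J.I_l_closed[of x g] by simp_all

lemma J_end_at: "x \<in> J \<Longrightarrow> end_at i x \<in> J"
  using J_conv_right[OF _ basis_vertex] end_at_outside[OF J_subset] J.zero_closed
  by (cases "i \<in> V") (simp_all add: conv_vertex)

lemma F_end_at: "x \<in> F \<Longrightarrow> end_at i x \<in> F"
  using conv_closed[OF _ basis_vertex] end_at_outside path_functions_zero
  by (cases "i \<in> V") (simp_all add: conv_vertex[symmetric])

lemma F_then_arrow: "x \<in> F \<Longrightarrow> {k, i} \<in> E \<Longrightarrow> then_arrow k i x \<in> F"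
  using conv_closed[OF _ basis_arrow] by (simp add: conv_arrow[symmetric])

lemma J_diff: "x \<in> J \<Longrightarrow> y \<in> J \<Longrightarrow> x - y \<in> J"
proof -
  assume xy: "x \<in> J" "y \<in> J"
  have "\<ominus>\<^bsub>R\<^esub> y \<in> J" using J.a_inv_closed[OF xy(2)] .
  then have "- y \<in> J" using path_algebra_a_inv[OF finite_V J_subset[OF xy(2)]] by simp
  then show "x - y \<in> J" using J.a_closed[OF xy(1)] by fastforce
qed

lemma nbs_edge: "k \<in> nbs i \<longleftrightarrow> {k, i} \<in> E"
  by (simp add: nbs_def insert_commute)

sublocale act: preprojective_action nbs "end_at :: 'v \<Rightarrow> ('v list \<Rightarrow> 'k) \<Rightarrow> _" then_arrow "\<lambda>i k. (i, k) \<in> Q" J F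
proof (unfold_locales, goal_cases)
  case (1 i) show ?case by (rule finite_nbs)
next
  case (2 i) show ?case by (rule not_nbs_self)
next
  case (3 j i) then show ?case using nbs_sym by simp
next
  case (4 i x y) show ?case by (rule end_at_add)
next
  case (5 k i x y) show ?case by (rule then_arrow_add)
next
  case (6 i x) show ?case by (simp add: end_at_end_at)
next
  case (7 i j x) then show ?case by (simp add: end_at_end_at)
next
  case (8 k i x) show ?case by (rule then_arrow_end_at)
next
  case (9 i k x) show ?case by (simp add: end_at_then_arrow)
next
  case 10 show ?case using J.zero_closed by simp
next
  case (11 x y) then show ?case by (rule J_diff)
next
  case (12 x i) then show ?case by (rule J_end_at)
next
  case (13 x i)
  then show ?case
    unfolding relation_at_vertex[symmetric] using J_conv_left[OF relation_in_J] J_end_at by blast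
qed

lemma submodule_F: "act.submodule F"
  unfolding act.submodule_def
proof (intro conjI ballI allI)
  show "J \<subseteq> F" using J_subset by blast
  show "x - y \<in> F" if "x \<in> F" "y \<in> F" for x y :: "'v list \<Rightarrow> 'k"
    using path_functions_add[OF that(1) path_functions_minus[OF that(2)]] by simp
qed (use F_end_at F_then_arrow in \<open>simp_all add: nbs_edge\<close>)

text \<open>The coefficient of the arrow from \<open>k\<close> to \<open>j\<close> when the paths in \<open>g\<close> are split off at their last arrow.\<close>

definition last_step :: "'v \<Rightarrow> 'v \<Rightarrow> ('v list \<Rightarrow> 'k) \<Rightarrow> 'v list \<Rightarrow> 'k" where
  "last_step k j g = (\<lambda>p. if p \<noteq> [] \<and> last p = k then g (p @ [j]) else 0)"

lemma last_step_closed: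
  assumes "g \<in> F" shows "last_step k j g \<in> F"
proof -
  have "{p. last_step k j g p \<noteq> 0} \<subseteq> butlast ` {p. g p \<noteq> 0}"
  proof
    fix p assume "p \<in> {p. last_step k j g p \<noteq> 0}"
    then have "g (p @ [j]) \<noteq> 0" by (auto simp: last_step_def split: if_splits)
    then show "p \<in> butlast ` {p. g p \<noteq> 0}" by (intro image_eqI[of _ _ "p @ [j]"]) auto
  qed
  then have "finite {p. last_step k j g p \<noteq> 0}"
    using assms by (auto simp: path_functions_def intro: finite_subset)
  moreover have "p \<in> paths V (double_quiver Q)" if "last_step k j g p \<noteq> 0" for p
  proof -
    have "p \<noteq> []" "g (p @ [j]) \<noteq> 0" using that by (auto simp: last_step_def split: if_splits)
    then have "p @ [j] \<in> paths V (double_quiver Q)" using assms by (auto simp: path_functions_def)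
    then show ?thesis using \<open>p \<noteq> []\<close> by (auto simp: paths_def successively_append_iff)
  qed
  ultimately show ?thesis by (auto simp: path_functions_def)
qed

lemma then_arrow_snoc: "then_arrow k j f (p @ [i]) = (if i = j \<and> p \<noteq> [] \<and> last p = k then f p else 0)"
  by (cases p) (auto simp: then_arrow_def)

lemma end_at_decompose:
  assumes g: "g \<in> F"
  shows "end_at j g = (\<lambda>p. g [j] * path_basis [j] p) + (\<Sum>k\<in>nbs j. then_arrow k j (last_step k j g))"
proof
  fix p
  have sum: "(\<Sum>k\<in>nbs j. h k) r = (\<Sum>k\<in>nbs j. h k r)" for h :: "'v \<Rightarrow> 'v list \<Rightarrow> 'k" and r
    using finite_nbs[of j] by induction auto
  show "end_at j g p = ((\<lambda>p. g [j] * path_basis [j] p) + (\<Sum>k\<in>nbs j. then_arrow k j (last_step k j g))) p"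
  proof (cases p rule: rev_cases)
    case Nil
    then show ?thesis by (simp add: end_at_def sum path_basis_def then_arrow_def)
  next
    case (snoc q i)
    show ?thesis
    proof (cases "q = []")
      case True
      then show ?thesis by (auto simp: snoc end_at_def sum path_basis_def then_arrow_def)
    next
      case False
      have "g (q @ [j]) = 0" if "last q \<notin> nbs j"
      proof (rule ccontr)
        assume "g (q @ [j]) \<noteq> 0"
        then have "q @ [j] \<in> paths V (double_quiver Q)" using g by (auto simp: path_functions_def)
        then have "(last q, j) \<in> double_quiver Q" using False by (auto simp: paths_def successively_append_iff)
        then show False using that by (simp add: arrow_iff nbs_edge)
      qed
      moreover have "(\<Sum>k\<in>nbs j. then_arrow k j (last_step k j g) p)
        = (\<Sum>k\<in>nbs j. if k = last q then if i = j then g (q @ [j]) else 0 else 0)"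
        by (rule sum.cong) (use False in \<open>auto simp: snoc then_arrow_snoc last_step_def\<close>)
      ultimately show ?thesis
        using False finite_nbs[of j] by (auto simp: snoc end_at_def sum path_basis_def)
    qed
  qed
qed

lemma scale_conv: "(\<lambda>p. c * conv f g p) = conv f (\<lambda>p. c * g p)"
  by (auto simp: conv_def sum_distrib_left mult.left_commute)

lemma end_at_conv:
  assumes g: "g \<in> F"
  shows "end_at j (conv x g) = (\<lambda>p. g [j] * end_at j x p) + (\<Sum>k\<in>nbs j. then_arrow k j (conv x (last_step k j g)))"
proof -
  have "end_at j (conv x g) = conv x (end_at j g)" by (simp only: conv_vertex[symmetric] conv_assoc)
  also have "\<dots> = conv x (\<lambda>p. g [j] * path_basis [j] p) + (\<Sum>k\<in>nbs j. conv x (then_arrow k j (last_step k j g)))"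
    unfolding end_at_decompose[OF g] by (simp only: conv_add_right additive.sum[OF additive_conv])
  also have "conv x (\<lambda>p. g [j] * path_basis [j] p) = (\<lambda>p. g [j] * end_at j x p)"
    unfolding scale_conv[symmetric] conv_vertex ..
  finally show ?thesis by (simp only: conv_arrow[symmetric] conv_assoc)
qed

end

section \<open>Exactness for the whole algebra\<close>

context preprojective
begin

lemma F_scale: "x \<in> F \<Longrightarrow> (\<lambda>p. c * x p) \<in> F"
  by (auto simp: path_functions_def intro: finite_subset[OF _ conjunct1])

lemma ideal_subsetI:
  assumes "T \<subseteq> F" "0 \<in> T" "\<And>x y. x \<in> T \<Longrightarrow> y \<in> T \<Longrightarrow> x - y \<in> T"
    and "\<And>x g. x \<in> T \<Longrightarrow> g \<in> F \<Longrightarrow> conv g x \<in> T" "\<And>x g. x \<in> T \<Longrightarrow> g \<in> F \<Longrightarrow> conv x g \<in> T"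
  shows "ideal T R"
proof (rule idealI)
  show "ring R" by (rule R.ring_axioms)
  have neg: "- x \<in> T" if "x \<in> T" for x using assms(3)[OF assms(2) that] by simp
  show "subgroup T (add_monoid R)"
  proof (rule R.add.subgroupI)
    show "T \<subseteq> carrier R" using assms(1) by simp
    show "T \<noteq> {}" using assms(2) by blast
    show "\<ominus>\<^bsub>R\<^esub> x \<in> T" if "x \<in> T" for x
      using neg[OF that] path_algebra_a_inv[OF finite_V, of x] that assms(1) by auto
    show "x \<oplus>\<^bsub>R\<^esub> y \<in> T" if "x \<in> T" "y \<in> T" for x y
      using assms(3)[OF that(1) neg[OF that(2)]] by simp
  qed
qed (use assms(4,5) in simp_all)

text \<open>Elements of the sum of the \<open>Ja\<close> over the arrows \<open>a\<close> ending in \<open>j\<close>, and of the left multiples of the part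
of the relation at \<open>j\<close>.\<close>

definition syzygy :: "'v \<Rightarrow> ('v list \<Rightarrow> 'k) \<Rightarrow> bool" where
  "syzygy j x \<longleftrightarrow> (\<exists>u z. (\<forall>k\<in>nbs j. u k \<in> J) \<and> z \<in> F \<and>
     x = (\<Sum>k\<in>nbs j. then_arrow k j (u k + act.signed_arrow j k z)))"

lemma additive_signed_arrow: "additive (act.signed_arrow j k)"
  by (auto simp: additive_def act.signed_arrow_def then_arrow_add)

lemma conv_signed_arrow: "conv g (act.signed_arrow j k z) = act.signed_arrow j k (conv g z)"
  by (simp add: act.signed_arrow_def additive.minus[OF additive_conv] conv_assoc flip: conv_arrow)

lemma syzygy_add: assumes "syzygy j x" "syzygy j y" shows "syzygy j (x + y)"
proof -
  obtain u z u' z' where h: "\<forall>k\<in>nbs j. u k \<in> J" "z \<in> F" "x = (\<Sum>k\<in>nbs j. then_arrow k j (u k + act.signed_arrow j k z))"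
    "\<forall>k\<in>nbs j. u' k \<in> J" "z' \<in> F" "y = (\<Sum>k\<in>nbs j. then_arrow k j (u' k + act.signed_arrow j k z'))"
    using assms by (auto simp: syzygy_def)
  have "x + y = (\<Sum>k\<in>nbs j. then_arrow k j ((u k + u' k) + act.signed_arrow j k (z + z')))"
    unfolding h(3,6) additive.add[OF additive_signed_arrow] sum.distrib[symmetric] then_arrow_add[symmetric]
    by (simp add: ac_simps)
  moreover have "\<forall>k\<in>nbs j. u k + u' k \<in> J" using h act.J_add by simp
  moreover have "z + z' \<in> F" by (rule path_functions_add[OF h(2,5)])
  ultimately show ?thesis unfolding syzygy_def
    by (intro exI[of _ "\<lambda>k. u k + u' k"] exI[of _ "z + z'"] conjI) simp_all
qed

lemma syzygy_conv: assumes "syzygy j x" "g \<in> F" shows "syzygy j (conv g x)"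
proof -
  obtain u z where h: "\<forall>k\<in>nbs j. u k \<in> J" "z \<in> F" "x = (\<Sum>k\<in>nbs j. then_arrow k j (u k + act.signed_arrow j k z))"
    using assms by (auto simp: syzygy_def)
  have "conv g x = (\<Sum>k\<in>nbs j. then_arrow k j (conv g (u k) + act.signed_arrow j k (conv g z)))"
    unfolding h(3) additive.sum[OF additive_conv]
    by (simp only: conv_arrow[symmetric] conv_assoc[symmetric] conv_add_right[symmetric] conv_signed_arrow[symmetric])
  then show ?thesis
    unfolding syzygy_def using h(1,2) J_conv_left assms(2) conv_closed
    by (intro exI[of _ "\<lambda>k. conv g (u k)"] exI[of _ "conv g z"] conjI) simp_all
qed

lemma syzygy_J: assumes "\<And>k. k \<in> nbs j \<Longrightarrow> u k \<in> J" shows "syzygy j (\<Sum>k\<in>nbs j. then_arrow k j (u k))"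
  unfolding syzygy_def using assms additive.zero[OF additive_signed_arrow] path_functions_zero
  by (intro exI[of _ u] exI[of _ 0]) simp

lemma conv_scaled_unit: "x \<in> F \<Longrightarrow> conv (\<lambda>p. c * unit_path p) x = (\<lambda>p. c * x p)"
proof -
  assume x: "x \<in> F"
  have "conv (\<lambda>p. c * unit_path p) x = (\<lambda>p. c * conv unit_path x p)"
    by (auto simp: conv_def sum_distrib_left mult.assoc fun_eq_iff simp del: if_split)
  then show ?thesis using one_conv[OF x] by simp
qed

text \<open>The elements with this property form a two-sided ideal that contains the relation: multiplying on the
right with a path either does nothing or ends with an arrow, and what precedes this arrow remains in
\<open>J\<close>.\<close>

lemma J_syzygy: assumes x: "x \<in> J" shows "syzygy j (end_at j x)"
proof -
  define T where "T = {x \<in> J. \<forall>j. syzygy j (end_at j x)}"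
  have u: "unit_path \<in> F" using R.one_closed by simp
  have left: "conv g x \<in> T" if "x \<in> T" "g \<in> F" for x g
  proof -
    have "end_at j (conv g x) = conv g (end_at j x)" for j by (simp only: conv_vertex[symmetric] conv_assoc)
    then show ?thesis using that J_conv_left syzygy_conv by (simp add: T_def)
  qed
  have scale: "syzygy j (\<lambda>p. c * end_at j x p)" if "x \<in> T" for x j c
  proof -
    have x: "end_at j x \<in> F" "syzygy j (end_at j x)" using that F_end_at[OF J_subset] by (auto simp: T_def)
    have "syzygy j (conv (\<lambda>p. c * unit_path p) (end_at j x))" by (rule syzygy_conv[OF x(2) F_scale[OF u]])
    then show ?thesis unfolding conv_scaled_unit[OF x(1)] .
  qed
  have "ideal T R"
  proof (rule ideal_subsetI)
    show "T \<subseteq> F" using J_subset by (auto simp: T_def)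
    show "0 \<in> T" using syzygy_J[of _ "\<lambda>_. 0"] act.J_zero by (simp add: T_def)
    show "conv g x \<in> T" if "x \<in> T" "g \<in> F" for x g by (rule left[OF that])
    show "x - y \<in> T" if "x \<in> T" "y \<in> T" for x y
    proof -
      have "x - y \<in> J" using that J_diff by (simp add: T_def)
      moreover have "syzygy j (end_at j (x - y))" for j
      proof -
        have "syzygy j (end_at j x)" using that(1) by (simp add: T_def)
        then have "syzygy j (end_at j x + (\<lambda>p. (- 1) * end_at j y p))"
          by (rule syzygy_add[OF _ scale[OF that(2)]])
        moreover have "end_at j x + (\<lambda>p. (- 1) * end_at j y p) = end_at j (x - y)"
          by (auto simp: end_at_def fun_eq_iff)
        ultimately show ?thesis by simp
      qed
      ultimately show ?thesis by (simp add: T_def)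
    qed
    show "conv x g \<in> T" if xg: "x \<in> T" "g \<in> F" for x g
    proof -
      have x: "x \<in> J" using xg(1) by (simp add: T_def)
      have "syzygy j (end_at j (conv x g))" for j
        unfolding end_at_conv[OF xg(2)]
        by (intro syzygy_add scale[OF xg(1)] syzygy_J J_conv_right[OF x] last_step_closed xg(2))
      then show ?thesis using J_conv_right[OF x xg(2)] by (simp add: T_def)
    qed
  qed
  moreover have "\<rho> \<in> T"
  proof -
    have "syzygy j (end_at j \<rho>)" for j
    proof -
      have "end_at j \<rho> = end_at j (conv unit_path \<rho>)" using one_conv[OF relation_closed] by simp
      also have "\<dots> = (\<Sum>k\<in>nbs j. then_arrow k j (0 + act.signed_arrow j k unit_path))"
        unfolding relation_at_vertex by (simp only: act.signed_arrow_def add_0)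
      finally show ?thesis unfolding syzygy_def using u act.J_zero
        by (intro exI[of _ "\<lambda>_. 0"] exI[of _ unit_path] conjI) simp_all
    qed
    then show ?thesis using relation_in_J by (simp add: T_def)
  qed
  ultimately have "J \<subseteq> T" unfolding preprojective_ideal_def by (intro R.genideal_minimal) simp_all
  then show ?thesis using x by (auto simp: T_def)
qed

lemma then_arrows_independent:
  fixes h :: "'v \<Rightarrow> 'v list \<Rightarrow> 'k"
  assumes "(\<Sum>k\<in>nbs j. then_arrow k j (h k)) = 0" "k \<in> nbs j"
  shows "end_at k (h k) = 0"
proof
  fix p
  have "end_at k (h k) p = 0" if p: "p \<noteq> []" "last p = k"
  proof -
    have apply_sum: "(\<Sum>l\<in>S. g l) r = (\<Sum>l\<in>S. g l r)" if "finite S" for g :: "'v \<Rightarrow> 'v list \<Rightarrow> 'k" and r S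
      using that by induction auto
    have "(\<Sum>l\<in>nbs j. then_arrow l j (h l)) (p @ [j]) = (\<Sum>l\<in>nbs j. then_arrow l j (h l) (p @ [j]))"
      by (rule apply_sum[OF finite_nbs])
    also have "\<dots> = (\<Sum>l\<in>nbs j. if l = k then h k p else 0)"
      by (rule sum.cong) (use p in \<open>auto simp: then_arrow_snoc\<close>)
    finally have "(\<Sum>l\<in>nbs j. if l = k then h k p else 0) = (0 :: 'v list \<Rightarrow> 'k) (p @ [j])" using assms(1) by simp
    then have "h k p = 0" using assms finite_nbs[of j] by simp
    then show ?thesis by (simp add: end_at_def)
  qed
  then show "end_at k (h k) p = 0 p" by (auto simp: end_at_def)
qed

text \<open>Compare the given sum, an element of \<open>J\<close>, with its form from \<open>J_syzygy\<close>. In the path algebra the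
products with different arrows are independent, so the comparison can be made for each arrow
separately.\<close>

lemma exact_F: "act.exact F j"
  unfolding act.exact_def
proof (intro allI impI)
  fix y assume y: "\<forall>k\<in>nbs j. y k \<in> F" "(\<Sum>k\<in>nbs j. then_arrow k j (y k)) \<in> J"
  have e: "end_at j (\<Sum>k\<in>nbs j. then_arrow k j (y k)) = (\<Sum>k\<in>nbs j. then_arrow k j (y k))"
    by (simp add: additive.sum[OF additive_end_at] end_at_then_arrow)
  obtain u z where h: "\<forall>k\<in>nbs j. u k \<in> J" "z \<in> F"
    "(\<Sum>k\<in>nbs j. then_arrow k j (y k)) = (\<Sum>k\<in>nbs j. then_arrow k j (u k + act.signed_arrow j k z))"
    using J_syzygy[OF y(2), of j] unfolding e syzygy_def by blast
  have "(\<Sum>k\<in>nbs j. then_arrow k j (y k - (u k + act.signed_arrow j k z))) = 0"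
    unfolding additive.diff[OF additive_then_arrow] sum_subtractf using h(3) by simp
  then have 0: "end_at k (y k - (u k + act.signed_arrow j k z)) = 0" if "k \<in> nbs j" for k
    using then_arrows_independent[of j "\<lambda>k. y k - (u k + act.signed_arrow j k z)"] that by blast
  have "end_at k (y k) - act.signed_arrow j k z \<in> J" if k: "k \<in> nbs j" for k
  proof -
    have "end_at k (act.signed_arrow j k z) = act.signed_arrow j k z"
      by (simp add: act.signed_arrow_def end_at_then_arrow additive.minus[OF additive_end_at])
    then have "end_at k (y k) - (end_at k (u k) + act.signed_arrow j k z) = 0"
      using 0[OF k] by (simp only: additive.diff[OF additive_end_at] end_at_add)
    then have "end_at k (y k) - act.signed_arrow j k z = end_at k (u k)"
      by (metis add_diff_cancel_right' eq_iff_diff_eq_0)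
    then show ?thesis using J_end_at h(1) k by simp
  qed
  then show "\<exists>z\<in>F. \<forall>k\<in>nbs j. end_at k (y k) - act.signed_arrow j k z \<in> J" using h(2) by blast
qed

end

section \<open>Ideals of the preprojective algebra and their preimages\<close>

context preprojective
begin

abbreviation P :: "('v list \<Rightarrow> 'k) set ring" where "P \<equiv> preprojective_algebra V Q"
abbreviation \<pi> :: "('v list \<Rightarrow> 'k) \<Rightarrow> ('v list \<Rightarrow> 'k) set" where "\<pi> x \<equiv> J +>\<^bsub>R\<^esub> x"

lemma P_def: "P = R Quot J" by (simp add: preprojective_algebra_def)

sublocale P: ring P unfolding P_def by (rule J.quotient_is_ring)

lemma proj_hom: "\<pi> \<in> ring_hom R P" unfolding P_def by (rule J.rcos_ring_hom)

lemma proj_closed: "x \<in> F \<Longrightarrow> \<pi> x \<in> carrier P"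
  and proj_add: "x \<in> F \<Longrightarrow> y \<in> F \<Longrightarrow> \<pi> (x + y) = \<pi> x \<oplus>\<^bsub>P\<^esub> \<pi> y"
  and proj_conv: "x \<in> F \<Longrightarrow> y \<in> F \<Longrightarrow> \<pi> (conv x y) = \<pi> x \<otimes>\<^bsub>P\<^esub> \<pi> y"
  and proj_one: "\<pi> unit_path = \<one>\<^bsub>P\<^esub>"
  using ring_hom_closed[OF proj_hom, of x] ring_hom_add[OF proj_hom, of x y] ring_hom_mult[OF proj_hom, of x y]
    ring_hom_one[OF proj_hom] by simp_all

lemma proj_eq_iff: "x \<in> F \<Longrightarrow> y \<in> F \<Longrightarrow> \<pi> x = \<pi> y \<longleftrightarrow> x - y \<in> J"
  using R.quotient_eq_iff_same_a_r_cos[OF ideal_J, of x y] path_algebra_a_inv[OF finite_V, of y]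
  by (simp add: a_minus_def)

lemma proj_surj: "c \<in> carrier P \<Longrightarrow> \<exists>x\<in>F. c = \<pi> x"
  by (auto simp: P_def FactRing_def A_RCOSETS_def')

lemma F_diff: "x \<in> F \<Longrightarrow> y \<in> F \<Longrightarrow> x - y \<in> F"
  using act.M_diff[OF submodule_F] .

lemma proj_diff: assumes "x \<in> F" "y \<in> F" shows "\<pi> (x - y) = \<pi> x \<ominus>\<^bsub>P\<^esub> \<pi> y"
proof -
  have "\<pi> x = \<pi> (x - y) \<oplus>\<^bsub>P\<^esub> \<pi> y" using proj_add[OF F_diff[OF assms] assms(2)] by simp
  then show ?thesis
    using P.add.inv_solve_right'[OF proj_closed[OF F_diff[OF assms]] proj_closed[OF assms(1)] proj_closed[OF assms(2)]]
    unfolding a_minus_def by metis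
qed

definition lift :: "('v list \<Rightarrow> 'k) set set \<Rightarrow> ('v list \<Rightarrow> 'k) set" where
  "lift M = {x \<in> F. \<pi> x \<in> M}"

lemma lift_image: assumes "M \<subseteq> carrier P" shows "M = \<pi> ` lift M"
proof
  show "M \<subseteq> \<pi> ` lift M"
  proof
    fix c assume c: "c \<in> M"
    then obtain x where x: "x \<in> F" "c = \<pi> x" using proj_surj[of c] assms by blast
    then have "x \<in> lift M" using c by (simp add: lift_def)
    then show "c \<in> \<pi> ` lift M" unfolding x(2) by (rule imageI)
  qed
  show "\<pi> ` lift M \<subseteq> M" by (auto simp: lift_def)
qed

lemma lift_carrier: "lift (carrier P) = F"
proof (rule Set.set_eqI)
  fix x show "x \<in> lift (carrier P) \<longleftrightarrow> x \<in> F" using proj_closed[of x] by (auto simp: lift_def)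
qed

context
  fixes M assumes M: "ideal M P"
begin

interpretation M: ideal M P by (rule M)

lemma lift_zero: "0 \<in> lift M"
proof -
  have "\<pi> 0 \<oplus>\<^bsub>P\<^esub> \<pi> 0 = \<pi> 0" using proj_add[OF path_functions_zero path_functions_zero] by simp
  then have "\<pi> 0 = \<zero>\<^bsub>P\<^esub>" using P.add.l_cancel_one'[of "\<pi> 0" "\<pi> 0"] proj_closed[OF path_functions_zero] by simp
  then show ?thesis using M.zero_closed path_functions_zero by (simp add: lift_def)
qed

lemma lift_diff: "x \<in> lift M \<Longrightarrow> y \<in> lift M \<Longrightarrow> x - y \<in> lift M"
  using F_diff[of x y] proj_diff[of x y] M.a_closed[of "\<pi> x" "\<ominus>\<^bsub>P\<^esub> \<pi> y"] M.a_inv_closed[of "\<pi> y"]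
  by (simp add: lift_def a_minus_def)

lemma lift_conv: "x \<in> lift M \<Longrightarrow> g \<in> F \<Longrightarrow> conv x g \<in> lift M" "x \<in> lift M \<Longrightarrow> g \<in> F \<Longrightarrow> conv g x \<in> lift M"
  using conv_closed[of x V "double_quiver Q" g] conv_closed[of g V "double_quiver Q" x]
    proj_conv[of x g] proj_conv[of g x] M.I_r_closed[of "\<pi> x" "\<pi> g"] M.I_l_closed[of "\<pi> x" "\<pi> g"] proj_closed[of g]
  by (simp_all add: lift_def)

lemma submodule_lift: "act.submodule (lift M)"
  unfolding act.submodule_def
proof (intro conjI ballI allI)
  show "J \<subseteq> lift M"
  proof
    fix x assume x: "x \<in> J"
    then have "\<pi> x = \<pi> 0" using proj_eq_iff[OF J_subset path_functions_zero] by simp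
    then show "x \<in> lift M" using lift_zero J_subset[OF x] by (simp add: lift_def)
  qed
  show "lift M \<subseteq> F" by (auto simp: lift_def)
  show "x - y \<in> lift M" if "x \<in> lift M" "y \<in> lift M" for x y by (rule lift_diff[OF that])
  show "end_at i x \<in> lift M" if x: "x \<in> lift M" for x i
  proof (cases "i \<in> V")
    case True
    then show ?thesis using lift_conv(1)[OF x basis_vertex] by (simp add: conv_vertex)
  next
    case False
    then show ?thesis using end_at_outside[of x i] x lift_zero by (simp add: lift_def)
  qed
  show "then_arrow k i x \<in> lift M" if "x \<in> lift M" "k \<in> nbs i" for x i k
    using lift_conv(1)[OF that(1) basis_arrow] that(2) by (simp add: conv_arrow nbs_edge)
qed

end

abbreviation I :: "'v \<Rightarrow> ('v list \<Rightarrow> 'k) set set" where "I \<equiv> vertex_ideal V Q"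

lemma off_vertex_closed: "j \<in> V \<Longrightarrow> unit_path - path_basis [j] \<in> F"
  using F_diff[OF _ basis_vertex] R.one_closed by simp

lemma vertex_ideal_genideal: assumes "j \<in> V" shows "I j = Idl\<^bsub>P\<^esub> {\<pi> (unit_path - path_basis [j])}"
proof -
  have "unit_path \<in> F" using R.one_closed by simp
  then have "\<pi> (unit_path - path_basis [j]) = \<one>\<^bsub>P\<^esub> \<ominus>\<^bsub>P\<^esub> vertex_idempotent V Q j"
    using proj_diff[OF _ basis_vertex[OF assms]] proj_one by (simp add: vertex_idempotent_def)
  then show ?thesis by (simp add: vertex_ideal_def Let_def)
qed

lemma ideal_I: "j \<in> V \<Longrightarrow> ideal (I j) P"
  unfolding vertex_ideal_genideal using proj_closed[OF off_vertex_closed] by (intro P.genideal_ideal) simp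

lemma span_conv_left:
  assumes "x \<in> act.arrow_span N j S" "g \<in> F" "\<And>y. y \<in> N \<Longrightarrow> conv g y \<in> N'"
  shows "conv g x \<in> act.arrow_span N' j S"
proof -
  obtain y where y: "\<forall>k\<in>S. y k \<in> N" "x - (\<Sum>k\<in>S. then_arrow k j (y k)) \<in> J"
    using assms(1) by (auto simp: act.arrow_span_def)
  have "conv g x - (\<Sum>k\<in>S. then_arrow k j (conv g (y k))) = conv g (x - (\<Sum>k\<in>S. then_arrow k j (y k)))"
    by (simp only: additive.diff[OF additive_conv] additive.sum[OF additive_conv] conv_arrow[symmetric] conv_assoc)
  then have "conv g x - (\<Sum>k\<in>S. then_arrow k j (conv g (y k))) \<in> J"
    using J_conv_left[OF y(2) assms(2)] by (simp only:)
  then show ?thesis unfolding act.arrow_span_def using y(1) assms(3)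
    by (intro CollectI exI[of _ "\<lambda>k. conv g (y k)"] conjI) simp_all
qed

lemma end_at_conv_left: "end_at j (conv g x) = conv g (end_at j x)"
  by (simp only: conv_vertex[symmetric] conv_assoc)

text \<open>It suffices that the right hand side is a two-sided ideal that contains \<open>1 - e\<^sub>j\<close>.\<close>

lemma I_subset: assumes j: "j \<in> V" shows "lift (I j) \<subseteq> act.red j F"
proof -
  have sub: "act.submodule (act.red j F)" by (rule act.submodule_red[OF submodule_F])
  have T: "ideal (act.red j F) R"
  proof (rule ideal_subsetI)
    show "act.red j F \<subseteq> F" by (rule act.red_subset)
    show "0 \<in> act.red j F" by (rule act.M_zero[OF sub])
    show "x - y \<in> act.red j F" if "x \<in> act.red j F" "y \<in> act.red j F" for x y by (rule act.M_diff[OF sub that])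
    show "conv g x \<in> act.red j F" if "x \<in> act.red j F" "g \<in> F" for x g
      using that conv_closed[OF that(2)] span_conv_left[of "end_at j x" F j "nbs j" g F]
      by (simp add: act.red_def end_at_conv_left)
    show "conv x g \<in> act.red j F" if x: "x \<in> act.red j F" and g: "g \<in> F" for x g
    proof -
      have xF: "x \<in> F" and "end_at j x \<in> act.arrow_span F j (nbs j)" using x by (simp_all add: act.red_def)
      then have "conv (\<lambda>p. g [j] * unit_path p) (end_at j x) \<in> act.arrow_span F j (nbs j)"
        using R.one_closed by (intro span_conv_left[where N = F] F_scale conv_closed) simp_all
      then have 1: "(\<lambda>p. g [j] * end_at j x p) \<in> act.arrow_span F j (nbs j)"
        unfolding conv_scaled_unit[OF F_end_at[OF xF]] .
      have 2: "(\<Sum>k\<in>nbs j. then_arrow k j (conv x (last_step k j g))) \<in> act.arrow_span F j (nbs j)"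
        unfolding act.arrow_span_def using conv_closed[OF xF last_step_closed[OF g]] act.J_zero
        by (intro CollectI exI[of _ "\<lambda>k. conv x (last_step k j g)"]) simp
      have "end_at j (conv x g) \<in> act.arrow_span F j (nbs j)"
        unfolding end_at_conv[OF g] by (rule act.span_add[OF submodule_F 1 2])
      then show ?thesis using conv_closed[OF xF g] by (simp add: act.red_def)
    qed
  qed
  have "end_at j (unit_path - path_basis [j]) = 0"
    using j by (auto simp: end_at_def path_basis_def fun_eq_iff)
  then have "unit_path - path_basis [j] \<in> act.red j F"
    using off_vertex_closed[OF j] act.span_J[OF submodule_F act.J_zero] by (simp add: act.red_def)
  then have gen: "{\<pi> (unit_path - path_basis [j])} \<subseteq> \<pi> ` act.red j F" by blast
  have "ideal (\<pi> ` act.red j F) P" unfolding P_def by (rule R.ring_ideal_imp_quot_ideal[OF ideal_J T])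
  then have "I j \<subseteq> \<pi> ` act.red j F" unfolding vertex_ideal_genideal[OF j] by (rule P.genideal_minimal[OF _ gen])
  show ?thesis
  proof
    fix x assume "x \<in> lift (I j)"
    then obtain y where y: "x \<in> F" "y \<in> act.red j F" "\<pi> x = \<pi> y" using \<open>I j \<subseteq> _\<close> by (auto simp: lift_def)
    then have "x - y \<in> J" using proj_eq_iff[of x y] act.red_subset by blast
    then show "x \<in> act.red j F" using act.M_cong[OF sub y(2)] by blast
  qed
qed

text \<open>An arrow \<open>a\<close> that ends in \<open>j\<close> satisfies \<open>a = (1 - e\<^sub>j)a\<close> because it starts elsewhere, so it lies in the
vertex ideal. Conversely every element of the vertex ideal ends, at \<open>j\<close>, with an arrow.\<close>

theorem lift_ideal_prod:
  assumes M: "ideal M P" and j: "j \<in> V"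
  shows "lift (ideal_prod P M (I j)) = act.red j (lift M)"
proof
  have subM: "act.submodule (lift M)" by (rule submodule_lift[OF M])
  have sub: "act.submodule (act.red j (lift M))" by (rule act.submodule_red[OF subM])
  have prod: "ideal (ideal_prod P M (I j)) P" by (rule P.ideal_prod_is_ideal[OF M ideal_I[OF j]])
  have subP: "act.submodule (lift (ideal_prod P M (I j)))" by (rule submodule_lift[OF prod])
  have ex: "\<exists>y\<in>act.red j (lift M). c = \<pi> y" if "c \<in> ideal_prod P M (I j)" for c
    using that
  proof (induction rule: ideal_prod.induct)
    case (prod m q)
    obtain m' where m': "m' \<in> F" "m = \<pi> m'" using proj_surj ideal.Icarr[OF M prod(1)] by blast
    obtain q' where q': "q' \<in> F" "q = \<pi> q'" using proj_surj ideal.Icarr[OF ideal_I[OF j] prod(2)] by blast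
    have m: "m' \<in> lift M" using m' prod(1) by (simp add: lift_def)
    have "q' \<in> lift (I j)" using q' prod(2) by (simp add: lift_def)
    then have "end_at j q' \<in> act.arrow_span F j (nbs j)" using I_subset[OF j] by (auto simp: act.red_def)
    then have "conv m' (end_at j q') \<in> act.arrow_span (lift M) j (nbs j)"
      by (rule span_conv_left[OF _ m'(1)]) (rule lift_conv(1)[OF M m])
    then have "conv m' q' \<in> act.red j (lift M)"
      using lift_conv(1)[OF M m q'(1)] by (simp add: act.red_def end_at_conv_left)
    then show ?case using proj_conv[OF m'(1) q'(1)] m' q' by (intro bexI[of _ "conv m' q'"]) simp_all
  next
    case (sum c d)
    then obtain x y where xy: "x \<in> act.red j (lift M)" "c = \<pi> x" "y \<in> act.red j (lift M)" "d = \<pi> y" by blast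
    have "c \<oplus>\<^bsub>P\<^esub> d = \<pi> (x + y)"
      unfolding xy(2,4) by (rule proj_add[OF act.M_F[OF sub xy(1)] act.M_F[OF sub xy(3)], symmetric])
    then show ?case by (rule bexI[OF _ act.M_add[OF sub xy(1,3)]])
  qed
  show "lift (ideal_prod P M (I j)) \<subseteq> act.red j (lift M)"
  proof
    fix x assume "x \<in> lift (ideal_prod P M (I j))"
    then have x: "x \<in> F" "\<pi> x \<in> ideal_prod P M (I j)" by (simp_all add: lift_def)
    obtain y where y: "y \<in> act.red j (lift M)" "\<pi> x = \<pi> y" using ex[OF x(2)] by (elim bexE)
    have "x - y \<in> J" by (rule iffD1[OF proj_eq_iff[OF x(1) act.M_F[OF sub y(1)]] y(2)])
    then show "x \<in> act.red j (lift M)" by (rule act.M_cong[OF sub y(1)])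
  qed
  have I1: "\<pi> (unit_path - path_basis [j]) \<in> I j"
    unfolding vertex_ideal_genideal[OF j] by (rule P.genideal_self'[OF proj_closed[OF off_vertex_closed[OF j]]])
  have product: "conv x c \<in> lift (ideal_prod P M (I j))" if "x \<in> lift M" "c \<in> F" "\<pi> c \<in> I j" for x c
  proof -
    have "x \<in> F" "\<pi> x \<in> M" using that(1) by (simp_all add: lift_def)
    then show ?thesis
      using ideal_prod.prod[of "\<pi> x" M "\<pi> c" "I j" P] that proj_conv conv_closed by (simp add: lift_def)
  qed
  show "act.red j (lift M) \<subseteq> lift (ideal_prod P M (I j))"
  proof
    fix x assume x: "x \<in> act.red j (lift M)"
    then have xM: "x \<in> lift M" and xF: "x \<in> F" by (simp_all add: act.red_def lift_def)
    obtain y where y: "\<forall>k\<in>nbs j. y k \<in> lift M" "end_at j x - (\<Sum>k\<in>nbs j. then_arrow k j (y k)) \<in> J"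
      using x by (auto simp: act.red_def act.arrow_span_def)
    have "conv x (unit_path - path_basis [j]) = x - end_at j x"
      by (simp add: additive.diff[OF additive_conv] conv_one[OF xF] conv_vertex)
    then have 1: "x - end_at j x \<in> lift (ideal_prod P M (I j))"
      using product[OF xM off_vertex_closed[OF j] I1] by simp
    have 2: "then_arrow k j (y k) \<in> lift (ideal_prod P M (I j))" if k: "k \<in> nbs j" for k
    proof -
      have kj: "{k, j} \<in> E" "k \<noteq> j" using k edge_verts by (auto simp: nbs_edge)
      have "conv (path_basis [j]) (path_basis [k, j]) = (0 :: 'v list \<Rightarrow> 'k)"
        unfolding conv_arrow using kj(2) by (auto simp: then_arrow_def path_basis_def fun_eq_iff)
      then have "path_basis [k, j] = conv (unit_path - path_basis [j]) (path_basis [k, j])"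
        using one_conv[OF basis_arrow[OF kj(1)]] by (simp add: additive.diff[OF additive_conv_left])
      then have "\<pi> (path_basis [k, j]) \<in> I j"
        using proj_conv[OF off_vertex_closed[OF j] basis_arrow[OF kj(1)]]
          ideal.I_r_closed[OF ideal_I[OF j] I1 proj_closed[OF basis_arrow[OF kj(1)]]] by simp
      then show ?thesis using product[OF _ basis_arrow[OF kj(1)]] y(1) k by (simp add: conv_arrow)
    qed
    have "end_at j x \<in> lift (ideal_prod P M (I j))"
      by (rule act.M_cong[OF subP act.M_sum[OF subP 2] y(2)])
    then have "(x - end_at j x) + end_at j x \<in> lift (ideal_prod P M (I j))"
      by (rule act.M_add[OF subP 1])
    then show "x \<in> lift (ideal_prod P M (I j))" by simp
  qed
qed

end

section \<open>Isomorphisms of quotients of left ideals\<close>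

lemma (in ring) coset_smult:
  assumes N: "ideal N R" and c: "c \<in> carrier R" and x: "x \<in> carrier R"
  shows "(\<Union>z\<in>N +> x. N +> (c \<otimes> z)) = N +> (c \<otimes> x)"
proof -
  interpret N: ideal N R by (rule N)
  have "N +> (c \<otimes> z) = N +> (c \<otimes> x)" if zx: "z \<in> N +> x" for z
  proof -
    obtain m where m: "m \<in> N" "z = m \<oplus> x" using zx by (auto simp: a_r_coset_def')
    have mc: "m \<in> carrier R" using m(1) by (rule N.Icarr)
    have "c \<otimes> z \<ominus> c \<otimes> x = c \<otimes> m" unfolding m(2) using c x mc by algebra
    then have "c \<otimes> z \<ominus> c \<otimes> x \<in> N" using N.I_l_closed[OF m(1) c] by simp
    then show ?thesis
      using quotient_eq_iff_same_a_r_cos[OF N, of "c \<otimes> z" "c \<otimes> x"] c x mc m(2) by simp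
  qed
  moreover have "x \<in> N +> x" by (rule N.a_rcos_self[OF x])
  ultimately show ?thesis by blast
qed

lemma (in ring) quotient_module_simps:
  assumes M: "ideal M R" and N: "ideal N R"
  shows "carrier (quotient_module R M N) = (+>) N ` M"
    and "x \<in> M \<Longrightarrow> y \<in> M \<Longrightarrow> (N +> x) \<oplus>\<^bsub>quotient_module R M N\<^esub> (N +> y) = N +> (x \<oplus> y)"
    and "c \<in> carrier R \<Longrightarrow> x \<in> M \<Longrightarrow> c \<odot>\<^bsub>quotient_module R M N\<^esub> (N +> x) = N +> (c \<otimes> x)"
  using ideal.a_rcos_sum[OF N, of x y] coset_smult[OF N, of c x] ideal.Icarr[OF M]
  by (simp_all add: quotient_module_def)

text \<open>The isomorphism is right multiplication by \<open>r\<close>.\<close>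

lemma (in ring) quotient_module_iso:
  assumes M: "ideal M R" and M': "ideal M' R" and N: "ideal N R" and N': "ideal N' R"
    and r: "r \<in> carrier R"
    and into: "\<And>x. x \<in> M \<Longrightarrow> x \<otimes> r \<in> N"
    and kernel: "\<And>x. x \<in> M \<Longrightarrow> x \<otimes> r \<in> N' \<longleftrightarrow> x \<in> M'"
    and onto: "\<And>y. y \<in> N \<Longrightarrow> \<exists>x\<in>M. y \<ominus> x \<otimes> r \<in> N'"
  shows "left_module_isomorphic R (quotient_module R M M') (quotient_module R N N')"
proof -
  interpret M: ideal M R by (rule M)
  interpret N: ideal N R by (rule N)
  note eqM = quotient_eq_iff_same_a_r_cos[OF M'] and eqN = quotient_eq_iff_same_a_r_cos[OF N']
  have diffM: "x \<ominus> y \<in> M" if "x \<in> M" "y \<in> M" for x y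
    unfolding a_minus_def using that M.a_closed M.a_inv_closed by simp
  have diffr: "(x \<ominus> y) \<otimes> r = x \<otimes> r \<ominus> y \<otimes> r" if "x \<in> M" "y \<in> M" for x y
    using M.Icarr[OF that(1)] M.Icarr[OF that(2)] r by algebra
  have same: "M' +> x = M' +> y \<longleftrightarrow> N' +> x \<otimes> r = N' +> y \<otimes> r" if xy: "x \<in> M" "y \<in> M" for x y
  proof -
    have "M' +> x = M' +> y \<longleftrightarrow> x \<ominus> y \<in> M'" using eqM[of x y] xy M.Icarr by simp
    also have "\<dots> \<longleftrightarrow> (x \<ominus> y) \<otimes> r \<in> N'" using kernel[OF diffM[OF xy]] by simp
    also have "\<dots> \<longleftrightarrow> x \<otimes> r \<ominus> y \<otimes> r \<in> N'" unfolding diffr[OF xy] ..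
    also have "\<dots> \<longleftrightarrow> N' +> x \<otimes> r = N' +> y \<otimes> r" using eqN[of "x \<otimes> r" "y \<otimes> r"] xy M.Icarr r by simp
    finally show ?thesis .
  qed
  define f where "f C = N' +> (SOME x. x \<in> M \<and> C = M' +> x) \<otimes> r" for C
  have f: "f (M' +> x) = N' +> x \<otimes> r" if x: "x \<in> M" for x
  proof -
    let ?y = "SOME y. y \<in> M \<and> M' +> x = M' +> y"
    have "?y \<in> M \<and> M' +> x = M' +> ?y" by (rule someI[of _ x]) (use x in simp)
    then show ?thesis unfolding f_def using same[OF x, of ?y] by metis
  qed
  note simpM = quotient_module_simps[OF M M'] and simpN = quotient_module_simps[OF N N']
  show ?thesis
    unfolding left_module_isomorphic_def
  proof (intro exI[of _ f] conjI ballI)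
    show "bij_betw f (carrier (quotient_module R M M')) (carrier (quotient_module R N N'))"
      unfolding simpM(1) simpN(1) bij_betw_def
    proof
      show "inj_on f ((+>) M' ` M)"
      proof (rule inj_onI)
        fix C D assume "C \<in> (+>) M' ` M" "D \<in> (+>) M' ` M" and fCD: "f C = f D"
        then obtain x y where xy: "x \<in> M" "C = M' +> x" "y \<in> M" "D = M' +> y" by blast
        then show "C = D" using fCD same[OF xy(1,3)] f by simp
      qed
      show "f ` (+>) M' ` M = (+>) N' ` N"
      proof
        show "f ` (+>) M' ` M \<subseteq> (+>) N' ` N" using f into by auto
        show "(+>) N' ` N \<subseteq> f ` (+>) M' ` M"
        proof
          fix C assume "C \<in> (+>) N' ` N"
          then obtain y where y: "y \<in> N" "C = N' +> y" by blast
          obtain x where x: "x \<in> M" "y \<ominus> x \<otimes> r \<in> N'" using onto[OF y(1)] by blast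
          have "C = N' +> x \<otimes> r" using eqN[of y "x \<otimes> r"] x y M.Icarr N.Icarr r by simp
          then have "C = f (M' +> x)" using f[OF x(1)] by simp
          then show "C \<in> f ` (+>) M' ` M" using x(1) by blast
        qed
      qed
    qed
    fix C assume C: "C \<in> carrier (quotient_module R M M')"
    then obtain x where x: "x \<in> M" "C = M' +> x" unfolding simpM(1) by blast
    have xc: "x \<in> carrier R" by (rule M.Icarr[OF x(1)])
    show "f (C \<oplus>\<^bsub>quotient_module R M M'\<^esub> D) = f C \<oplus>\<^bsub>quotient_module R N N'\<^esub> f D"
      if D: "D \<in> carrier (quotient_module R M M')" for D
    proof -
      obtain y where y: "y \<in> M" "D = M' +> y" using D unfolding simpM(1) by blast
      have "(x \<oplus> y) \<otimes> r = x \<otimes> r \<oplus> y \<otimes> r" using l_distr[OF xc M.Icarr[OF y(1)] r] .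
      then show ?thesis
        unfolding x(2) y(2) simpM(2)[OF x(1) y(1)] f[OF x(1)] f[OF y(1)] f[OF M.a_closed[OF x(1) y(1)]]
          simpN(2)[OF into[OF x(1)] into[OF y(1)]] by simp
    qed
    fix c assume c: "c \<in> carrier R"
    have "(c \<otimes> x) \<otimes> r = c \<otimes> (x \<otimes> r)" using m_assoc[OF c xc r] .
    then show "f (c \<odot>\<^bsub>quotient_module R M M'\<^esub> C) = c \<odot>\<^bsub>quotient_module R N N'\<^esub> f C"
      unfolding x(2) simpM(3)[OF c x(1)] f[OF x(1)] f[OF M.I_l_closed[OF x(1) c]] simpN(3)[OF c into[OF x(1)]] by simp
  qed
qed

lemma left_module_isomorphic_refl: "left_module_isomorphic R M M"
  unfolding left_module_isomorphic_def by (intro exI[of _ id]) simp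

lemma left_module_isomorphic_trans:
  assumes "left_module_isomorphic R M N" "left_module_isomorphic R N N'"
  shows "left_module_isomorphic R M N'"
proof -
  obtain f g where f: "bij_betw f (carrier M) (carrier N)"
      "\<forall>x\<in>carrier M. \<forall>y\<in>carrier M. f (x \<oplus>\<^bsub>M\<^esub> y) = f x \<oplus>\<^bsub>N\<^esub> f y"
      "\<forall>r\<in>carrier R. \<forall>x\<in>carrier M. f (r \<odot>\<^bsub>M\<^esub> x) = r \<odot>\<^bsub>N\<^esub> f x"
    and g: "bij_betw g (carrier N) (carrier N')"
      "\<forall>x\<in>carrier N. \<forall>y\<in>carrier N. g (x \<oplus>\<^bsub>N\<^esub> y) = g x \<oplus>\<^bsub>N'\<^esub> g y"
      "\<forall>r\<in>carrier R. \<forall>x\<in>carrier N. g (r \<odot>\<^bsub>N\<^esub> x) = r \<odot>\<^bsub>N'\<^esub> g x"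
    using assms unfolding left_module_isomorphic_def by blast
  have in_N: "f x \<in> carrier N" if "x \<in> carrier M" for x using f(1) that by (auto simp: bij_betw_def)
  show ?thesis
    unfolding left_module_isomorphic_def
    by (intro exI[of _ "g \<circ> f"] conjI bij_betw_trans[OF f(1) g(1)]) (use f g in_N in simp_all)
qed

lemma left_module_isomorphic_sym:
  assumes iso: "left_module_isomorphic R M N"
    and add: "\<And>x y. x \<in> carrier M \<Longrightarrow> y \<in> carrier M \<Longrightarrow> x \<oplus>\<^bsub>M\<^esub> y \<in> carrier M"
    and smult: "\<And>r x. r \<in> carrier R \<Longrightarrow> x \<in> carrier M \<Longrightarrow> r \<odot>\<^bsub>M\<^esub> x \<in> carrier M"
  shows "left_module_isomorphic R N M"
proof -
  obtain f where f: "bij_betw f (carrier M) (carrier N)"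
      "\<forall>x\<in>carrier M. \<forall>y\<in>carrier M. f (x \<oplus>\<^bsub>M\<^esub> y) = f x \<oplus>\<^bsub>N\<^esub> f y"
      "\<forall>r\<in>carrier R. \<forall>x\<in>carrier M. f (r \<odot>\<^bsub>M\<^esub> x) = r \<odot>\<^bsub>N\<^esub> f x"
    using iso unfolding left_module_isomorphic_def by blast
  define g where "g = inv_into (carrier M) f"
  have g: "bij_betw g (carrier N) (carrier M)" unfolding g_def by (rule bij_betw_inv_into[OF f(1)])
  have gf: "g (f x) = x" if "x \<in> carrier M" for x
    unfolding g_def using bij_betw_inv_into_left[OF f(1) that] .
  have fg: "f (g y) = y" "g y \<in> carrier M" if "y \<in> carrier N" for y
    using bij_betw_inv_into_right[OF f(1) that] g that unfolding g_def by (auto simp: bij_betw_def)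
  show ?thesis
    unfolding left_module_isomorphic_def
  proof (intro exI[of _ g] conjI ballI g)
    fix x y assume "x \<in> carrier N" "y \<in> carrier N"
    then show "g (x \<oplus>\<^bsub>N\<^esub> y) = g x \<oplus>\<^bsub>M\<^esub> g y" using f(2) fg add[of "g x" "g y"] gf[of "g x \<oplus>\<^bsub>M\<^esub> g y"] by metis
  next
    fix r x assume "r \<in> carrier R" "x \<in> carrier N"
    then show "g (r \<odot>\<^bsub>N\<^esub> x) = r \<odot>\<^bsub>M\<^esub> g x" using f(3) fg smult[of r "g x"] gf[of "r \<odot>\<^bsub>M\<^esub> g x"] by metis
  qed
qed

section \<open>The layers of the weak order\<close>

context preprojective
begin

lemma word_ideal_Nil: "word_ideal V Q [] = carrier P"
  and word_ideal_Cons: "word_ideal V Q (i # is) = ideal_prod P (I i) (word_ideal V Q is)"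
  by (simp_all add: word_ideal_def Let_def)

lemma ideal_word_ideal: "is \<in> lists V \<Longrightarrow> ideal (word_ideal V Q is) P"
proof (induction "is")
  case Nil
  show ?case unfolding word_ideal_Nil by (rule P.oneideal)
next
  case (Cons i "is")
  then show ?case unfolding word_ideal_Cons by (intro P.ideal_prod_is_ideal ideal_I) simp_all
qed

lemma carrier_ideal_prod: assumes "ideal M P" shows "ideal_prod P (carrier P) M = M"
proof
  show "ideal_prod P (carrier P) M \<subseteq> M"
    using P.ideal_prod_inter[OF P.oneideal assms] by blast
  show "M \<subseteq> ideal_prod P (carrier P) M"
  proof
    fix x assume x: "x \<in> M"
    have "\<one>\<^bsub>P\<^esub> \<otimes>\<^bsub>P\<^esub> x \<in> ideal_prod P (carrier P) M" by (rule ideal_prod.prod[OF P.one_closed x])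
    then show "x \<in> ideal_prod P (carrier P) M" using ideal.Icarr[OF assms x] by simp
  qed
qed

lemma word_ideal_snoc:
  "is \<in> lists V \<Longrightarrow> i \<in> V \<Longrightarrow> word_ideal V Q (is @ [i]) = ideal_prod P (word_ideal V Q is) (I i)"
proof (induction "is")
  case Nil
  have "word_ideal V Q ([] @ [i]) = ideal_prod P (word_ideal V Q []) (I i)"
    unfolding append_Nil word_ideal_Cons word_ideal_Nil
    using P.ideal_prod_one[OF ideal_I] carrier_ideal_prod[OF ideal_I] Nil.prems by simp
  then show ?case .
next
  case (Cons j "is")
  have "j \<in> V" "is \<in> lists V" using Cons by simp_all
  then have "word_ideal V Q ((j # is) @ [i]) = ideal_prod P (I j) (ideal_prod P (word_ideal V Q is) (I i))"
    unfolding append_Cons word_ideal_Cons using Cons by simp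
  also have "\<dots> = ideal_prod P (word_ideal V Q (j # is)) (I i)"
    unfolding word_ideal_Cons
    by (rule P.ideal_prod_assoc[symmetric]) (use \<open>j \<in> V\<close> \<open>is \<in> lists V\<close> Cons.prems in \<open>simp_all add: ideal_I ideal_word_ideal\<close>)
  finally show ?case .
qed

text \<open>The preimage of the ideal of a word, computed letter by letter on the right; the definition of
\<open>word_ideal\<close> builds it up from the other end.\<close>

definition reds :: "'v list \<Rightarrow> ('v list \<Rightarrow> 'k) set" where
  "reds is = foldl (\<lambda>M i. act.red i M) F is"

lemma reds_Nil: "reds [] = F" and reds_snoc: "reds (is @ [i]) = act.red i (reds is)"
  by (simp_all add: reds_def)

lemma lift_word_ideal: "is \<in> lists V \<Longrightarrow> lift (word_ideal V Q is) = reds is"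
proof (induction "is" rule: rev_induct)
  case Nil
  show ?case unfolding word_ideal_Nil reds_Nil by (rule lift_carrier)
next
  case (snoc i "is")
  then have "is \<in> lists V" "i \<in> V" by simp_all
  then show ?case
    unfolding reds_snoc using word_ideal_snoc lift_ideal_prod[OF ideal_word_ideal] snoc.IH by simp
qed

lemma submodule_reds: "act.submodule (reds is)"
  by (induction "is" rule: rev_induct) (simp_all add: reds_Nil reds_snoc submodule_F act.submodule_red)

end

locale preprojective_weyl = definite_graph V E Q + preprojective V E Q scalars
  for V :: "'v set" and E :: "'v set set" and Q :: "('v \<times> 'v) set" and scalars :: "'k::field itself"
begin

lemma nonedge_nbs: "{i, j} \<notin> E \<Longrightarrow> j \<notin> nbs i" and edge_nbs: "{i, j} \<in> E \<Longrightarrow> j \<in> nbs i"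
  by (simp_all add: nbs_def)

lemma reduced_snoc_descent:
  assumes w: "w \<in> W" and red: "reduced_word V E w (us @ [i])"
  shows "i \<in> V" "- w (\<alpha> i) \<in> pos" "w \<circ> s i \<in> W" "reduced_word V E (w \<circ> s i) us"
proof -
  show i: "i \<in> V" and neg: "- w (\<alpha> i) \<in> pos" using reduced_word_snocD[OF w red] by simp_all
  show ws: "w \<circ> s i \<in> W" by (rule W_comp[OF w s_W[OF i]])
  have asc: "(w \<circ> s i) (\<alpha> i) \<in> pos" using neg descent_s[OF i w] by simp
  show "reduced_word V E (w \<circ> s i) us"
    by (rule iffD1[OF reduced_word_snoc[OF ws i asc, of us, unfolded comp_s_s] red])
qed

lemma red_swap:
  assumes "act.submodule X" "i \<noteq> j" "{i, j} \<notin> E"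
  shows "act.red i (act.red j X) = act.red j (act.red i X)"
proof -
  have "j \<notin> nbs i" "i \<notin> nbs j" using assms(3) nonedge_nbs by (simp_all add: insert_commute)
  then show ?thesis
    using act.red_commute[OF assms(1,2)] act.red_commute[OF assms(1) assms(2)[symmetric]] by auto
qed

text \<open>If two reduced words of \<open>w\<close> end in different letters \<open>i\<close> and \<open>j\<close>, then \<open>w\<close> is the top of a square or a hexagon, and
by induction both words can be replaced by words that go through the bottom of the polygon. These differ
by a commutation or a braid move at the end.\<close>

lemma reds_reduced_unique:
  assumes "w \<in> W" "reduced_word V E w is" "reduced_word V E w js"
  shows "reds is = reds js"
  using assms
proof (induction "length is" arbitrary: w "is" js rule: less_induct)
  case less
  have len: "length is = length js" using less.prems by (simp add: reduced_word_def)
  show ?case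
  proof (cases "is" rule: rev_cases)
    case Nil
    then show ?thesis using len by simp
  next
    case (snoc us i)
    then obtain vs j where js: "js = vs @ [j]" using len by (cases js rule: rev_cases) auto
    note is_red = less.prems(2)[unfolded snoc] and js_red = less.prems(3)[unfolded js]
    note wi = reduced_snoc_descent[OF less.prems(1) is_red] and wj = reduced_snoc_descent[OF less.prems(1) js_red]
    have shorter: "length us < length is" "length vs < length is" using snoc js len by simp_all
    show ?thesis
    proof (cases "i = j")
      case True
      have vs: "reduced_word V E (w \<circ> s i) vs" using wj(4) unfolding True .
      have "reds us = reds vs" by (rule less.hyps[OF shorter(1) wi(3,4) vs])
      then show ?thesis unfolding snoc js reds_snoc True by simp
    next
      case False
      show ?thesis
        using less.prems(1) wi(1) wj(1) False wi(2) wj(2)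
      proof (cases rule: rank2_bottom)
        case (square u)
        obtain xs where xs: "reduced_word V E u xs" using reduced_word_exists[OF square(2)] by blast
        have "reduced_word V E (w \<circ> s i) (xs @ [j])"
          unfolding square(6) by (rule iffD2[OF reduced_word_snoc[OF square(2) wj(1) square(4)] xs])
        then have 1: "reds us = act.red j (reds xs)"
          using less.hyps[OF shorter(1) wi(3,4)] by (simp add: reds_snoc)
        have "reduced_word V E (w \<circ> s j) (xs @ [i])"
          unfolding square(7) by (rule iffD2[OF reduced_word_snoc[OF square(2) wi(1) square(3)] xs])
        then have 2: "reds vs = act.red i (reds xs)"
          using less.hyps[OF shorter(2) wj(3,4)] by (simp add: reds_snoc)
        show ?thesis unfolding snoc js reds_snoc 1 2 by (rule red_swap[OF submodule_reds False square(1)])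
      next
        case (hexagon u)
        have e: "{j, i} \<in> E" using hexagon(1) by (simp add: insert_commute)
        obtain xs where xs: "reduced_word V E u xs" using reduced_word_exists[OF hexagon(2)] by blast
        have ui: "u \<circ> s i \<in> W" "u \<circ> s j \<in> W" by (intro W_comp s_W hexagon(2) wi(1) wj(1))+
        have "reduced_word V E (u \<circ> s i) (xs @ [i])"
          by (rule iffD2[OF reduced_word_snoc[OF hexagon(2) wi(1) hexagon(3)] xs])
        then have "reduced_word V E (w \<circ> s i) ((xs @ [i]) @ [j])"
          unfolding hexagon(6)
          by (rule iffD2[OF reduced_word_snoc[OF ui(1) wj(1) inversions_hexagon(5)[OF hexagon(2,1,3,4)]]])
        then have 1: "reds us = act.red j (act.red i (reds xs))"
          using less.hyps[OF shorter(1) wi(3,4)] reds_snoc by metis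
        have "reduced_word V E (u \<circ> s j) (xs @ [j])"
          by (rule iffD2[OF reduced_word_snoc[OF hexagon(2) wj(1) hexagon(4)] xs])
        then have "reduced_word V E (w \<circ> s j) ((xs @ [j]) @ [i])"
          unfolding hexagon(7)
          by (rule iffD2[OF reduced_word_snoc[OF ui(2) wi(1) inversions_hexagon(5)[OF hexagon(2) e hexagon(4,3)]]])
        then have 2: "reds vs = act.red i (act.red j (reds xs))"
          using less.hyps[OF shorter(2) wj(3,4)] reds_snoc by metis
        show ?thesis unfolding snoc js reds_snoc 1 2
          by (rule act.red_braid[OF submodule_reds edge_nbs[OF e]])
      qed
    qed
  qed
qed

abbreviation ideal_of :: "(('v \<Rightarrow> int) \<Rightarrow> ('v \<Rightarrow> int)) \<Rightarrow> ('v list \<Rightarrow> 'k) set set" where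
  "ideal_of \<equiv> weyl_ideal V E Q"

abbreviation layer :: "(('v \<Rightarrow> int) \<Rightarrow> ('v \<Rightarrow> int)) \<Rightarrow> (('v \<Rightarrow> int) \<Rightarrow> ('v \<Rightarrow> int))
    \<Rightarrow> (('v list \<Rightarrow> 'k) set, ('v list \<Rightarrow> 'k) set set) module" where
  "layer \<equiv> layer_label V E Q"

definition lifted_ideal :: "(('v \<Rightarrow> int) \<Rightarrow> ('v \<Rightarrow> int)) \<Rightarrow> ('v list \<Rightarrow> 'k) set" where
  "lifted_ideal w = lift (ideal_of w)"

lemma reduced_word_lists: "reduced_word V E w is \<Longrightarrow> is \<in> lists V"
  by (simp add: reduced_word_def)

lemma some_reduced: "w \<in> W \<Longrightarrow> reduced_word V E w (SOME is. reduced_word V E w is)"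
  using reduced_word_exists by (rule someI_ex)

lemma ideal_weyl_ideal: "w \<in> W \<Longrightarrow> ideal (ideal_of w) P"
  unfolding weyl_ideal_def by (rule ideal_word_ideal[OF reduced_word_lists[OF some_reduced]])

lemma lifted_ideal_reds: assumes "w \<in> W" "reduced_word V E w is" shows "lifted_ideal w = reds is"
proof -
  note r = some_reduced[OF assms(1)]
  have "lifted_ideal w = reds (SOME is. reduced_word V E w is)"
    unfolding lifted_ideal_def weyl_ideal_def by (rule lift_word_ideal[OF reduced_word_lists[OF r]])
  also have "\<dots> = reds is" by (rule reds_reduced_unique[OF assms(1) r assms(2)])
  finally show ?thesis .
qed

lemma submodule_lifted: "w \<in> W \<Longrightarrow> act.submodule (lifted_ideal w)"
  unfolding lifted_ideal_def by (rule submodule_lift[OF ideal_weyl_ideal])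

lemma lifted_ideal_ascent:
  assumes "w \<in> W" "i \<in> V" "w (\<alpha> i) \<in> pos"
  shows "lifted_ideal (w \<circ> s i) = act.red i (lifted_ideal w)"
proof -
  obtain "is" where r: "reduced_word V E w is" using reduced_word_exists[OF assms(1)] by blast
  then have "reduced_word V E (w \<circ> s i) (is @ [i])" by (rule iffD2[OF reduced_word_snoc[OF assms]])
  then have "lifted_ideal (w \<circ> s i) = reds (is @ [i])"
    by (rule lifted_ideal_reds[OF W_comp[OF assms(1) s_W[OF assms(2)]]])
  then show ?thesis unfolding reds_snoc lifted_ideal_reds[OF assms(1) r] .
qed

text \<open>Induction on the length, with \<open>w = us\<^sub>i\<close> longer than \<open>u\<close>. If \<open>u\<alpha>\<^sub>j > 0\<close>, exactness at \<open>j\<close> passes from \<open>u\<close> to \<open>w\<close>.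
Otherwise \<open>i\<close> and \<open>j\<close> are adjacent and \<open>w = vs\<^sub>js\<^sub>i\<close>, where both \<open>i\<close> and \<open>j\<close> are ascents of \<open>v\<close>, so that \<open>v\<close>
is exact at both vertices.\<close>

theorem exact_lifted_ideal:
  assumes "w \<in> W" "j \<in> V" "w (\<alpha> j) \<in> pos"
  shows "act.exact (lifted_ideal w) j"
  using assms
proof (induction "card (inversions w)" arbitrary: w j rule: less_induct)
  case less
  note w = less.prems(1) and j = less.prems(2)
  show ?case
  proof (cases "\<forall>i\<in>V. w (\<alpha> i) \<in> pos")
    case True
    then have "w = id" using no_descent_id[OF w] by blast
    moreover have "reduced_word V E id []"
      using card_inversions_word[of "[]"] by (simp add: reduced_word_iff)
    ultimately have "lifted_ideal w = F" using lifted_ideal_reds[OF id_W] reds_Nil by metis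
    then show ?thesis using exact_F by (simp only:)
  next
    case False
    then obtain i where i: "i \<in> V" "w (\<alpha> i) \<notin> pos" by blast
    then have neg: "- w (\<alpha> i) \<in> pos" using W_pos_or_neg[OF w simple_root_pos[OF i(1)]] by blast
    have ij: "i \<noteq> j" using i(2) less.prems(3) by blast
    define u where "u = w \<circ> s i"
    have u: "u \<in> W" unfolding u_def by (rule W_comp[OF w s_W[OF i(1)]])
    have ui: "u (\<alpha> i) \<in> pos" using neg descent_s[OF i(1) w] by (simp add: u_def)
    have wu: "w = u \<circ> s i" unfolding u_def by (simp only: comp_s_s)
    have lw: "lifted_ideal w = act.red i (lifted_ideal u)" unfolding wu by (rule lifted_ideal_ascent[OF u i(1) ui])
    have cu: "card (inversions w) = Suc (card (inversions u))"
      unfolding wu by (rule card_inversions_ascent[OF u i(1) ui])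
    show ?thesis
    proof (cases "u (\<alpha> j) \<in> pos")
      case True
      have "act.exact (lifted_ideal u) j" using less.hyps[OF _ u j True] cu by simp
      then show ?thesis unfolding lw by (rule act.exact_red[OF submodule_lifted[OF u] ij])
    next
      case False
      have e: "{i, j} \<in> E"
      proof (rule ccontr)
        assume "{i, j} \<notin> E"
        then have "u (\<alpha> j) = w (\<alpha> j)" unfolding u_def by (rule rank2_roots(1)[OF w _ ij])
        then show False using False less.prems(3) by simp
      qed
      have negj: "- u (\<alpha> j) \<in> pos" using False W_pos_or_neg[OF u simple_root_pos[OF j]] by blast
      define v where "v = u \<circ> s j"
      have v: "v \<in> W" unfolding v_def by (rule W_comp[OF u s_W[OF j]])
      have vj: "v (\<alpha> j) \<in> pos" using negj descent_s[OF j u] by (simp add: v_def)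
      have "v (\<alpha> i) = w (\<alpha> j)" unfolding v_def u_def by (rule rank2_roots(3)[OF w e])
      then have vi: "v (\<alpha> i) \<in> pos" using less.prems(3) by simp
      have uv: "u = v \<circ> s j" unfolding v_def by (simp only: comp_s_s)
      have lu: "lifted_ideal u = act.red j (lifted_ideal v)" unfolding uv by (rule lifted_ideal_ascent[OF v j vj])
      have cv: "card (inversions v) < card (inversions w)"
        using card_inversions_ascent[OF v j vj] cu uv by simp
      show ?thesis unfolding lw lu
        by (rule act.exact_red_red[OF submodule_lifted[OF v] edge_nbs[OF e]
              less.hyps[OF cv v i(1) vi] less.hyps[OF cv v j vj]])
    qed
  qed
qed

lemma layer_iso_by_lift:
  assumes W: "x \<in> W" "y \<in> W" "x' \<in> W" "y' \<in> W" and r: "r \<in> F"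
    and into: "\<And>m. m \<in> lifted_ideal x \<Longrightarrow> conv m r \<in> lifted_ideal x'"
    and kernel: "\<And>m. m \<in> lifted_ideal x \<Longrightarrow> conv m r \<in> lifted_ideal y' \<longleftrightarrow> m \<in> lifted_ideal y"
    and onto: "\<And>n. n \<in> lifted_ideal x' \<Longrightarrow> \<exists>m\<in>lifted_ideal x. n - conv m r \<in> lifted_ideal y'"
  shows "left_module_isomorphic P (layer y x) (layer y' x')"
  unfolding layer_label_def
proof (rule P.quotient_module_iso[where r = "\<pi> r"])
  have lift: "\<exists>m\<in>lifted_ideal w. c = \<pi> m" if "c \<in> ideal_of w" "w \<in> W" for c and w :: "('v \<Rightarrow> int) \<Rightarrow> ('v \<Rightarrow> int)"
    using that lift_image[of "ideal_of w"] ideal.Icarr[OF ideal_weyl_ideal[OF that(2)]]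
    unfolding lifted_ideal_def by blast
  have proj: "\<pi> m \<in> ideal_of w \<longleftrightarrow> m \<in> lifted_ideal w" if "m \<in> F" for m w
    using that by (simp add: lifted_ideal_def lift_def)
  have F: "m \<in> F" if "m \<in> lifted_ideal w" for m w using that by (simp add: lifted_ideal_def lift_def)
  show "ideal (ideal_of x) P" "ideal (ideal_of y) P" "ideal (ideal_of x') P" "ideal (ideal_of y') P"
    by (rule ideal_weyl_ideal[OF W(1)] ideal_weyl_ideal[OF W(2)] ideal_weyl_ideal[OF W(3)] ideal_weyl_ideal[OF W(4)])+
  show "\<pi> r \<in> carrier P" by (rule proj_closed[OF r])
  show "c \<otimes>\<^bsub>P\<^esub> \<pi> r \<in> ideal_of x'" if c: "c \<in> ideal_of x" for c
  proof -
    obtain m where m: "m \<in> lifted_ideal x" "c = \<pi> m" using lift[OF c W(1)] by (elim bexE)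
    show ?thesis
      unfolding m(2) proj_conv[OF F[OF m(1)] r, symmetric] proj[OF conv_closed[OF F[OF m(1)] r]] by (rule into[OF m(1)])
  qed
  show "c \<otimes>\<^bsub>P\<^esub> \<pi> r \<in> ideal_of y' \<longleftrightarrow> c \<in> ideal_of y" if c: "c \<in> ideal_of x" for c
  proof -
    obtain m where m: "m \<in> lifted_ideal x" "c = \<pi> m" using lift[OF c W(1)] by (elim bexE)
    show ?thesis
      unfolding m(2) proj_conv[OF F[OF m(1)] r, symmetric] proj[OF conv_closed[OF F[OF m(1)] r]] proj[OF F[OF m(1)]]
      by (rule kernel[OF m(1)])
  qed
  show "\<exists>c\<in>ideal_of x. d \<ominus>\<^bsub>P\<^esub> c \<otimes>\<^bsub>P\<^esub> \<pi> r \<in> ideal_of y'" if d: "d \<in> ideal_of x'" for d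
  proof -
    obtain n where n: "n \<in> lifted_ideal x'" "d = \<pi> n" using lift[OF d W(3)] by (elim bexE)
    obtain m where m: "m \<in> lifted_ideal x" "n - conv m r \<in> lifted_ideal y'" using onto[OF n(1)] by (elim bexE)
    have "d \<ominus>\<^bsub>P\<^esub> \<pi> m \<otimes>\<^bsub>P\<^esub> \<pi> r = \<pi> (n - conv m r)"
      unfolding n(2) proj_conv[OF F[OF m(1)] r, symmetric]
      by (rule proj_diff[OF F[OF n(1)] conv_closed[OF F[OF m(1)] r], symmetric])
    then have "d \<ominus>\<^bsub>P\<^esub> \<pi> m \<otimes>\<^bsub>P\<^esub> \<pi> r \<in> ideal_of y'"
      using m(2) proj[OF F[OF m(2)]] by simp
    moreover have "\<pi> m \<in> ideal_of x" using m(1) proj[OF F[OF m(1)]] by simp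
    ultimately show ?thesis by (intro bexI[of _ "\<pi> m"])
  qed
qed

lemma layer_iso_sym:
  assumes "x \<in> W" "y \<in> W" and "left_module_isomorphic P (layer y x) N"
  shows "left_module_isomorphic P N (layer y x)"
proof (rule left_module_isomorphic_sym[OF assms(3)])
  note M = ideal_weyl_ideal[OF assms(1)] and N = ideal_weyl_ideal[OF assms(2)]
  interpret M: ideal "ideal_of x" P by (rule M)
  note simps = P.quotient_module_simps[OF M N, folded layer_label_def]
  fix C assume "C \<in> carrier (layer y x)"
  then obtain c where c: "c \<in> ideal_of x" "C = ideal_of y +>\<^bsub>P\<^esub> c" unfolding simps(1) by blast
  show "C \<oplus>\<^bsub>layer y x\<^esub> D \<in> carrier (layer y x)"
    if D: "D \<in> carrier (layer y x)" for D
  proof -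
    obtain d where d: "d \<in> ideal_of x" "D = ideal_of y +>\<^bsub>P\<^esub> d" using D unfolding simps(1) by blast
    show ?thesis unfolding c(2) d(2) simps(2)[OF c(1) d(1)] unfolding simps(1)
      by (rule imageI[OF M.a_closed[OF c(1) d(1)]])
  qed
  show "r \<odot>\<^bsub>layer y x\<^esub> C \<in> carrier (layer y x)" if r: "r \<in> carrier P" for r
    unfolding c(2) simps(3)[OF r c(1)] unfolding simps(1) by (rule imageI[OF M.I_l_closed[OF c(1) r]])
qed

text \<open>Right multiplication by the unit is the inclusion of the smaller ideals.\<close>

lemma layer_iso_square:
  assumes w: "w \<in> W" and ij: "i \<in> V" "j \<in> V" "i \<noteq> j" and e: "{i, j} \<notin> E"
    and x: "w (\<alpha> i) \<in> pos" and y: "w (\<alpha> j) \<in> pos"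
  shows "left_module_isomorphic P (layer (w \<circ> s j \<circ> s i) (w \<circ> s j)) (layer (w \<circ> s i) w)"
proof (rule layer_iso_by_lift[where r = unit_path])
  have wj: "w \<circ> s j \<in> W" by (rule W_comp[OF w s_W[OF ij(2)]])
  have e': "{j, i} \<notin> E" "j \<noteq> i" using e ij by (simp_all add: insert_commute)
  have asc: "(w \<circ> s j) (\<alpha> i) \<in> pos" unfolding rank2_roots(1)[OF w e'] by (rule x)
  let ?M = "lifted_ideal w"
  note M = submodule_lifted[OF w]
  have lj: "lifted_ideal (w \<circ> s j) = act.red j ?M" by (rule lifted_ideal_ascent[OF w ij(2) y])
  have li: "lifted_ideal (w \<circ> s i) = act.red i ?M" by (rule lifted_ideal_ascent[OF w ij(1) x])
  have lji: "lifted_ideal (w \<circ> s j \<circ> s i) = act.red i (act.red j ?M)"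
    unfolding lj[symmetric] by (rule lifted_ideal_ascent[OF wj ij(1) asc])
  note layer_maps = act.layer_square[OF M ij(3) nonedge_nbs[OF e]]
  have one: "conv m unit_path = m" if "m \<in> ?M" for m by (rule conv_one[OF act.M_F[OF M that]])
  show "w \<circ> s j \<in> W" "w \<in> W" by (rule wj, rule w)
  show "w \<circ> s j \<circ> s i \<in> W" "w \<circ> s i \<in> W" by (intro W_comp w s_W ij)+
  show "unit_path \<in> F" using R.one_closed by simp
  show "conv m unit_path \<in> ?M" if "m \<in> lifted_ideal (w \<circ> s j)" for m
  proof -
    have "m \<in> ?M" using that layer_maps(1) unfolding lj by blast
    then show ?thesis using one by simp
  qed
  show "conv m unit_path \<in> lifted_ideal (w \<circ> s i) \<longleftrightarrow> m \<in> lifted_ideal (w \<circ> s j \<circ> s i)"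
    if "m \<in> lifted_ideal (w \<circ> s j)" for m
  proof -
    have m: "m \<in> act.red j ?M" using that unfolding lj .
    then have "m \<in> ?M" using layer_maps(1) by blast
    then show ?thesis unfolding li lji one[OF \<open>m \<in> ?M\<close>] using layer_maps(3)[OF m] by simp
  qed
  show "\<exists>m\<in>lifted_ideal (w \<circ> s j). n - conv m unit_path \<in> lifted_ideal (w \<circ> s i)" if n: "n \<in> ?M" for n
  proof -
    obtain m where m: "m \<in> act.red j ?M" "n - m \<in> act.red i ?M" using layer_maps(2)[OF n] by (elim bexE)
    then have "m \<in> ?M" using layer_maps(1) by blast
    then show ?thesis unfolding li lj using m one by (intro bexI[of _ m]) simp_all
  qed
qed

lemma layer_iso_hexagon:
  assumes w: "w \<in> W" and e: "{i, j} \<in> E" and x: "w (\<alpha> i) \<in> pos" and y: "w (\<alpha> j) \<in> pos"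
  shows "left_module_isomorphic P (layer (w \<circ> s i) w)
           (layer (w \<circ> s j \<circ> s i \<circ> s j) (w \<circ> s j \<circ> s i))"
proof (rule layer_iso_by_lift[where r = "path_basis [i, j]"])
  have ij: "i \<in> V" "j \<in> V" using edge_verts[OF e] by simp_all
  have e': "{j, i} \<in> E" using e by (simp add: insert_commute)
  have W: "w \<circ> s i \<in> W" "w \<circ> s j \<in> W" "w \<circ> s j \<circ> s i \<in> W" "w \<circ> s j \<circ> s i \<circ> s j \<in> W"
    by (intro W_comp w s_W ij)+
  note asc = inversions_hexagon(5,6)[OF w e' y x]
  let ?M = "lifted_ideal w"
  note M = submodule_lifted[OF w]
  have li: "lifted_ideal (w \<circ> s i) = act.red i ?M" by (rule lifted_ideal_ascent[OF w ij(1) x])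
  have lj: "lifted_ideal (w \<circ> s j) = act.red j ?M" by (rule lifted_ideal_ascent[OF w ij(2) y])
  have lji: "lifted_ideal (w \<circ> s j \<circ> s i) = act.red i (act.red j ?M)"
    unfolding lj[symmetric] by (rule lifted_ideal_ascent[OF W(2) ij(1) asc(1)])
  have ljij: "lifted_ideal (w \<circ> s j \<circ> s i \<circ> s j) = act.red j (act.red i (act.red j ?M))"
    unfolding lji[symmetric] by (rule lifted_ideal_ascent[OF W(3) ij(2) asc(2)])
  note layer_maps = act.layer_hexagon[OF M edge_nbs[OF e] exact_lifted_ideal[OF w ij(2) y]]
  show "w \<in> W" "w \<circ> s i \<in> W" "w \<circ> s j \<circ> s i \<in> W" "w \<circ> s j \<circ> s i \<circ> s j \<in> W" by (rule w W)+
  show "path_basis [i, j] \<in> F" by (rule basis_arrow[OF e])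
  show "conv m (path_basis [i, j]) \<in> lifted_ideal (w \<circ> s j \<circ> s i)" if "m \<in> ?M" for m
    unfolding conv_arrow lji by (rule layer_maps(1)[OF that])
  show "conv m (path_basis [i, j]) \<in> lifted_ideal (w \<circ> s j \<circ> s i \<circ> s j) \<longleftrightarrow> m \<in> lifted_ideal (w \<circ> s i)" if "m \<in> ?M" for m
    unfolding conv_arrow ljij li by (rule layer_maps(2)[OF that])
  show "\<exists>m\<in>?M. n - conv m (path_basis [i, j]) \<in> lifted_ideal (w \<circ> s j \<circ> s i \<circ> s j)"
    if "n \<in> lifted_ideal (w \<circ> s j \<circ> s i)" for n
    unfolding conv_arrow ljij by (rule layer_maps(3)[OF that[unfolded lji]])
qed

theorem congruent_arrows_same_layer:
  assumes "covers L y x" "covers L y' x'" "con L y x = con L y' x'"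
  shows "left_module_isomorphic P (layer y x) (layer y' x')"
proof -
  define lay where "lay e = layer (snd e) (fst e)" for e
  define sim where "sim e f \<longleftrightarrow> left_module_isomorphic P (lay e) (lay f) \<and> left_module_isomorphic P (lay f) (lay e)" for e f
  have "sim (x, y) (x', y')"
  proof (rule congruence_determines_class[where sim = sim, OF _ _ _ _ _ assms])
    show "sim e e" for e unfolding sim_def using left_module_isomorphic_refl by blast
    show "sim e f \<Longrightarrow> sim f e" for e f unfolding sim_def by blast
    show "sim e f \<Longrightarrow> sim f g \<Longrightarrow> sim e g" for e f g unfolding sim_def using left_module_isomorphic_trans by blast
  next
    fix w i j assume h: "w \<in> W" "i \<in> V" "j \<in> V" "i \<noteq> j" "{i, j} \<notin> E" "w (\<alpha> i) \<in> pos" "w (\<alpha> j) \<in> pos"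
    have W: "w \<circ> s j \<in> W" "w \<circ> s j \<circ> s i \<in> W" by (intro W_comp s_W h)+
    note iso = layer_iso_square[OF h]
    show "sim (w, w \<circ> s i) (w \<circ> s j, w \<circ> s j \<circ> s i)"
      unfolding sim_def lay_def fst_conv snd_conv by (intro conjI layer_iso_sym[OF W iso] iso)
  next
    fix w i j assume h: "w \<in> W" "{i, j} \<in> E" "w (\<alpha> i) \<in> pos" "w (\<alpha> j) \<in> pos"
    have "i \<in> V" using edge_verts[OF h(2)] by simp
    then have W: "w \<circ> s i \<in> W" by (intro W_comp s_W h)
    note iso = layer_iso_hexagon[OF h]
    show "sim (w, w \<circ> s i) (w \<circ> s j \<circ> s i, w \<circ> s j \<circ> s i \<circ> s j)"
      unfolding sim_def lay_def fst_conv snd_conv by (intro conjI layer_iso_sym[OF h(1) W iso] iso)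
  qed
  then show ?thesis unfolding sim_def lay_def fst_conv snd_conv by blast
qed

end

theorem theorem1p3:
  fixes V :: "'v set" and E :: "'v set set" and Q :: "('v \<times> 'v) set"
    and P :: "('v list \<Rightarrow> 'k::field) set ring"
    and w j :: "('v \<Rightarrow> int) \<Rightarrow> ('v \<Rightarrow> int)" and i :: 'v
  assumes "simply_laced_dynkin V E"
    and "orientation E Q"
    and "P = preprojective_algebra V Q"
    and "w \<in> weyl_group V E" and "i \<in> V"
    and "covers (weak_order V E) (w \<circ> simple_reflection E i) w"
    and "join_irreducible_label (weak_order V E) (w \<circ> simple_reflection E i) w j"
  shows "left_module_isomorphic P
           (layer_label V E Q (w \<circ> simple_reflection E i) w)
           (quotient_module P (weyl_ideal V E Q (lower_cover (weak_order V E) j))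
                              (weyl_ideal V E Q j))"
proof -
  interpret definite_graph V E Q by (rule dynkin_definite_graph[OF assms(1,2)])
  interpret preprojective_weyl V E Q "TYPE('k)" ..
  have j: "join_irreducible L j" "con L j (lower_cover L j) = con L (w \<circ> s i) w"
    using assms(7) by (simp_all only: join_irreducible_label_def)
  have "\<exists>!y. covers L j y" using j(1) by (simp only: join_irreducible_def)
  then have "covers L j (lower_cover L j)" unfolding lower_cover_def by (rule theI')
  then show ?thesis
    unfolding assms(3)
    using congruent_arrows_same_layer[OF assms(6) _ j(2)[symmetric]] by (simp only: layer_label_def)
qed

end
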